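(* (Generalized Karhunen-Loève theorem.) Let $a<b$ be real, let $Y=(Y_t)_{t\in[a,b]}$ be a continuous centered Gaussian process with covariance function $R(s,t)=\mathbb E[Y_sY_t]$, and let $\nu$ be a positive finite Borel measure on $[a,b]$ with support $C\subset[a,b]$. Let $(\lambda_k)_{k\ge1}$ be the eigenvalues of the operator $A_R:L_2([a,b],\nu)\to L_2([a,b],\nu)$, $(A_Re)(t)=\int_a^bR(s,t)e(s)\,\nu(ds)$, and let $(e_k)_{k\ge1}$ be the corresponding orthonormalized eigenfunctions. Then $$Y_t=\sum_{k=1}^\infty Z_ke_k(t)\qquad\text{with}\qquad Z_k=\int_a^bY_se_k(s)\,\nu(ds),$$ where the convergence is almost surely uniform in $t$ for all $t\in C$. Moreover, $(Z_k)_{k\ge1}$ is a sequence of independent centered normally distributed random variables with $\mathbb E[Z_k^2]=\lambda_k$.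
   Context: The operator $A_R$ is bounded, compact, self-adjoint and non-negative definite on $L_2([a,b],\nu)$, so its eigenvalues are real and non-negative, and (counting multiplicities) $A_Re=\sum_{k}\lambda_k\langle e_k,e\rangle e_k$ with $\langle\cdot,\cdot\rangle$ the scalar product of $L_2([a,b],\nu)$. For $\lambda_k>0$ the eigenfunction $e_k$ is taken to be its continuous version $e_k(t)=\lambda_k^{-1}\int_a^bR(s,t)e_k(s)\,\nu(ds)$, $t\in[a,b]$. If $L_2([a,b],\nu)$ is finite dimensional, the sequences and the sum are finite. A centered normal random variable with variance $0$ is the constant $0$. *)

theory Defs
  imports "HOL-Probability.Probability" "HOL-Library.Extended_Nat"
begin

text \<open>The second alternative covers variance \<open>0\<close>, where the law has no density.\<close>
definition centered_normal :: "'w measure \<Rightarrow> ('w \<Rightarrow> real) \<Rightarrow> bool" where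
  "centered_normal M X \<longleftrightarrow>
     (\<exists>\<sigma>>0. distributed M lborel X (normal_density 0 \<sigma>)) \<or>
     (X \<in> borel_measurable M \<and> (AE \<omega> in M. X \<omega> = 0))"

definition centered_gaussian_process ::
  "'w measure \<Rightarrow> real set \<Rightarrow> (real \<Rightarrow> 'w \<Rightarrow> real) \<Rightarrow> bool" where
  "centered_gaussian_process M T Y \<longleftrightarrow>
     (\<forall>F c. finite F \<longrightarrow> F \<subseteq> T \<longrightarrow> centered_normal M (\<lambda>\<omega>. \<Sum>t\<in>F. c t * Y t \<omega>))"

definition continuous_process ::
  "'w measure \<Rightarrow> real set \<Rightarrow> (real \<Rightarrow> 'w \<Rightarrow> real) \<Rightarrow> bool" where
  "continuous_process M T Y \<longleftrightarrow> (\<forall>\<omega>\<in>space M. continuous_on T (\<lambda>t. Y t \<omega>))"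

definition measure_support :: "real measure \<Rightarrow> real set" where
  "measure_support \<nu> =
     {x \<in> space \<nu>. \<forall>U. open U \<longrightarrow> x \<in> U \<longrightarrow> 0 < emeasure \<nu> (U \<inter> space \<nu>)}"

text \<open>Elements of \<open>L\<^sub>2(\<nu>)\<close> are handled through representatives; equality in \<open>L\<^sub>2(\<nu>)\<close>
  is \<open>\<nu>\<close>-almost everywhere equality.\<close>
definition in_L2 :: "real measure \<Rightarrow> (real \<Rightarrow> real) \<Rightarrow> bool" where
  "in_L2 \<nu> f \<longleftrightarrow> f \<in> borel_measurable \<nu> \<and> integrable \<nu> (\<lambda>x. (f x)\<^sup>2)"

definition L2_scalar :: "real measure \<Rightarrow> (real \<Rightarrow> real) \<Rightarrow> (real \<Rightarrow> real) \<Rightarrow> real" where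
  "L2_scalar \<nu> f g = (\<integral>x. f x * g x \<partial>\<nu>)"

definition kernel_operator ::
  "real measure \<Rightarrow> (real \<Rightarrow> real \<Rightarrow> real) \<Rightarrow> (real \<Rightarrow> real) \<Rightarrow> real \<Rightarrow> real" where
  "kernel_operator \<nu> R f t = (\<integral>s. R s t * f s \<partial>\<nu>)"

definition eigen_equation ::
  "real measure \<Rightarrow> (real \<Rightarrow> real \<Rightarrow> real) \<Rightarrow> real \<Rightarrow> (real \<Rightarrow> real) \<Rightarrow> bool" where
  "eigen_equation \<nu> R \<mu> f \<longleftrightarrow> in_L2 \<nu> f \<and> (AE t in \<nu>. kernel_operator \<nu> R f t = \<mu> * f t)"

text \<open>Sequences are indexed by \<open>1, \<dots>, N\<close>, with \<open>N = \<infinity>\<close> for infinite sequences.\<close>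
definition index_set :: "enat \<Rightarrow> nat set" where
  "index_set N = {k. 1 \<le> k \<and> enat k \<le> N}"

text \<open>An enumeration of the eigenvalues, repeated according to multiplicity, with orthonormal
  eigenfunctions. The third conjunct says that every nonzero eigenvalue is listed with its full
  multiplicity: the listed eigenfunctions for \<open>\<mu>\<close> are a maximal orthonormal system in the
  eigenspace of \<open>\<mu>\<close>. The eigenvalue \<open>0\<close> may be listed any number of times, so both the reading
  as a complete orthonormal system of \<open>L\<^sub>2(\<nu>)\<close> and the one listing only the positive eigenvalues
  are instances. The last conjunct selects the continuous version of \<open>e k\<close> when \<open>lam k > 0\<close>.\<close>
definition eigensystem ::
  "real measure \<Rightarrow> (real \<Rightarrow> real \<Rightarrow> real) \<Rightarrow> enat \<Rightarrow> (nat \<Rightarrow> real) \<Rightarrow> (nat \<Rightarrow> real \<Rightarrow> real) \<Rightarrow> bool"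
where
  "eigensystem \<nu> R N lam e \<longleftrightarrow>
     (\<forall>k\<in>index_set N. eigen_equation \<nu> R (lam k) (e k)) \<and>
     (\<forall>j\<in>index_set N. \<forall>k\<in>index_set N. L2_scalar \<nu> (e j) (e k) = (if j = k then 1 else 0)) \<and>
     (\<forall>\<mu> f. \<mu> \<noteq> 0 \<longrightarrow> eigen_equation \<nu> R \<mu> f \<longrightarrow>
        (\<forall>k\<in>index_set N. lam k = \<mu> \<longrightarrow> L2_scalar \<nu> (e k) f = 0) \<longrightarrow> (AE t in \<nu>. f t = 0)) \<and>
     (\<forall>k\<in>index_set N. 0 < lam k \<longrightarrow>
        (\<forall>t\<in>space \<nu>. e k t = inverse (lam k) * kernel_operator \<nu> R (e k) t))"

end

theory Submission
  imports Defs "HOL-Complex_Analysis.Great_Picard"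
begin

text \<open>All random variables considered lie in the space of pointwise limits of linear combinations of
  the \<open>Y t\<close>; since limits of centered normal variables are normal with convergent variances, this is a
  space of jointly Gaussian variables, and every joint law is determined by covariances.

  Pointwise convergence: the Rayleigh quotient of \<open>A\<close> on the complement of finitely many
  \<open>e k\<close> is bounded by the largest remaining eigenvalue, which tends to \<open>0\<close> because the trace is finite.
  Testing with normalized indicators of small balls around a point \<open>t\<close> of the support shows that the
  residual \<open>W n t = Y t - (\<Sum>k\<le>n. Z k * e k t)\<close> has variance tending to \<open>0\<close>.

  Uniform convergence: \<open>W n\<close> is independent of \<open>Y - W n\<close>, so \<open>Y - 2 * W n\<close> has the law of \<open>Y\<close>.
  Hence \<open>W n\<close>, half the difference of the two, is equicontinuous in probability and tends to \<open>0\<close>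
  uniformly in probability. A reflection inequality of Levy type upgrades this to almost sure
  convergence.\<close>

section \<open>Uniqueness of joint laws\<close>

text \<open>Convergence of variances, even uniformly in \<open>t\<close>, does not control a
  supremum over paths, and no bounds on the growth of the \<open>e k\<close> are at hand. What is
  needed is a modulus of continuity of the residuals that does not depend on the truncation, and its
  source is the law of \<open>Y\<close> itself. This is why equality of joint laws is established
  for infinite families. The list of eigenfunctions is not assumed to span:
  \<open>eigensystem\<close> only says that every nonzero eigenspace is exhausted, so an
  eigenfunction outside the list has to be constructed by compactness before the Rayleigh bound is
  available. Convergence is restricted to the support because the integrals against \<nu> see
  \<open>Y\<close> only there; elsewhere the residual variance can stay positive. Limits defining
  the Gaussian space are taken at every sample point, so that its members are functions rather than
  classes and continuity of paths can be used directly.\<close>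

lemma pos_weighted_law_eqI:
  fixes X :: "'a \<Rightarrow> real" and X' :: "'b \<Rightarrow> real" and p :: "'a \<Rightarrow> real" and p' :: "'b \<Rightarrow> real"
  assumes "prob_space M" "prob_space M'"
    and [measurable]: "X \<in> borel_measurable M" "X' \<in> borel_measurable M'"
      "p \<in> borel_measurable M" "p' \<in> borel_measurable M'"
    and p: "\<And>\<omega>. 1 \<le> p \<omega>" "\<And>\<omega>. p \<omega> \<le> B" and p': "\<And>\<omega>. 1 \<le> p' \<omega>" "\<And>\<omega>. p' \<omega> \<le> B"
    and char: "\<And>s. (\<integral>\<omega>. p \<omega> *\<^sub>R iexp (s * X \<omega>) \<partial>M) = (\<integral>\<omega>. p' \<omega> *\<^sub>R iexp (s * X' \<omega>) \<partial>M')"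
    and A[measurable]: "A \<in> sets borel"
  shows "(\<integral>\<omega>. p \<omega> * indicator A (X \<omega>) \<partial>M) = (\<integral>\<omega>. p' \<omega> * indicator A (X' \<omega>) \<partial>M')"
proof -
  \<comment> \<open>Stated for a space of its own type, so that it serves both sides. The weight
    divided by its mean is a density, and the weighted characteristic function is the mean times
    that of \<open>X\<close> under the new measure. The bound \<open>1 \<le> p\<close> keeps the
    mean positive.\<close>
  have *: "\<exists>D. real_distribution D \<and> (\<forall>s. char D s = (\<integral>\<omega>. p \<omega> *\<^sub>R iexp (s * X \<omega>) \<partial>M) / (\<integral>\<omega>. p \<omega> \<partial>M))
      \<and> measure D A = (\<integral>\<omega>. p \<omega> * indicator A (X \<omega>) \<partial>M) / (\<integral>\<omega>. p \<omega> \<partial>M) \<and> (\<integral>\<omega>. p \<omega> \<partial>M) > 0"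
    if "prob_space M" and [measurable]: "X \<in> borel_measurable M" "p \<in> borel_measurable M"
      and p: "\<And>\<omega>. 1 \<le> p \<omega>" "\<And>\<omega>. p \<omega> \<le> B"
    for M :: "'c measure" and X p :: "'c \<Rightarrow> real"
  proof -
    interpret prob_space M by fact
    have ip: "integrable M p"
      by (rule integrable_const_bound[where B=B]) (intro AE_I2, simp add: abs_le_iff, smt (verit) p, simp)
    define m where "m = (\<integral>\<omega>. p \<omega> \<partial>M)"
    have m1: "1 \<le> m" unfolding m_def
      using integral_mono[of M "\<lambda>_. 1" p] ip p by (simp add: prob_space)
    define Q where "Q = density M (\<lambda>\<omega>. ennreal (p \<omega> / m))"
    have nn: "0 \<le> p \<omega> / m" for \<omega> using p(1)[of \<omega>] m1 by auto
    have "emeasure Q (space Q) = 1"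
      unfolding Q_def using m1 ip
      by (subst emeasure_density)
        (auto simp: nn_integral_eq_integral nn m_def[symmetric] cong: nn_integral_cong)
    then interpret Q: prob_space Q by (rule prob_spaceI)
    have [measurable]: "X \<in> borel_measurable Q" unfolding Q_def by measurable
    have rd: "real_distribution (distr Q borel X)"
      by (rule Q.real_distribution_distr) measurable
    have "char (distr Q borel X) s = (\<integral>\<omega>. p \<omega> *\<^sub>R iexp (s * X \<omega>) \<partial>M) / m" for s
    proof -
      have "char (distr Q borel X) s = (\<integral>\<omega>. iexp (s * X \<omega>) \<partial>Q)"
        unfolding char_def by (rule integral_distr) measurable
      also have "\<dots> = (\<integral>\<omega>. (p \<omega> / m) *\<^sub>R iexp (s * X \<omega>) \<partial>M)"
        unfolding Q_def by (rule integral_density) (use nn in auto)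
      also have "\<dots> = (\<integral>\<omega>. (1/m) *\<^sub>R (p \<omega> *\<^sub>R iexp (s * X \<omega>)) \<partial>M)"
        by (simp add: field_simps)
      also have "\<dots> = (\<integral>\<omega>. p \<omega> *\<^sub>R iexp (s * X \<omega>) \<partial>M) / m"
        by (subst integral_scaleR_right) (simp add: scaleR_conv_of_real field_simps)
      finally show ?thesis .
    qed
    moreover have "measure (distr Q borel X) A = (\<integral>\<omega>. p \<omega> * indicator A (X \<omega>) \<partial>M) / m"
    proof -
      have "measure (distr Q borel X) A = (\<integral>x. indicator A x \<partial>distr Q borel X)"
        by simp
      also have "\<dots> = (\<integral>\<omega>. indicator A (X \<omega>) \<partial>Q)"
        by (rule integral_distr) measurable
      also have "\<dots> = (\<integral>\<omega>. (p \<omega> / m) *\<^sub>R indicator A (X \<omega>) \<partial>M)"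
        unfolding Q_def by (rule integral_density) (use nn in auto)
      also have "\<dots> = (\<integral>\<omega>. p \<omega> * indicator A (X \<omega>) \<partial>M) / m"
        by simp
      finally show ?thesis .
    qed
    ultimately show ?thesis using rd m1 unfolding m_def[symmetric] by (intro exI[of _ "distr Q borel X"]) auto
  qed
  obtain D where D: "real_distribution D" "\<And>s. char D s = (\<integral>\<omega>. p \<omega> *\<^sub>R iexp (s * X \<omega>) \<partial>M) / (\<integral>\<omega>. p \<omega> \<partial>M)"
      "measure D A = (\<integral>\<omega>. p \<omega> * indicator A (X \<omega>) \<partial>M) / (\<integral>\<omega>. p \<omega> \<partial>M)" "(\<integral>\<omega>. p \<omega> \<partial>M) > 0"
    using *[OF assms(1) assms(3,5) p] by blast
  obtain D' where D': "real_distribution D'" "\<And>s. char D' s = (\<integral>\<omega>. p' \<omega> *\<^sub>R iexp (s * X' \<omega>) \<partial>M') / (\<integral>\<omega>. p' \<omega> \<partial>M')"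
      "measure D' A = (\<integral>\<omega>. p' \<omega> * indicator A (X' \<omega>) \<partial>M') / (\<integral>\<omega>. p' \<omega> \<partial>M')" "(\<integral>\<omega>. p' \<omega> \<partial>M') > 0"
    using *[OF assms(2) assms(4,6) p'] by blast
  \<comment> \<open>At frequency 0 the hypothesis compares the total masses.\<close>
  have "complex_of_real (\<integral>\<omega>. p \<omega> \<partial>M) = complex_of_real (\<integral>\<omega>. p' \<omega> \<partial>M')"
    using char[of 0] by (simp add: scaleR_conv_of_real)
  then have m: "(\<integral>\<omega>. p \<omega> \<partial>M) = (\<integral>\<omega>. p' \<omega> \<partial>M')" by simp
  have "D = D'"
    using D D' m char by (intro Levy_uniqueness) auto
  then show ?thesis using D D' m by auto
qed

text \<open>A signed weight becomes admissible after adding 2, since \<open>2 + u\<close> lies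
  between 1 and 3. The contribution of the constant is then removed with the case of the constant
  weight 1.\<close>

lemma weighted_law_eqI:
  fixes X :: "'a \<Rightarrow> real" and X' :: "'b \<Rightarrow> real" and u :: "'a \<Rightarrow> real" and u' :: "'b \<Rightarrow> real"
  assumes "prob_space M" "prob_space M'"
    and [measurable]: "X \<in> borel_measurable M" "X' \<in> borel_measurable M'"
      "u \<in> borel_measurable M" "u' \<in> borel_measurable M'"
    and u: "\<And>\<omega>. \<bar>u \<omega>\<bar> \<le> 1" and u': "\<And>\<omega>. \<bar>u' \<omega>\<bar> \<le> 1"
    and char: "\<And>s. (\<integral>\<omega>. iexp (s * X \<omega>) \<partial>M) = (\<integral>\<omega>. iexp (s * X' \<omega>) \<partial>M')"
    and wchar: "\<And>s. (\<integral>\<omega>. u \<omega> *\<^sub>R iexp (s * X \<omega>) \<partial>M) = (\<integral>\<omega>. u' \<omega> *\<^sub>R iexp (s * X' \<omega>) \<partial>M')"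
    and A[measurable]: "A \<in> sets borel"
  shows "(\<integral>\<omega>. u \<omega> * indicator A (X \<omega>) \<partial>M) = (\<integral>\<omega>. u' \<omega> * indicator A (X' \<omega>) \<partial>M')"
proof -
  interpret M: prob_space M by fact
  interpret M': prob_space M' by fact
  have i: "integrable M (\<lambda>\<omega>. u \<omega> *\<^sub>R iexp (s * X \<omega>))" "integrable M (\<lambda>\<omega>. iexp (s * X \<omega>))" 
    "integrable M (\<lambda>\<omega>. u \<omega> * indicator A (X \<omega>))" "integrable M (\<lambda>\<omega>. indicator A (X \<omega>) :: real)" for s
    by (rule M.integrable_const_bound[where B=1], use u in \<open>auto simp: indicator_def\<close>)+
  have i': "integrable M' (\<lambda>\<omega>. u' \<omega> *\<^sub>R iexp (s * X' \<omega>))" "integrable M' (\<lambda>\<omega>. iexp (s * X' \<omega>))" 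
    "integrable M' (\<lambda>\<omega>. u' \<omega> * indicator A (X' \<omega>))" "integrable M' (\<lambda>\<omega>. indicator A (X' \<omega>) :: real)" for s
    by (rule M'.integrable_const_bound[where B=1], use u' in \<open>auto simp: indicator_def\<close>)+
  have 1: "(\<integral>\<omega>. 1 * indicator A (X \<omega>) \<partial>M) = (\<integral>\<omega>. 1 * indicator A (X' \<omega>) \<partial>M' :: real)"
    by (rule pos_weighted_law_eqI[where B=1]) (use assms in auto)
  have 2: "(\<integral>\<omega>. (2 + u \<omega>) * indicator A (X \<omega>) \<partial>M) = (\<integral>\<omega>. (2 + u' \<omega>) * indicator A (X' \<omega>) \<partial>M')"
  proof (rule pos_weighted_law_eqI[where B=3])
    show "1 \<le> 2 + u \<omega>" "2 + u \<omega> \<le> 3" for \<omega> using u[of \<omega>] by auto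
    show "1 \<le> 2 + u' \<omega>" "2 + u' \<omega> \<le> 3" for \<omega> using u'[of \<omega>] by auto
    show "(\<integral>\<omega>. (2 + u \<omega>) *\<^sub>R iexp (s * X \<omega>) \<partial>M) = (\<integral>\<omega>. (2 + u' \<omega>) *\<^sub>R iexp (s * X' \<omega>) \<partial>M')" for s
      using i i' char[of s] wchar[of s] by (simp add: scaleR_left_distrib)
  qed (use assms in auto)
  show ?thesis using 1 2 i i' by (simp add: distrib_right)
qed

text \<open>Kac's device: replacing one factor \<open>iexp (c j * X j)\<close> after the other by an indicator
  reduces uniqueness of the joint law to Levy's one-dimensional theorem, applied with the
  remaining factors as a weight.\<close>
lemma partial_char_eq:
  fixes X :: "'i \<Rightarrow> 'a \<Rightarrow> real" and X' :: "'i \<Rightarrow> 'b \<Rightarrow> real"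
  assumes M: "prob_space M" "prob_space M'"
    and X: "\<And>j. j \<in> J \<Longrightarrow> X j \<in> borel_measurable M" "\<And>j. j \<in> J \<Longrightarrow> X' j \<in> borel_measurable M'"
    and char: "\<And>F c. finite F \<Longrightarrow> F \<subseteq> J \<Longrightarrow>
      (\<integral>\<omega>. iexp (\<Sum>j\<in>F. c j * X j \<omega>) \<partial>M) = (\<integral>\<omega>. iexp (\<Sum>j\<in>F. c j * X' j \<omega>) \<partial>M')"
    and A: "\<And>j. j \<in> G \<Longrightarrow> A j \<in> sets borel"
    and "finite G" "G \<subseteq> J" "finite F" "F \<subseteq> J" "F \<inter> G = {}"
  shows "(\<integral>\<omega>. (\<Prod>j\<in>G. indicator (A j) (X j \<omega>)) *\<^sub>R iexp (\<Sum>j\<in>F. c j * X j \<omega>) \<partial>M)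
    = (\<integral>\<omega>. (\<Prod>j\<in>G. indicator (A j) (X' j \<omega>)) *\<^sub>R iexp (\<Sum>j\<in>F. c j * X' j \<omega>) \<partial>M')"
  using assms(7-11) A
proof (induction G arbitrary: F c rule: finite_induct)
  case empty
  then show ?case using char by simp
next
  case (insert g G)
  interpret M: prob_space M by fact
  interpret M': prob_space M' by fact
  have gF: "g \<notin> F" and gJ: "g \<in> J" using insert.prems by auto
  have [measurable]: "\<And>j. j \<in> F \<Longrightarrow> X j \<in> borel_measurable M" "\<And>j. j \<in> F \<Longrightarrow> X' j \<in> borel_measurable M'"
    "\<And>j. j \<in> G \<Longrightarrow> X j \<in> borel_measurable M" "\<And>j. j \<in> G \<Longrightarrow> X' j \<in> borel_measurable M'"
    "\<And>j. j \<in> G \<Longrightarrow> A j \<in> sets borel"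
    "X g \<in> borel_measurable M" "X' g \<in> borel_measurable M'" "A g \<in> sets borel"
    using insert.prems X by auto
  define P where "P = (\<lambda>\<omega>. \<Prod>j\<in>G. indicator (A j) (X j \<omega>) :: real)"
  define P' where "P' = (\<lambda>\<omega>. \<Prod>j\<in>G. indicator (A j) (X' j \<omega>) :: real)"
  define W where "W = (\<lambda>c \<omega>. \<Sum>j\<in>F. c j * X j \<omega>)"
  define W' where "W' = (\<lambda>c \<omega>. \<Sum>j\<in>F. c j * X' j \<omega>)"
  have [measurable]: "P \<in> borel_measurable M" "P' \<in> borel_measurable M'"
    "W c \<in> borel_measurable M" "W' c \<in> borel_measurable M'" for c
    unfolding P_def P'_def W_def W'_def by measurable
  have P01: "0 \<le> P \<omega>" "P \<omega> \<le> 1" for \<omega> unfolding P_def by (auto intro!: prod_nonneg prod_le_1)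
  have P'01: "0 \<le> P' \<omega>" "P' \<omega> \<le> 1" for \<omega> unfolding P'_def by (auto intro!: prod_nonneg prod_le_1)
  \<comment> \<open>The induction hypothesis for the frequency set enlarged by \<open>g\<close>:
    there the factor to be replaced is still an exponential, with a free frequency
    \<open>s\<close>.\<close>
  have IH: "(\<integral>\<omega>. P \<omega> *\<^sub>R iexp (W c \<omega> + s * X g \<omega>) \<partial>M) = (\<integral>\<omega>. P' \<omega> *\<^sub>R iexp (W' c \<omega> + s * X' g \<omega>) \<partial>M')" for c s
  proof -
    have "(\<Sum>j\<in>F. (c(g := s)) j * X j \<omega>) = W c \<omega>" "(\<Sum>j\<in>F. (c(g := s)) j * X' j \<omega>') = W' c \<omega>'" for \<omega> \<omega>'
      unfolding W_def W'_def using gF by (auto intro!: sum.cong)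
    moreover have "(\<integral>\<omega>. P \<omega> *\<^sub>R iexp (\<Sum>j\<in>insert g F. (c(g := s)) j * X j \<omega>) \<partial>M)
      = (\<integral>\<omega>. P' \<omega> *\<^sub>R iexp (\<Sum>j\<in>insert g F. (c(g := s)) j * X' j \<omega>) \<partial>M')"
      unfolding P_def P'_def using insert.prems insert.hyps by (intro insert.IH) auto
    ultimately show ?thesis
      using gF insert.prems by (simp add: add.commute)
  qed
  have neg: "W (\<lambda>j. - c j) \<omega> = - W c \<omega>" "W' (\<lambda>j. - c j) \<omega>' = - W' c \<omega>'" for c \<omega> \<omega>'
    unfolding W_def W'_def by (auto simp: sum_negf)
  have ib: "integrable M (\<lambda>\<omega>. P \<omega> *\<^sub>R iexp (W c \<omega> + s * X g \<omega>))" for c s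
    by (rule M.integrable_const_bound[where B=1]) (use P01 in auto)
  have ib': "integrable M' (\<lambda>\<omega>. P' \<omega> *\<^sub>R iexp (W' c \<omega> + s * X' g \<omega>))" for c s
    by (rule M'.integrable_const_bound[where B=1]) (use P'01 in auto)
  \<comment> \<open>The weight \<open>P * iexp W\<close> is complex, while weights have to be real
    and bounded. Its real and imaginary parts are combinations of exponentials with the frequencies
    \<open>c\<close> and \<open>- c\<close>, which the induction hypothesis covers.\<close>
  have cs: "(p * cos w) *\<^sub>R iexp x = (1/2) *\<^sub>R (p *\<^sub>R iexp (w + x) + p *\<^sub>R iexp (- w + x))"
      "(p * sin w) *\<^sub>R iexp x = (- \<i> / 2) * (p *\<^sub>R iexp (w + x) - p *\<^sub>R iexp (- w + x))" for p w x :: real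
    by (simp_all add: complex_eq_iff Re_exp Im_exp cos_add sin_add cos_diff sin_diff field_simps)
  have "(\<integral>\<omega>. iexp (s * X g \<omega>) \<partial>M) = (\<integral>\<omega>. iexp (s * X' g \<omega>) \<partial>M')" for s
    using char[of "{g}" "\<lambda>_. s"] gJ by simp
  note law = weighted_law_eqI[OF M _ _ _ _ _ _ this]
  have cos_eq: "(\<integral>\<omega>. (P \<omega> * cos (W c \<omega>)) * indicator (A g) (X g \<omega>) \<partial>M)
      = (\<integral>\<omega>. (P' \<omega> * cos (W' c \<omega>)) * indicator (A g) (X' g \<omega>) \<partial>M')"
  proof (rule law)
    show "\<bar>P \<omega> * cos (W c \<omega>)\<bar> \<le> 1" for \<omega>
      using P01[of \<omega>] by (auto simp: abs_mult intro!: mult_le_one)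
    show "\<bar>P' \<omega> * cos (W' c \<omega>)\<bar> \<le> 1" for \<omega>
      using P'01[of \<omega>] by (auto simp: abs_mult intro!: mult_le_one)
    show "(\<integral>\<omega>. (P \<omega> * cos (W c \<omega>)) *\<^sub>R iexp (s * X g \<omega>) \<partial>M)
      = (\<integral>\<omega>. (P' \<omega> * cos (W' c \<omega>)) *\<^sub>R iexp (s * X' g \<omega>) \<partial>M')" for s
      unfolding cs neg[symmetric] using ib ib' IH by (simp del: of_real_add)
  qed measurable
  have sin_eq: "(\<integral>\<omega>. (P \<omega> * sin (W c \<omega>)) * indicator (A g) (X g \<omega>) \<partial>M)
      = (\<integral>\<omega>. (P' \<omega> * sin (W' c \<omega>)) * indicator (A g) (X' g \<omega>) \<partial>M')"
  proof (rule law)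
    show "\<bar>P \<omega> * sin (W c \<omega>)\<bar> \<le> 1" for \<omega>
      using P01[of \<omega>] by (auto simp: abs_mult intro!: mult_le_one)
    show "\<bar>P' \<omega> * sin (W' c \<omega>)\<bar> \<le> 1" for \<omega>
      using P'01[of \<omega>] by (auto simp: abs_mult intro!: mult_le_one)
    show "(\<integral>\<omega>. (P \<omega> * sin (W c \<omega>)) *\<^sub>R iexp (s * X g \<omega>) \<partial>M)
      = (\<integral>\<omega>. (P' \<omega> * sin (W' c \<omega>)) *\<^sub>R iexp (s * X' g \<omega>) \<partial>M')" for s
      unfolding cs neg[symmetric] using ib ib' IH by (simp del: of_real_add)
  qed measurable
  have split: "(p * i) *\<^sub>R iexp w = complex_of_real ((p * cos w) * i) + \<i> * complex_of_real ((p * sin w) * i)" for p i w :: real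
    by (simp add: complex_eq_iff Re_exp Im_exp)
  have i2: "integrable M (\<lambda>\<omega>. (P \<omega> * cos (W c \<omega>)) * indicator (A g) (X g \<omega>))"
    "integrable M (\<lambda>\<omega>. (P \<omega> * sin (W c \<omega>)) * indicator (A g) (X g \<omega>))"
    by (rule M.integrable_const_bound[where B=1], use P01 in \<open>auto simp: abs_mult intro!: mult_le_one\<close>)+
  have i2': "integrable M' (\<lambda>\<omega>. (P' \<omega> * cos (W' c \<omega>)) * indicator (A g) (X' g \<omega>))"
    "integrable M' (\<lambda>\<omega>. (P' \<omega> * sin (W' c \<omega>)) * indicator (A g) (X' g \<omega>))"
    by (rule M'.integrable_const_bound[where B=1], use P'01 in \<open>auto simp: abs_mult intro!: mult_le_one\<close>)+
  have "(\<integral>\<omega>. (P \<omega> * indicator (A g) (X g \<omega>)) *\<^sub>R iexp (W c \<omega>) \<partial>M)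
    = (\<integral>\<omega>. (P' \<omega> * indicator (A g) (X' g \<omega>)) *\<^sub>R iexp (W' c \<omega>) \<partial>M')"
    unfolding split
    using cos_eq sin_eq i2 i2' by (simp del: of_real_mult)
  then show ?case
    using insert.hyps by (simp add: P_def P'_def W_def W'_def mult.commute)
qed

text \<open>Finite-dimensional cylinders determine a finite measure on the product, also for
  infinite \<open>J\<close>. On a cylinder both laws are integrals of products of indicators, the
  case of \<open>partial_char_eq\<close> in which no exponential factor is left.\<close>

lemma joint_law_eqI:
  fixes X :: "'i \<Rightarrow> 'a \<Rightarrow> real" and X' :: "'i \<Rightarrow> 'b \<Rightarrow> real"
  assumes M: "prob_space M" "prob_space M'"
    and X: "\<And>j. j \<in> J \<Longrightarrow> X j \<in> borel_measurable M" "\<And>j. j \<in> J \<Longrightarrow> X' j \<in> borel_measurable M'"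
    and char: "\<And>F c. finite F \<Longrightarrow> F \<subseteq> J \<Longrightarrow>
      (\<integral>\<omega>. iexp (\<Sum>j\<in>F. c j * X j \<omega>) \<partial>M) = (\<integral>\<omega>. iexp (\<Sum>j\<in>F. c j * X' j \<omega>) \<partial>M')"
  shows "distr M (PiM J (\<lambda>_. borel)) (\<lambda>\<omega>. \<lambda>j\<in>J. X j \<omega>) = distr M' (PiM J (\<lambda>_. borel)) (\<lambda>\<omega>. \<lambda>j\<in>J. X' j \<omega>)"
proof (rule measure_eqI_PiM_infinite)
  interpret M: prob_space M by fact
  interpret M': prob_space M' by fact
  have m[measurable]: "(\<lambda>\<omega>. \<lambda>j\<in>J. X j \<omega>) \<in> measurable M (PiM J (\<lambda>_. borel))"
    "(\<lambda>\<omega>. \<lambda>j\<in>J. X' j \<omega>) \<in> measurable M' (PiM J (\<lambda>_. borel))"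
    using X by (auto intro!: measurable_restrict)
  show "finite_measure (distr M (PiM J (\<lambda>_. borel)) (\<lambda>\<omega>. \<lambda>j\<in>J. X j \<omega>))"
    using M.prob_space_distr[OF m(1)] by (rule prob_space.finite_measure)
  fix A :: "'i \<Rightarrow> real set" and F assume F: "finite F" "F \<subseteq> J" and A: "\<And>i. i \<in> F \<Longrightarrow> A i \<in> sets borel"
  let ?C = "prod_emb J (\<lambda>_. borel) F (Pi\<^sub>E F A) :: ('i \<Rightarrow> real) set"
  have C: "?C \<in> sets (PiM J (\<lambda>_. borel))"
    using F A by (intro sets_PiM_I) auto
  have ind: "indicator {\<omega>\<in>S. \<forall>j\<in>F. Z j \<omega> \<in> A j} \<omega> = (\<Prod>j\<in>F. indicator (A j) (Z j \<omega>) :: real)"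
    if "\<omega> \<in> S" for Z :: "'i \<Rightarrow> 'c \<Rightarrow> real" and \<omega> S
  proof (cases "\<forall>j\<in>F. Z j \<omega> \<in> A j")
    case False
    then obtain j where "j \<in> F" "Z j \<omega> \<notin> A j" by auto
    then have "(\<Prod>j\<in>F. indicator (A j) (Z j \<omega>) :: real) = 0"
      using F by (intro prod_zero) (auto simp: indicator_def)
    then show ?thesis using False by (auto simp: indicator_def)
  qed (use that in \<open>auto simp: indicator_def\<close>)
  have main: "emeasure (distr N (PiM J (\<lambda>_. borel)) (\<lambda>\<omega>. \<lambda>j\<in>J. Z j \<omega>)) ?C
     = ennreal (\<integral>\<omega>. (\<Prod>j\<in>F. indicator (A j) (Z j \<omega>)) \<partial>N)"
    if N: "prob_space N" and Z: "\<And>j. j \<in> J \<Longrightarrow> Z j \<in> borel_measurable N" for N and Z :: "'i \<Rightarrow> 'c \<Rightarrow> real"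
  proof -
    interpret N: prob_space N by fact
    have mZ: "(\<lambda>\<omega>. \<lambda>j\<in>J. Z j \<omega>) \<in> measurable N (PiM J (\<lambda>_. borel))"
      using Z by (auto intro!: measurable_restrict)
    have eq: "(\<lambda>\<omega>. \<lambda>j\<in>J. Z j \<omega>) -` ?C \<inter> space N = {\<omega>\<in>space N. \<forall>j\<in>F. Z j \<omega> \<in> A j}"
      using F by (auto simp: prod_emb_def PiE_iff extensional_def subset_iff split: if_splits)
    have "{\<omega>\<in>space N. \<forall>j\<in>F. Z j \<omega> \<in> A j} \<in> sets N"
      using measurable_sets[OF mZ C] eq by simp
    then have "emeasure N {\<omega>\<in>space N. \<forall>j\<in>F. Z j \<omega> \<in> A j} = ennreal (\<integral>\<omega>. indicator {\<omega>\<in>space N. \<forall>j\<in>F. Z j \<omega> \<in> A j} \<omega> \<partial>N)"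
      by (simp add: N.emeasure_eq_measure)
    also have "(\<integral>\<omega>. indicator {\<omega>\<in>space N. \<forall>j\<in>F. Z j \<omega> \<in> A j} \<omega> \<partial>N) = (\<integral>\<omega>. (\<Prod>j\<in>F. indicator (A j) (Z j \<omega>) :: real) \<partial>N)"
      by (intro Bochner_Integration.integral_cong ind) auto
    finally show ?thesis
      using emeasure_distr[OF mZ C] eq by simp
  qed
  have "(\<integral>\<omega>. complex_of_real (\<Prod>j\<in>F. indicator (A j) (X j \<omega>)) \<partial>M)
    = (\<integral>\<omega>. complex_of_real (\<Prod>j\<in>F. indicator (A j) (X' j \<omega>)) \<partial>M')"
    using partial_char_eq[where F="{}" and G=F and c="\<lambda>_. 0", OF M X char A F(1) F(2)] by (simp add: scaleR_conv_of_real del: of_real_prod)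
  then have "(\<integral>\<omega>. (\<Prod>j\<in>F. indicator (A j) (X j \<omega>) :: real) \<partial>M) = (\<integral>\<omega>. (\<Prod>j\<in>F. indicator (A j) (X' j \<omega>)) \<partial>M')"
    by (simp del: of_real_prod)
  then show "emeasure (distr M (PiM J (\<lambda>_. borel)) (\<lambda>\<omega>. \<lambda>j\<in>J. X j \<omega>)) ?C = emeasure (distr M' (PiM J (\<lambda>_. borel)) (\<lambda>\<omega>. \<lambda>j\<in>J. X' j \<omega>)) ?C"
    using main[OF M(1) X(1)] main[OF M(2) X(2)] by simp
qed auto

section \<open>Gaussian spaces of random variables\<close>

lemma
  assumes "prob_space M" and cn: "centered_normal M X"
  shows centered_normal_integrable_square: "integrable M (\<lambda>\<omega>. (X \<omega>)\<^sup>2)"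
    and centered_normal_char:
      "(\<integral>\<omega>. iexp (t * X \<omega>) \<partial>M) = of_real (exp (- (t\<^sup>2 * (\<integral>\<omega>. (X \<omega>)\<^sup>2 \<partial>M)) / 2))"
proof -
  interpret prob_space M by fact
  have "integrable M (\<lambda>\<omega>. (X \<omega>)\<^sup>2) \<and>
    (\<integral>\<omega>. iexp (t * X \<omega>) \<partial>M) = of_real (exp (- (t\<^sup>2 * (\<integral>\<omega>. (X \<omega>)\<^sup>2 \<partial>M)) / 2))"
    using cn unfolding centered_normal_def
  proof (elim disjE exE conjE)
    fix \<sigma> :: real assume \<sigma>: "\<sigma> > 0" and D: "distributed M lborel X (normal_density 0 \<sigma>)"
    have X[measurable]: "X \<in> borel_measurable M"
      using distributed_measurable[OF D] by simp
    have i: "integrable M (\<lambda>\<omega>. (X \<omega>)\<^sup>2)"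
    proof (rule distributed_integrable[OF D, of "\<lambda>x. x\<^sup>2", THEN iffD1])
      show "integrable lborel (\<lambda>x. normal_density 0 \<sigma> x * x\<^sup>2)"
        using integrable_normal_moment[OF \<sigma>, of 0 2] unfolding diff_0_right .
    qed simp_all
    have v: "(\<integral>\<omega>. (X \<omega>)\<^sup>2 \<partial>M) = \<sigma>\<^sup>2"
      using distributed_integral[OF D, of "\<lambda>x. x\<^sup>2"] integral_normal_moment_even[OF \<sigma>, of 0 1] by simp
    have S: "distributed M lborel (\<lambda>x. X x / \<sigma>) std_normal_density"
      using D normal_standard_normal_convert[OF \<sigma>, of X 0] by simp
    have "(\<integral>\<omega>. iexp (t * X \<omega>) \<partial>M) = (\<integral>\<omega>. iexp ((t * \<sigma>) * (X \<omega> / \<sigma>)) \<partial>M)"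
      using \<sigma> by simp
    also have "\<dots> = (\<integral>x. iexp ((t * \<sigma>) * x) \<partial>distr M lborel (\<lambda>x. X x / \<sigma>))"
      by (rule integral_distr[symmetric]) auto
    also have "\<dots> = char std_normal_distribution (t * \<sigma>)"
      using distributed_distr_eq_density[OF S] unfolding char_def by simp
    finally show ?thesis using i v by (simp add: char_std_normal_distribution power_mult_distrib)
  next
    assume X[measurable]: "X \<in> borel_measurable M" and z: "AE \<omega> in M. X \<omega> = 0"
    have "(\<integral>\<omega>. (X \<omega>)\<^sup>2 \<partial>M) = (\<integral>\<omega>. 0 \<partial>M)"
      using z by (intro integral_cong_AE) auto
    moreover have "(\<integral>\<omega>. iexp (t * X \<omega>) \<partial>M) = (\<integral>\<omega>. 1 \<partial>M)"
      using z by (intro integral_cong_AE) auto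
    moreover have "integrable M (\<lambda>\<omega>. (X \<omega>)\<^sup>2)"
      by (subst integrable_cong_AE[of _ _ "\<lambda>_. 0"]) (use z in auto)
    ultimately show ?thesis by (simp add: prob_space)
  qed
  then show "integrable M (\<lambda>\<omega>. (X \<omega>)\<^sup>2)"
    "(\<integral>\<omega>. iexp (t * X \<omega>) \<partial>M) = of_real (exp (- (t\<^sup>2 * (\<integral>\<omega>. (X \<omega>)\<^sup>2 \<partial>M)) / 2))" by auto
qed

lemma centered_normal_measurable:
  "centered_normal M X \<Longrightarrow> X \<in> borel_measurable M"
  unfolding centered_normal_def using distributed_measurable[of M lborel X] by fastforce

text \<open>Levy's uniqueness theorem identifies the law: for \<open>v = 0\<close> it is the point
  mass at 0, otherwise division by \<open>sqrt v\<close> leads to the standard normal law. Normality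
  thus becomes a property of the characteristic function, which passes to pointwise limits.\<close>

lemma centered_normal_charI:
  assumes "prob_space M" and X[measurable]: "X \<in> borel_measurable M" and v: "0 \<le> v"
    and char: "\<And>t. (\<integral>\<omega>. iexp (t * X \<omega>) \<partial>M) = of_real (exp (- (t\<^sup>2 * v) / 2))"
  shows "centered_normal M X"
proof -
  interpret prob_space M by fact
  have c: "char (distr M borel X) t = of_real (exp (- (t\<^sup>2 * v) / 2))" for t
    unfolding char_def using char[of t] by (subst integral_distr) auto
  have rd: "real_distribution (distr M borel X)" by (rule real_distribution_distr) fact
  show ?thesis
  proof (cases "v = 0")
    case True
    have "real_distribution (return borel 0)"
      by (auto simp: real_distribution_def real_distribution_axioms_def intro!: prob_space_return)
    moreover have "char (return borel (0::real)) t = 1" for t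
      unfolding char_def by (subst integral_return) auto
    ultimately have "distr M borel X = return borel 0"
      using rd c True by (intro Levy_uniqueness) auto
    moreover have "AE x in return borel (0::real). x = 0"
      by (subst AE_return) auto
    ultimately have "AE x in distr M borel X. x = 0" by metis
    then have "AE \<omega> in M. X \<omega> = 0"
      by (subst (asm) AE_distr_iff) auto
    then show ?thesis unfolding centered_normal_def by auto
  next
    case False
    define \<sigma> where "\<sigma> = sqrt v"
    have \<sigma>: "\<sigma> > 0" "\<sigma>\<^sup>2 = v" using False v unfolding \<sigma>_def by auto
    have rd': "real_distribution (distr M borel (\<lambda>\<omega>. X \<omega> / \<sigma>))" by (rule real_distribution_distr) measurable
    have "char (distr M borel (\<lambda>\<omega>. X \<omega> / \<sigma>)) t = char std_normal_distribution t" for t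
    proof -
      have "char (distr M borel (\<lambda>\<omega>. X \<omega> / \<sigma>)) t = (\<integral>\<omega>. iexp ((t / \<sigma>) * X \<omega>) \<partial>M)"
        unfolding char_def by (subst integral_distr) auto
      then show ?thesis
        unfolding char char_std_normal_distribution using \<sigma> False by (simp add: power_divide)
    qed
    then have eq: "distr M borel (\<lambda>\<omega>. X \<omega> / \<sigma>) = std_normal_distribution"
      by (intro Levy_uniqueness rd' real_dist_normal_dist) auto
    \<comment> \<open>\<open>distributed\<close> takes \<open>lborel\<close> as target; only its
      measurable sets enter \<open>distr\<close>, and these are those of
      \<open>borel\<close>.\<close>
    have "distr M lborel (\<lambda>\<omega>. X \<omega> / \<sigma>) = distr M borel (\<lambda>\<omega>. X \<omega> / \<sigma>)"
      by (rule distr_cong) auto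
    then have "distributed M lborel (\<lambda>\<omega>. (X \<omega> - 0) / \<sigma>) std_normal_density"
      using eq by (simp add: distributed_def)
    then have "distributed M lborel X (normal_density 0 \<sigma>)"
      using normal_standard_normal_convert[OF \<sigma>(1)] by blast
    then show ?thesis using \<sigma>(1) unfolding centered_normal_def by blast
  qed
qed

text \<open>The characteristic function of the limit is nonzero at some \<open>t \<noteq> 0\<close>, and the logarithm
  of the characteristic functions at that point determines the variances.\<close>
lemma centered_normal_limit:
  assumes "prob_space M" and cn: "\<And>n. centered_normal M (X n)"
    and lim: "\<And>\<omega>. \<omega> \<in> space M \<Longrightarrow> (\<lambda>n. X n \<omega>) \<longlonglongrightarrow> X' \<omega>"
  shows "centered_normal M X'"
    and "(\<lambda>n. \<integral>\<omega>. (X n \<omega>)\<^sup>2 \<partial>M) \<longlonglongrightarrow> (\<integral>\<omega>. (X' \<omega>)\<^sup>2 \<partial>M)"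
proof -
  interpret prob_space M by fact
  have [measurable]: "X n \<in> borel_measurable M" for n
    using cn by (rule centered_normal_measurable)
  have X'[measurable]: "X' \<in> borel_measurable M"
    by (rule borel_measurable_LIMSEQ_metric[where f=X]) (use lim in auto)
  define v where "v = (\<lambda>n. \<integral>\<omega>. (X n \<omega>)\<^sup>2 \<partial>M)"
  define \<phi> where "\<phi> = (\<lambda>t. \<integral>\<omega>. iexp (t * X' \<omega>) \<partial>M)"
  have conv: "(\<lambda>n. complex_of_real (exp (- (t\<^sup>2 * v n) / 2))) \<longlonglongrightarrow> \<phi> t" for t
  proof -
    have "(\<lambda>n. \<integral>\<omega>. iexp (t * X n \<omega>) \<partial>M) \<longlonglongrightarrow> \<phi> t"
      unfolding \<phi>_def
      by (rule integral_dominated_convergence[where w="\<lambda>_. 1"])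
        (auto intro!: tendsto_intros lim AE_I2)
    then show ?thesis using centered_normal_char[OF assms(1) cn] by (simp add: v_def)
  qed
  have convR: "(\<lambda>n. exp (- (t\<^sup>2 * v n) / 2)) \<longlonglongrightarrow> Re (\<phi> t)" for t
    using tendsto_Re[OF conv[of t]] by simp
  have "isCont (char (distr M borel X')) 0"
    by (rule real_distribution.isCont_char, rule real_distribution_distr) fact
  moreover have "char (distr M borel X') = \<phi>"
    unfolding char_def \<phi>_def by (rule ext, subst integral_distr) auto
  ultimately have "isCont (\<lambda>t. Re (\<phi> t)) 0" by (auto intro: continuous_intros)
  moreover have "Re (\<phi> 0) = 1" unfolding \<phi>_def by (simp add: prob_space)
  ultimately have "\<forall>\<^sub>F t in at 0. Re (\<phi> t) > 0"
    unfolding isCont_def by (auto dest!: order_tendstoD(1)[of _ 1 _ 0])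
  then obtain d where d: "d > 0" "\<And>t. t \<noteq> 0 \<Longrightarrow> dist t 0 < d \<Longrightarrow> Re (\<phi> t) > 0"
    unfolding eventually_at by auto
  define t0 where "t0 = d / 2"
  have t0: "t0 > 0" "Re (\<phi> t0) > 0" using d(1) d(2)[of "d/2"] by (auto simp: t0_def)
  have "(\<lambda>n. ln (exp (- (t0\<^sup>2 * v n) / 2))) \<longlonglongrightarrow> ln (Re (\<phi> t0))"
    using t0 by (intro tendsto_ln convR) auto
  then have "(\<lambda>n. (- 2 / t0\<^sup>2) * (- (t0\<^sup>2 * v n) / 2)) \<longlonglongrightarrow> (- 2 / t0\<^sup>2) * ln (Re (\<phi> t0))"
    by (intro tendsto_mult_left) simp
  moreover have "(- 2 / t0\<^sup>2) * (- (t0\<^sup>2 * v n) / 2) = v n" for n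
    using t0 by simp
  ultimately obtain w where w: "v \<longlonglongrightarrow> w"
    by auto
  have "0 \<le> v n" for n unfolding v_def by simp
  then have w0: "0 \<le> w" using w by (intro LIMSEQ_le_const) auto
  have eq: "\<phi> t = of_real (exp (- (t\<^sup>2 * w) / 2))" for t
    by (rule LIMSEQ_unique[OF conv]) (intro tendsto_intros w, simp)
  show cn': "centered_normal M X'"
    by (rule centered_normal_charI[OF assms(1) X' w0]) (use eq in \<open>simp add: \<phi>_def\<close>)
  \<comment> \<open>So far \<open>w\<close> is only the limit of the variances. Comparing the two
    forms of the characteristic function of \<open>X'\<close> at frequency 1 identifies it with the
    second moment of \<open>X'\<close>.\<close>
  have "complex_of_real (exp (- (1\<^sup>2 * (\<integral>\<omega>. (X' \<omega>)\<^sup>2 \<partial>M)) / 2)) = of_real (exp (- (1\<^sup>2 * w) / 2))"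
    using centered_normal_char[OF assms(1) cn', of 1] eq[of 1] unfolding \<phi>_def by metis
  then have "w = (\<integral>\<omega>. (X' \<omega>)\<^sup>2 \<partial>M)"
    unfolding of_real_eq_iff by simp
  then show "(\<lambda>n. \<integral>\<omega>. (X n \<omega>)\<^sup>2 \<partial>M) \<longlonglongrightarrow> (\<integral>\<omega>. (X' \<omega>)\<^sup>2 \<partial>M)"
    using w unfolding v_def by simp
qed

text \<open>This is Cauchy-Schwarz for forms that may be degenerate; both \<open>cov\<close> and
  \<open>L2_scalar\<close> can vanish on nonzero functions. For \<open>r = 0\<close> a nonzero
  \<open>q\<close> is refuted at the point where the affine function takes the value -1; otherwise
  the stationary point \<open>- q / r\<close> is inserted.\<close>

lemma psd_discriminant:
  fixes p q r :: real
  assumes "\<And>x. 0 \<le> p + 2 * x * q + x\<^sup>2 * r"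
  shows "q\<^sup>2 \<le> p * r"
proof (cases "r = 0")
  case True
  have "q = 0"
  proof (rule ccontr)
    assume "q \<noteq> 0"
    then show False using assms[of "- (p + 1) / (2 * q)"] True by (simp add: field_simps)
  qed
  then show ?thesis using True by simp
next
  case False
  have "0 \<le> p - q\<^sup>2 / r"
    using assms[of "- q / r"] False by (simp add: power2_eq_square field_simps)
  moreover have "0 \<le> r"
  proof (rule ccontr)
    assume r: "\<not> 0 \<le> r"
    \<comment> \<open>For a negative \<open>r\<close> the quadratic term wins at such an
      \<open>n\<close>: the value \<open>p + n * (2 * q + n * r)\<close> is below
      \<open>p - \<bar>p\<bar>\<close>, hence negative.\<close>
    obtain n :: real where n: "n > 0" "n * (- r) > \<bar>p\<bar> + 2 * \<bar>q\<bar>" "n \<ge> 1"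
      using that[of "max 1 ((\<bar>p\<bar> + 2 * \<bar>q\<bar> + 1) / (- r))"] r
      by (auto simp: max_def field_simps split: if_splits)
    have "p + 2 * n * q + n\<^sup>2 * r = p + n * (2 * q + n * r)" by (simp add: power2_eq_square algebra_simps)
    moreover have "2 * q + n * r < - \<bar>p\<bar>" using n by (simp add: algebra_simps)
    then have "n * (2 * q + n * r) < n * (- \<bar>p\<bar>)" using n(1) by (rule mult_strict_left_mono)
    moreover have "n * (- \<bar>p\<bar>) \<le> - \<bar>p\<bar>" using n mult_right_mono[of 1 n "\<bar>p\<bar>"] by simp
    ultimately show False using assms[of n] by linarith
  qed
  ultimately show ?thesis using False by (simp add: field_simps)
qed

text \<open>Closure under linear combinations turns a condition on single variables into joint
  normality: characteristic functions of finite families are determined by the mixed second moments,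
  which are the covariances because all means vanish.\<close>

locale gaussian_space = prob_space M for M :: "'w measure" +
  fixes G :: "('w \<Rightarrow> real) set"
  assumes zero: "(\<lambda>_. 0) \<in> G"
    and add: "X \<in> G \<Longrightarrow> Y \<in> G \<Longrightarrow> (\<lambda>\<omega>. X \<omega> + Y \<omega>) \<in> G"
    and scale: "X \<in> G \<Longrightarrow> (\<lambda>\<omega>. c * X \<omega>) \<in> G"
    and normal: "X \<in> G \<Longrightarrow> centered_normal M X"
begin

definition cov :: "('w \<Rightarrow> real) \<Rightarrow> ('w \<Rightarrow> real) \<Rightarrow> real" where
  "cov X Y = (\<integral>\<omega>. X \<omega> * Y \<omega> \<partial>M)"

lemma diff: "X \<in> G \<Longrightarrow> Y \<in> G \<Longrightarrow> (\<lambda>\<omega>. X \<omega> - Y \<omega>) \<in> G"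
  using add[of X "\<lambda>\<omega>. (-1) * Y \<omega>"] scale[of Y "-1"] by simp

lemma sum: "(\<And>i. i \<in> F \<Longrightarrow> X i \<in> G) \<Longrightarrow> (\<lambda>\<omega>. \<Sum>i\<in>F. X i \<omega>) \<in> G"
  by (induction F rule: infinite_finite_induct) (auto intro: zero add)

lemma measurable: "X \<in> G \<Longrightarrow> X \<in> borel_measurable M"
  by (rule centered_normal_measurable[OF normal])

lemma integrable_mult:
  assumes "X \<in> G" "Y \<in> G"
  shows "integrable M (\<lambda>\<omega>. X \<omega> * Y \<omega>)"
proof (rule Bochner_Integration.integrable_bound)
  have [measurable]: "X \<in> borel_measurable M" "Y \<in> borel_measurable M"
    using assms by (auto intro: measurable)
  show "integrable M (\<lambda>\<omega>. (X \<omega>)\<^sup>2 + (Y \<omega>)\<^sup>2)"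
    using assms normal prob_space_axioms by (intro Bochner_Integration.integrable_add centered_normal_integrable_square) auto
  have "\<bar>x * y\<bar> \<le> x\<^sup>2 + y\<^sup>2" for x y :: real
    using sum_squares_bound[of "\<bar>x\<bar>" "\<bar>y\<bar>"] zero_le_power2[of x] zero_le_power2[of y]
    by (simp add: abs_mult) (use mult_nonneg_nonneg[of "\<bar>x\<bar>" "\<bar>y\<bar>"] in linarith)
  then show "AE \<omega> in M. norm (X \<omega> * Y \<omega>) \<le> norm ((X \<omega>)\<^sup>2 + (Y \<omega>)\<^sup>2)"
    by (intro AE_I2) (smt (verit) real_norm_def)
  show "(\<lambda>\<omega>. X \<omega> * Y \<omega>) \<in> borel_measurable M" by measurable
qed

lemma cov_commute: "cov X Y = cov Y X"
  unfolding cov_def by (simp add: mult.commute)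

lemma cov_nonneg: "0 \<le> cov X X"
  unfolding cov_def by simp

lemma cov_add: "X \<in> G \<Longrightarrow> X' \<in> G \<Longrightarrow> Y \<in> G \<Longrightarrow> cov (\<lambda>\<omega>. X \<omega> + X' \<omega>) Y = cov X Y + cov X' Y"
  unfolding cov_def using integrable_mult by (simp add: distrib_right)

lemma cov_diff: "X \<in> G \<Longrightarrow> X' \<in> G \<Longrightarrow> Y \<in> G \<Longrightarrow> cov (\<lambda>\<omega>. X \<omega> - X' \<omega>) Y = cov X Y - cov X' Y"
  unfolding cov_def using integrable_mult by (simp add: left_diff_distrib)

lemma cov_add_right: "X \<in> G \<Longrightarrow> X' \<in> G \<Longrightarrow> Y \<in> G \<Longrightarrow> cov Y (\<lambda>\<omega>. X \<omega> + X' \<omega>) = cov Y X + cov Y X'"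
  unfolding cov_def using integrable_mult by (simp add: distrib_left)

lemma cov_diff_right: "X \<in> G \<Longrightarrow> X' \<in> G \<Longrightarrow> Y \<in> G \<Longrightarrow> cov Y (\<lambda>\<omega>. X \<omega> - X' \<omega>) = cov Y X - cov Y X'"
  unfolding cov_def using integrable_mult by (simp add: right_diff_distrib)

lemma cov_scale: "cov (\<lambda>\<omega>. c * X \<omega>) Y = c * cov X Y"
  unfolding cov_def by (simp add: mult.assoc)

lemma cov_scale_right: "cov X (\<lambda>\<omega>. c * Y \<omega>) = c * cov X Y"
  unfolding cov_def by (simp add: mult.left_commute)

lemma cov_zero: "cov (\<lambda>_. 0) Y = 0"
  unfolding cov_def by simp

lemma cov_sum:
  "(\<And>i. i \<in> F \<Longrightarrow> X i \<in> G) \<Longrightarrow> Y \<in> G \<Longrightarrow> cov (\<lambda>\<omega>. \<Sum>i\<in>F. X i \<omega>) Y = (\<Sum>i\<in>F. cov (X i) Y)"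
  unfolding cov_def using integrable_mult by (simp add: sum_distrib_right)

lemma cov_sum_right:
  "(\<And>i. i \<in> F \<Longrightarrow> X i \<in> G) \<Longrightarrow> Y \<in> G \<Longrightarrow> cov Y (\<lambda>\<omega>. \<Sum>i\<in>F. X i \<omega>) = (\<Sum>i\<in>F. cov Y (X i))"
  using cov_sum[of F X Y] by (simp add: cov_commute)

lemma var_add:
  assumes "X \<in> G" "Y \<in> G"
  shows "cov (\<lambda>\<omega>. X \<omega> + Y \<omega>) (\<lambda>\<omega>. X \<omega> + Y \<omega>) = cov X X + 2 * cov X Y + cov Y Y"
  using assms add[OF assms] cov_commute[of Y X] by (simp add: cov_add cov_add_right)

lemma var_diff:
  assumes "X \<in> G" "Y \<in> G"
  shows "cov (\<lambda>\<omega>. X \<omega> - Y \<omega>) (\<lambda>\<omega>. X \<omega> - Y \<omega>) = cov X X - 2 * cov X Y + cov Y Y"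
  using assms diff[OF assms] cov_commute[of Y X] by (simp add: cov_diff cov_diff_right)

lemma var_add_le:
  assumes "X \<in> G" "Y \<in> G"
  shows "cov (\<lambda>\<omega>. X \<omega> + Y \<omega>) (\<lambda>\<omega>. X \<omega> + Y \<omega>) \<le> 2 * cov X X + 2 * cov Y Y"
  using var_add[OF assms] var_diff[OF assms] cov_nonneg[of "\<lambda>\<omega>. X \<omega> - Y \<omega>"] by simp

lemma cov_Cauchy_Schwarz:
  assumes "X \<in> G" "Y \<in> G"
  shows "(cov X Y)\<^sup>2 \<le> cov X X * cov Y Y"
proof (rule psd_discriminant)
  fix x
  have "cov (\<lambda>\<omega>. X \<omega> + x * Y \<omega>) (\<lambda>\<omega>. X \<omega> + x * Y \<omega>) = cov X X + 2 * x * cov X Y + x\<^sup>2 * cov Y Y"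
    using var_add[OF assms(1) scale[OF assms(2), of x]]
    by (simp add: cov_scale cov_scale_right power2_eq_square)
  then show "0 \<le> cov X X + 2 * x * cov X Y + x\<^sup>2 * cov Y Y"
    using cov_nonneg by metis
qed

lemma char_cov: "X \<in> G \<Longrightarrow> (\<integral>\<omega>. iexp (X \<omega>) \<partial>M) = of_real (exp (- cov X X / 2))"
  using centered_normal_char[OF prob_space_axioms normal, of X 1]
  by (simp add: cov_def power2_eq_square)

text \<open>Polarization: \<open>4 * cov U Y\<close> is the difference of the variances of
  \<open>U + Y\<close> and \<open>U - Y\<close>, and variances of centered normal variables converge
  along pointwise limits.\<close>

lemma cov_limit:
  assumes X: "\<And>n. X n \<in> G" "X' \<in> G" and Y: "Y \<in> G"
    and lim: "\<And>\<omega>. \<omega> \<in> space M \<Longrightarrow> (\<lambda>n. X n \<omega>) \<longlonglongrightarrow> X' \<omega>"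
  shows "(\<lambda>n. cov (X n) Y) \<longlonglongrightarrow> cov X' Y"
proof -
  have "(\<lambda>n. \<integral>\<omega>. (X n \<omega> + Y \<omega>)\<^sup>2 \<partial>M) \<longlonglongrightarrow> (\<integral>\<omega>. (X' \<omega> + Y \<omega>)\<^sup>2 \<partial>M)"
    by (rule centered_normal_limit(2)[OF prob_space_axioms normal[OF add[OF X(1) Y]]])
      (intro tendsto_intros lim)
  moreover have "(\<lambda>n. \<integral>\<omega>. (X n \<omega> - Y \<omega>)\<^sup>2 \<partial>M) \<longlonglongrightarrow> (\<integral>\<omega>. (X' \<omega> - Y \<omega>)\<^sup>2 \<partial>M)"
    by (rule centered_normal_limit(2)[OF prob_space_axioms normal[OF diff[OF X(1) Y]]])
      (intro tendsto_intros lim)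
  ultimately have "(\<lambda>n. ((\<integral>\<omega>. (X n \<omega> + Y \<omega>)\<^sup>2 \<partial>M) - (\<integral>\<omega>. (X n \<omega> - Y \<omega>)\<^sup>2 \<partial>M)) / 4)
     \<longlonglongrightarrow> ((\<integral>\<omega>. (X' \<omega> + Y \<omega>)\<^sup>2 \<partial>M) - (\<integral>\<omega>. (X' \<omega> - Y \<omega>)\<^sup>2 \<partial>M)) / 4"
    by (intro tendsto_intros) auto
  moreover have "((\<integral>\<omega>. (U \<omega> + Y \<omega>)\<^sup>2 \<partial>M) - (\<integral>\<omega>. (U \<omega> - Y \<omega>)\<^sup>2 \<partial>M)) / 4 = cov U Y" if "U \<in> G" for U
    using var_add[OF that Y] var_diff[OF that Y] unfolding cov_def power2_eq_square by simp
  ultimately show ?thesis using X by simp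
qed

lemma var_limit:
  assumes X: "\<And>n. X n \<in> G" and lim: "\<And>\<omega>. \<omega> \<in> space M \<Longrightarrow> (\<lambda>n. X n \<omega>) \<longlonglongrightarrow> X' \<omega>"
  shows "(\<lambda>n. cov (X n) (X n)) \<longlonglongrightarrow> cov X' X'"
  using centered_normal_limit(2)[OF prob_space_axioms normal[OF X] lim]
  by (simp add: cov_def power2_eq_square)

text \<open>For every linear combination the variances of the sum and of the difference differ only
  in the sign of the mixed term, which is 0. This reflection serves twice below: for the modulus of
  continuity of the residuals and for the maximal inequality.\<close>

lemma flip_law:
  fixes U V :: "'i \<Rightarrow> 'w \<Rightarrow> real"
  assumes U: "\<And>j. j \<in> J \<Longrightarrow> U j \<in> G" and V: "\<And>j. j \<in> J \<Longrightarrow> V j \<in> G"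
    and orth: "\<And>i j. i \<in> J \<Longrightarrow> j \<in> J \<Longrightarrow> cov (U i) (V j) = 0"
  shows "distr M (PiM J (\<lambda>_. borel)) (\<lambda>\<omega>. \<lambda>j\<in>J. U j \<omega> + V j \<omega>)
    = distr M (PiM J (\<lambda>_. borel)) (\<lambda>\<omega>. \<lambda>j\<in>J. U j \<omega> - V j \<omega>)"
proof (rule joint_law_eqI[OF prob_space_axioms prob_space_axioms])
  show "(\<lambda>\<omega>. U j \<omega> + V j \<omega>) \<in> borel_measurable M" if "j \<in> J" for j
    using that U V by (intro measurable add) auto
  show "(\<lambda>\<omega>. U j \<omega> - V j \<omega>) \<in> borel_measurable M" if "j \<in> J" for j
    using that U V by (intro measurable diff) auto
  fix F and c :: "'i \<Rightarrow> real" assume F: "finite F" "F \<subseteq> J"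
  let ?U = "\<lambda>\<omega>. \<Sum>j\<in>F. c j * U j \<omega>" and ?V = "\<lambda>\<omega>. \<Sum>j\<in>F. c j * V j \<omega>"
  have GU: "?U \<in> G" and GV: "?V \<in> G"
    using F U V by (auto intro!: sum scale)
  have "cov ?U ?V = (\<Sum>i\<in>F. \<Sum>j\<in>F. cov (\<lambda>\<omega>. c i * U i \<omega>) (\<lambda>\<omega>. c j * V j \<omega>))"
    using F U V GV scale by (subst cov_sum) (auto intro!: sum.cong cov_sum_right)
  also have "\<dots> = (\<Sum>i\<in>F. \<Sum>j\<in>F. 0)"
  proof (intro sum.cong refl)
    fix i j assume "i \<in> F" "j \<in> F"
    then have "cov (U i) (V j) = 0" using orth F by auto
    then show "cov (\<lambda>\<omega>. c i * U i \<omega>) (\<lambda>\<omega>. c j * V j \<omega>) = 0"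
      by (simp add: cov_scale cov_scale_right)
  qed
  finally have "cov ?U ?V = 0" by simp
  then have "(\<integral>\<omega>. iexp (?U \<omega> + ?V \<omega>) \<partial>M) = (\<integral>\<omega>. iexp (?U \<omega> - ?V \<omega>) \<partial>M)"
    using char_cov[OF add[OF GU GV]] char_cov[OF diff[OF GU GV]] var_add[OF GU GV] var_diff[OF GU GV]
    by simp
  then show "(\<integral>\<omega>. iexp (\<Sum>j\<in>F. c j * (U j \<omega> + V j \<omega>)) \<partial>M) = (\<integral>\<omega>. iexp (\<Sum>j\<in>F. c j * (U j \<omega> - V j \<omega>)) \<partial>M)"
    by (simp add: distrib_left right_diff_distrib sum.distrib sum_subtractf del: of_real_add of_real_diff of_real_sum)
qed

text \<open>The law of the family is compared with that of the coordinates on the product of the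
  one-dimensional laws. On the product, independence factors the characteristic function; on
  \<open>M\<close> the variance of a linear combination is the sum of the variances of its terms,
  which gives the same product of exponentials.\<close>

lemma uncorrelated_indep:
  fixes Z :: "'i \<Rightarrow> 'w \<Rightarrow> real"
  assumes Z: "\<And>k. k \<in> I \<Longrightarrow> Z k \<in> G"
    and orth: "\<And>j k. j \<in> I \<Longrightarrow> k \<in> I \<Longrightarrow> j \<noteq> k \<Longrightarrow> cov (Z j) (Z k) = 0"
  shows "indep_vars (\<lambda>_. borel) Z I"
proof (cases "I = {}")
  case True
  then show ?thesis unfolding indep_vars_def indep_sets_def by simp
next
  case False
  have rv: "\<And>k. k \<in> I \<Longrightarrow> Z k \<in> borel_measurable M" using Z by (auto intro: measurable)
  let ?P = "PiM I (\<lambda>k. distr M borel (Z k))"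
  have pk: "prob_space (distr M borel (Z k))" if "k \<in> I" for k
    using that by (intro prob_space_distr rv)
  interpret P: prob_space ?P by (rule prob_space_PiM) (rule pk)
  have sP: "sets ?P = sets (PiM I (\<lambda>_. borel))" by (rule sets_PiM_cong) auto
  have coord: "(\<lambda>x. x k) \<in> borel_measurable ?P" if "k \<in> I" for k
    using measurable_component_singleton[OF that, of "\<lambda>k. distr M borel (Z k)"] by simp
  have indepP: "P.indep_vars (\<lambda>_. borel) (\<lambda>k x. x k) I"
  proof (subst P.indep_vars_iff_distr_eq_PiM'[OF False coord])
    have "distr ?P (PiM I (\<lambda>_. borel)) (\<lambda>x. \<lambda>k\<in>I. x k) = distr ?P ?P (\<lambda>x. x)"
      by (rule distr_cong) (auto simp: space_PiM sP[symmetric] intro!: restrict_ext simp: PiE_iff extensional_restrict)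
    moreover have "distr ?P borel (\<lambda>x. x k) = distr M borel (Z k)" if "k \<in> I" for k
    proof -
      have "distr ?P (distr M borel (Z k)) (\<lambda>x. x k) = distr M borel (Z k)"
        by (rule distr_PiM_component[OF pk that])
      moreover have "distr ?P (distr M borel (Z k)) (\<lambda>x. x k) = distr ?P borel (\<lambda>x. x k)"
        by (rule distr_cong) auto
      ultimately show ?thesis by simp
    qed
    ultimately show "distr ?P (PiM I (\<lambda>_. borel)) (\<lambda>x. \<lambda>k\<in>I. x k) = PiM I (\<lambda>k. distr ?P borel (\<lambda>x. x k))"
      by (simp cong: PiM_cong)
  qed simp
  have law: "distr M (PiM I (\<lambda>_. borel)) (\<lambda>\<omega>. \<lambda>k\<in>I. Z k \<omega>) = distr ?P (PiM I (\<lambda>_. borel)) (\<lambda>x. \<lambda>k\<in>I. x k)"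
  proof (rule joint_law_eqI[OF prob_space_axioms P.prob_space_axioms rv coord])
    fix F and c :: "'i \<Rightarrow> real" assume F: "finite F" "F \<subseteq> I"
    have FG: "(\<lambda>\<omega>. \<Sum>k\<in>F. c k * Z k \<omega>) \<in> G" and cG: "\<And>k. k \<in> F \<Longrightarrow> (\<lambda>\<omega>. c k * Z k \<omega>) \<in> G"
      using F Z by (auto intro!: sum scale)
    have "cov (\<lambda>\<omega>. \<Sum>k\<in>F. c k * Z k \<omega>) (\<lambda>\<omega>. \<Sum>k\<in>F. c k * Z k \<omega>)
      = (\<Sum>i\<in>F. \<Sum>j\<in>F. cov (\<lambda>\<omega>. c i * Z i \<omega>) (\<lambda>\<omega>. c j * Z j \<omega>))"
      using FG cG by (subst cov_sum) (auto intro!: sum.cong cov_sum_right)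
    also have "\<dots> = (\<Sum>i\<in>F. \<Sum>j\<in>F. if j = i then cov (\<lambda>\<omega>. c i * Z i \<omega>) (\<lambda>\<omega>. c i * Z i \<omega>) else 0)"
    proof (intro sum.cong refl)
      fix i j assume ij: "i \<in> F" "j \<in> F"
      have "cov (Z i) (Z j) = 0" if "i \<noteq> j" using orth that ij F by auto
      then show "cov (\<lambda>\<omega>. c i * Z i \<omega>) (\<lambda>\<omega>. c j * Z j \<omega>) = (if j = i then cov (\<lambda>\<omega>. c i * Z i \<omega>) (\<lambda>\<omega>. c i * Z i \<omega>) else 0)"
        by (simp add: cov_scale cov_scale_right)
    qed
    also have "\<dots> = (\<Sum>i\<in>F. cov (\<lambda>\<omega>. c i * Z i \<omega>) (\<lambda>\<omega>. c i * Z i \<omega>))"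
      using F by simp
    finally have var: "cov (\<lambda>\<omega>. \<Sum>k\<in>F. c k * Z k \<omega>) (\<lambda>\<omega>. \<Sum>k\<in>F. c k * Z k \<omega>) = \<dots>" .
    have "P.indep_vars (\<lambda>_. borel) (\<lambda>k x. c k * x k) F"
      by (rule P.indep_vars_compose2[where X="\<lambda>k x. x k", OF P.indep_vars_subset[OF indepP F(2)]]) measurable
    note indep_sum = P.char_distr_sum[OF this, of 1]
    have ms: "(\<lambda>x. \<Sum>k\<in>F. c k * x k) \<in> borel_measurable ?P"
      using F coord by (intro borel_measurable_sum borel_measurable_times) auto
    have "(\<integral>x. iexp (\<Sum>k\<in>F. c k * x k) \<partial>?P) = char (distr ?P borel (\<lambda>x. \<Sum>k\<in>F. c k * x k)) 1"
      unfolding char_def using ms by (subst integral_distr) simp_all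
    also have "\<dots> = (\<Prod>k\<in>F. char (distr ?P borel (\<lambda>x. c k * x k)) 1)"
      by (rule indep_sum)
    also have "\<dots> = (\<Prod>k\<in>F. complex_of_real (exp (- cov (\<lambda>\<omega>. c k * Z k \<omega>) (\<lambda>\<omega>. c k * Z k \<omega>) / 2)))"
    proof (intro prod.cong refl)
      fix k assume k: "k \<in> F"
      then have kI: "k \<in> I" using F by auto
      have "char (distr ?P borel (\<lambda>x. c k * x k)) 1 = (\<integral>x. iexp (c k * x k) \<partial>?P)"
        unfolding char_def using coord[OF kI] by (subst integral_distr) simp_all
      also have "\<dots> = (\<integral>y. iexp (c k * y) \<partial>distr ?P (distr M borel (Z k)) (\<lambda>x. x k))"
        by (rule integral_distr[symmetric]) (simp_all only: measurable_component_singleton[OF kI, of "\<lambda>k. distr M borel (Z k)"] measurable_distr_eq1, measurable)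
      also have "\<dots> = (\<integral>y. iexp (c k * y) \<partial>distr M borel (Z k))"
        using distr_PiM_component[of I "\<lambda>k. distr M borel (Z k)" k] pk kI by simp
      also have "\<dots> = (\<integral>\<omega>. iexp (c k * Z k \<omega>) \<partial>M)"
        using rv[OF kI] by (subst integral_distr) simp_all
      finally show "char (distr ?P borel (\<lambda>x. c k * x k)) 1 = complex_of_real (exp (- cov (\<lambda>\<omega>. c k * Z k \<omega>) (\<lambda>\<omega>. c k * Z k \<omega>) / 2))"
        using char_cov[OF cG[OF k]] by simp
    qed
    also have "\<dots> = complex_of_real (exp (- cov (\<lambda>\<omega>. \<Sum>k\<in>F. c k * Z k \<omega>) (\<lambda>\<omega>. \<Sum>k\<in>F. c k * Z k \<omega>) / 2))"
      unfolding var of_real_prod[symmetric] exp_sum[OF F(1), symmetric] sum_divide_distrib[symmetric] sum_negf ..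
    finally show "(\<integral>\<omega>. iexp (\<Sum>k\<in>F. c k * Z k \<omega>) \<partial>M) = (\<integral>x. iexp (\<Sum>k\<in>F. c k * x k) \<partial>?P)"
      using char_cov[OF FG] by simp
  qed auto
  have "distr ?P (PiM I (\<lambda>_. borel)) (\<lambda>x. \<lambda>k\<in>I. x k) = ?P"
    using distr_cong[of ?P ?P "PiM I (\<lambda>_. borel)" ?P "\<lambda>x. \<lambda>k\<in>I. x k" "\<lambda>x. x"] sP
    by (simp add: space_PiM PiE_iff extensional_restrict)
  then show ?thesis
    using law indep_vars_iff_distr_eq_PiM'[OF False rv] by simp
qed

end

section \<open>Continuous Gaussian processes and their integrals\<close>

lemma const_minus_inverse_tendsto: "(\<lambda>n. c - 1 / real (Suc n)) \<longlonglongrightarrow> c"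
proof -
  have "(\<lambda>n. 1 / real (Suc n)) \<longlonglongrightarrow> 0"
    using LIMSEQ_inverse_real_of_nat unfolding inverse_eq_divide .
  from tendsto_diff[OF tendsto_const[of c] this] show ?thesis unfolding diff_0_right .
qed

section \<open>Square integrable functions through representatives\<close>

lemma in_L2_measurable: "in_L2 \<nu> f \<Longrightarrow> f \<in> borel_measurable \<nu>"
  by (simp add: in_L2_def)

lemma in_L2_integrable_mult:
  assumes "in_L2 \<nu> f" "in_L2 \<nu> g"
  shows "integrable \<nu> (\<lambda>x. f x * g x)"
proof (rule Bochner_Integration.integrable_bound)
  have [measurable]: "f \<in> borel_measurable \<nu>" "g \<in> borel_measurable \<nu>"
    using assms by (auto intro: in_L2_measurable)
  show "integrable \<nu> (\<lambda>x. (f x)\<^sup>2 + (g x)\<^sup>2)"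
    using assms by (auto simp: in_L2_def)
  have "\<bar>x * y\<bar> \<le> x\<^sup>2 + y\<^sup>2" for x y :: real
    using sum_squares_bound[of "\<bar>x\<bar>" "\<bar>y\<bar>"] zero_le_power2[of x] zero_le_power2[of y]
    by (simp add: abs_mult) (use mult_nonneg_nonneg[of "\<bar>x\<bar>" "\<bar>y\<bar>"] in linarith)
  then show "AE x in \<nu>. norm (f x * g x) \<le> norm ((f x)\<^sup>2 + (g x)\<^sup>2)"
    by (intro AE_I2) (smt (verit) real_norm_def)
  show "(\<lambda>x. f x * g x) \<in> borel_measurable \<nu>" by measurable
qed

lemma in_L2_add:
  assumes "in_L2 \<nu> f" "in_L2 \<nu> g"
  shows "in_L2 \<nu> (\<lambda>x. f x + g x)"
  using assms in_L2_integrable_mult[OF assms]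
  by (auto simp: in_L2_def power2_sum mult.assoc)

lemma in_L2_scale: "in_L2 \<nu> f \<Longrightarrow> in_L2 \<nu> (\<lambda>x. c * f x)"
  by (auto simp: in_L2_def power_mult_distrib)

lemma in_L2_diff:
  assumes "in_L2 \<nu> f" "in_L2 \<nu> g"
  shows "in_L2 \<nu> (\<lambda>x. f x - g x)"
  using in_L2_add[OF assms(1) in_L2_scale[OF assms(2), of "-1"]] by simp

lemma in_L2_sum: "(\<And>k. k \<in> F \<Longrightarrow> in_L2 \<nu> (f k)) \<Longrightarrow> in_L2 \<nu> (\<lambda>x. \<Sum>k\<in>F. f k x)"
proof (induction F rule: infinite_finite_induct)
  case (insert k F)
  then show ?case using in_L2_add[of \<nu> "f k" "\<lambda>x. \<Sum>k\<in>F. f k x"] by simp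
qed (simp_all add: in_L2_def)

lemma in_L2_bounded:
  assumes "finite_measure \<nu>" "f \<in> borel_measurable \<nu>" "\<And>x. x \<in> space \<nu> \<Longrightarrow> \<bar>f x\<bar> \<le> B"
  shows "in_L2 \<nu> f"
proof -
  interpret finite_measure \<nu> by fact
  have "norm ((f x)\<^sup>2) \<le> B\<^sup>2" if "x \<in> space \<nu>" for x
    using power_mono[OF assms(3)[OF that], of 2] by simp
  then have "integrable \<nu> (\<lambda>x. (f x)\<^sup>2)"
    using assms(2) by (intro integrable_const_bound[where B="B\<^sup>2"]) auto
  then show ?thesis using assms(2) by (simp add: in_L2_def)
qed

lemma in_L2_integrable:
  assumes "finite_measure \<nu>" "in_L2 \<nu> f"
  shows "integrable \<nu> f"
  using in_L2_integrable_mult[OF assms(2) in_L2_bounded[OF assms(1), of "\<lambda>_. 1" 1]] by simp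

lemma L2_scalar_commute: "L2_scalar \<nu> f g = L2_scalar \<nu> g f"
  by (simp add: L2_scalar_def mult.commute)

lemma L2_scalar_nonneg: "0 \<le> L2_scalar \<nu> f f"
  by (simp add: L2_scalar_def)

lemma L2_scalar_diff: "in_L2 \<nu> f \<Longrightarrow> in_L2 \<nu> g \<Longrightarrow> in_L2 \<nu> h \<Longrightarrow>
    L2_scalar \<nu> (\<lambda>x. f x - g x) h = L2_scalar \<nu> f h - L2_scalar \<nu> g h"
  using in_L2_integrable_mult by (simp add: L2_scalar_def left_diff_distrib)

lemma L2_scalar_diff_right: "in_L2 \<nu> f \<Longrightarrow> in_L2 \<nu> g \<Longrightarrow> in_L2 \<nu> h \<Longrightarrow>
    L2_scalar \<nu> h (\<lambda>x. f x - g x) = L2_scalar \<nu> h f - L2_scalar \<nu> h g"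
  using L2_scalar_diff[of \<nu> f g h] by (simp add: L2_scalar_commute)

lemma L2_scalar_scale: "L2_scalar \<nu> (\<lambda>x. c * f x) g = c * L2_scalar \<nu> f g"
  by (simp add: L2_scalar_def mult.assoc)

lemma L2_scalar_scale_right: "L2_scalar \<nu> g (\<lambda>x. c * f x) = c * L2_scalar \<nu> g f"
  by (simp add: L2_scalar_def mult.left_commute)

lemma L2_scalar_sum_right: "(\<And>k. k \<in> F \<Longrightarrow> in_L2 \<nu> (f k)) \<Longrightarrow> in_L2 \<nu> g \<Longrightarrow>
    L2_scalar \<nu> g (\<lambda>x. \<Sum>k\<in>F. f k x) = (\<Sum>k\<in>F. L2_scalar \<nu> g (f k))"
  using in_L2_integrable_mult by (simp add: L2_scalar_def sum_distrib_left)

lemma L2_scalar_norm_diff: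
  assumes "in_L2 \<nu> f" "in_L2 \<nu> g"
  shows "L2_scalar \<nu> (\<lambda>x. f x - g x) (\<lambda>x. f x - g x) = L2_scalar \<nu> f f - 2 * L2_scalar \<nu> f g + L2_scalar \<nu> g g"
  using assms in_L2_diff[OF assms] L2_scalar_commute[of \<nu> g f]
  by (simp add: L2_scalar_diff L2_scalar_diff_right)

lemma L2_scalar_Cauchy_Schwarz:
  assumes "in_L2 \<nu> f" "in_L2 \<nu> g"
  shows "(L2_scalar \<nu> f g)\<^sup>2 \<le> L2_scalar \<nu> f f * L2_scalar \<nu> g g"
proof (rule psd_discriminant)
  fix x
  have "L2_scalar \<nu> (\<lambda>t. f t - (- x) * g t) (\<lambda>t. f t - (- x) * g t)
      = L2_scalar \<nu> f f + 2 * x * L2_scalar \<nu> f g + x\<^sup>2 * L2_scalar \<nu> g g"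
    using L2_scalar_norm_diff[OF assms(1) in_L2_scale[OF assms(2), of "- x"]]
    by (simp only: L2_scalar_scale L2_scalar_scale_right power2_eq_square)
  then show "0 \<le> L2_scalar \<nu> f f + 2 * x * L2_scalar \<nu> f g + x\<^sup>2 * L2_scalar \<nu> g g"
    using L2_scalar_nonneg by metis
qed

lemma L2_scalar_eq_0_iff:
  assumes "in_L2 \<nu> f"
  shows "L2_scalar \<nu> f f = 0 \<longleftrightarrow> (AE x in \<nu>. f x = 0)"
  unfolding L2_scalar_def using in_L2_integrable_mult[OF assms assms]
  by (subst integral_nonneg_eq_0_iff_AE) auto

section \<open>The process, its integrals and the covariance operator\<close>

locale kl_setting = prob_space M for M :: "'w measure" +
  fixes Y :: "real \<Rightarrow> 'w \<Rightarrow> real" and a b :: real and R :: "real \<Rightarrow> real \<Rightarrow> real" and \<nu> :: "real measure"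
  assumes ab: "a < b"
    and cont_Y: "continuous_process M {a..b} Y"
    and gauss_Y: "centered_gaussian_process M {a..b} Y"
    and R_eq: "\<And>s t. s \<in> {a..b} \<Longrightarrow> t \<in> {a..b} \<Longrightarrow> R s t = (\<integral>\<omega>. Y s \<omega> * Y t \<omega> \<partial>M)"
    and sets_\<nu>: "sets \<nu> = sets (restrict_space borel {a..b})"
    and finite_\<nu>: "finite_measure \<nu>"
begin

sublocale \<nu>: finite_measure \<nu> by (rule finite_\<nu>)

lemma space_\<nu>: "space \<nu> = {a..b}"
  using sets_eq_imp_space_eq[OF sets_\<nu>] by (simp add: space_restrict_space)

lemma measurable_\<nu>: "borel_measurable \<nu> = borel_measurable (restrict_space borel {a..b})"
  by (rule measurable_cong_sets) (auto simp: sets_\<nu>)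

lemma continuous_measurable:
  "continuous_on {a..b} f \<Longrightarrow> f \<in> borel_measurable \<nu>" for f :: "real \<Rightarrow> real"
  unfolding measurable_\<nu> by (rule borel_measurable_continuous_on_restrict)

lemma continuous_bounded:
  fixes f :: "real \<Rightarrow> real"
  assumes "continuous_on {a..b} f"
  obtains B where "B > 0" "\<And>x. x \<in> {a..b} \<Longrightarrow> \<bar>f x\<bar> \<le> B"
  using compact_imp_bounded[OF compact_continuous_image[OF assms compact_Icc]]
  unfolding bounded_pos by auto

lemma continuous_in_L2: "continuous_on {a..b} f \<Longrightarrow> in_L2 \<nu> f"
proof -
  assume f: "continuous_on {a..b} f"
  show ?thesis
  proof (rule continuous_bounded[OF f])
    fix B assume "\<And>x. x \<in> {a..b} \<Longrightarrow> \<bar>f x\<bar> \<le> B"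
    then show ?thesis by (intro in_L2_bounded[OF finite_\<nu> continuous_measurable[OF f]]) (simp add: space_\<nu>)
  qed
qed

lemma path_continuous: "\<omega> \<in> space M \<Longrightarrow> continuous_on {a..b} (\<lambda>t. Y t \<omega>)"
  using cont_Y by (simp add: continuous_process_def)

text \<open>Rounding down to a multiple of \<open>1 / real (Suc n)\<close> cannot pass
  \<open>b\<close>, and the maximum with \<open>a\<close> repairs the left end. The range on the
  interval is finite, so that Riemann sums are finite linear combinations of the
  \<open>Y t\<close>.\<close>

definition grid :: "nat \<Rightarrow> real \<Rightarrow> real" where
  "grid n s = max a (of_int \<lfloor>s * real (Suc n)\<rfloor> / real (Suc n))"

lemma grid_range: "s \<in> {a..b} \<Longrightarrow> grid n s \<in> {a..b}"
proof -
  assume s: "s \<in> {a..b}"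
  have "of_int \<lfloor>s * real (Suc n)\<rfloor> \<le> s * real (Suc n)" by (rule of_int_floor_le)
  then have "of_int \<lfloor>s * real (Suc n)\<rfloor> / real (Suc n) \<le> s" by (simp add: field_simps)
  then show ?thesis using s by (auto simp: grid_def)
qed

lemma grid_finite: "finite (grid n ` {a..b})"
proof (rule finite_subset)
  show "grid n ` {a..b} \<subseteq> (\<lambda>i. max a (of_int i / real (Suc n))) ` {\<lfloor>a * real (Suc n)\<rfloor>..\<lfloor>b * real (Suc n)\<rfloor>}"
    unfolding grid_def by (auto intro!: imageI floor_mono mult_right_mono)
qed simp

lemma grid_tendsto:
  assumes "s \<in> {a..b}" shows "(\<lambda>n. grid n s) \<longlonglongrightarrow> s"
proof -
  have lo: "s - 1 / real (Suc n) \<le> grid n s" for n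
  proof -
    have "s * real (Suc n) - 1 \<le> of_int \<lfloor>s * real (Suc n)\<rfloor>"
      using real_of_int_floor_gt_diff_one[of "s * real (Suc n)"] by (rule less_imp_le)
    then have "(s * real (Suc n) - 1) / real (Suc n) \<le> of_int \<lfloor>s * real (Suc n)\<rfloor> / real (Suc n)"
      by (intro divide_right_mono) auto
    then have "s - 1 / real (Suc n) \<le> of_int \<lfloor>s * real (Suc n)\<rfloor> / real (Suc n)"
      by (simp add: diff_divide_distrib del: of_nat_Suc)
    then show ?thesis unfolding grid_def by (rule max.coboundedI2)
  qed
  have hi: "grid n s \<le> s" for n
  proof -
    have "of_int \<lfloor>s * real (Suc n)\<rfloor> \<le> s * real (Suc n)" by (rule of_int_floor_le)
    then have "of_int \<lfloor>s * real (Suc n)\<rfloor> / real (Suc n) \<le> s" by (simp add: field_simps)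
    then show ?thesis using assms by (auto simp: grid_def)
  qed
  show ?thesis
    by (rule tendsto_sandwich[OF always_eventually always_eventually const_minus_inverse_tendsto[of s] tendsto_const])
      (use lo hi in blast)+
qed

lemma grid_measurable: "grid n \<in> borel_measurable \<nu>"
proof -
  have "grid n \<in> borel_measurable borel" unfolding grid_def by measurable
  then show ?thesis unfolding measurable_\<nu> by (rule measurable_restrict_space1)
qed

text \<open>The mass that the signed measure with \<nu>-density \<open>g\<close> gives to the set of
  points rounded to \<open>r\<close>; it is the coefficient in a Riemann sum.\<close>

definition weight :: "(real \<Rightarrow> real) \<Rightarrow> nat \<Rightarrow> real \<Rightarrow> real" where
  "weight g n r = (\<integral>s. indicator {s. grid n s = r} s * g s \<partial>\<nu>)"

lemma Riemann_sum_tendsto: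
  assumes f: "continuous_on {a..b} f" and g: "integrable \<nu> g"
  shows "(\<lambda>n. \<Sum>r\<in>grid n ` {a..b}. weight g n r * f r) \<longlonglongrightarrow> (\<integral>s. f s * g s \<partial>\<nu>)"
proof -
  obtain B where B: "\<And>x. x \<in> {a..b} \<Longrightarrow> \<bar>f x\<bar> \<le> B"
    using continuous_bounded[OF f] by blast
  have [measurable]: "g \<in> borel_measurable \<nu>" "f \<in> borel_measurable \<nu>" "grid n \<in> borel_measurable \<nu>" for n
    using g grid_measurable continuous_measurable[OF f] by auto
  \<comment> \<open>\<open>f\<close> is measurable on the interval only, so \<open>grid n\<close>
    has to be seen as a map of \<nu> into itself.\<close>
  have fg: "(\<lambda>s. f (grid n s)) \<in> borel_measurable \<nu>" for n
  proof -
    have "grid n \<in> measurable \<nu> \<nu>"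
      unfolding measurable_cong_sets[OF refl sets_\<nu>]
      using grid_measurable[of n] grid_range[of _ n] space_\<nu>
      by (intro measurable_restrict_space2) auto
    then show ?thesis by (rule measurable_compose) measurable
  qed
  have eq: "(\<Sum>r\<in>grid n ` {a..b}. weight g n r * f r) = (\<integral>s. f (grid n s) * g s \<partial>\<nu>)" for n
  proof -
    have i: "integrable \<nu> (\<lambda>s. indicator {s. grid n s = r} s * g s * f r)" for r
    proof -
      have "integrable \<nu> (\<lambda>s. indicator {s\<in>space \<nu>. grid n s = r} s * g s)"
        using g by (intro integrable_mult_indicator[where 'b=real, simplified]) measurable
      also have "?this = integrable \<nu> (\<lambda>s. indicator {s. grid n s = r} s * g s)"
        by (intro Bochner_Integration.integrable_cong) (auto simp: indicator_def)
      finally show ?thesis by simp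
    qed
    have "(\<Sum>r\<in>grid n ` {a..b}. weight g n r * f r)
        = (\<integral>s. (\<Sum>r\<in>grid n ` {a..b}. indicator {s. grid n s = r} s * g s * f r) \<partial>\<nu>)"
      using i by (simp add: weight_def)
    also have "\<dots> = (\<integral>s. f (grid n s) * g s \<partial>\<nu>)"
    proof (rule Bochner_Integration.integral_cong)
      fix s assume s: "s \<in> space \<nu>"
      have "(\<Sum>r\<in>grid n ` {a..b}. indicator {s. grid n s = r} s * g s * f r)
          = (\<Sum>r\<in>grid n ` {a..b}. if r = grid n s then g s * f r else 0)"
        by (intro sum.cong) (auto simp: indicator_def)
      then show "(\<Sum>r\<in>grid n ` {a..b}. indicator {s. grid n s = r} s * g s * f r) = f (grid n s) * g s"
        using grid_finite s space_\<nu> by simp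
    qed simp
    finally show ?thesis .
  qed
  have "(\<lambda>n. \<integral>s. f (grid n s) * g s \<partial>\<nu>) \<longlonglongrightarrow> (\<integral>s. f s * g s \<partial>\<nu>)"
  proof (rule integral_dominated_convergence[where w="\<lambda>s. B * \<bar>g s\<bar>"])
    show "AE s in \<nu>. (\<lambda>n. f (grid n s) * g s) \<longlonglongrightarrow> f s * g s"
    proof (rule AE_I2)
      fix s assume "s \<in> space \<nu>"
      then have s: "s \<in> {a..b}" by (simp add: space_\<nu>)
      have "(\<lambda>n. f (grid n s)) \<longlonglongrightarrow> f s"
        using f grid_tendsto[OF s] s grid_range[OF s] unfolding continuous_on_sequentially
        by (auto simp: comp_def)
      then show "(\<lambda>n. f (grid n s) * g s) \<longlonglongrightarrow> f s * g s" by (intro tendsto_intros)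
    qed
    show "AE s in \<nu>. norm (f (grid n s) * g s) \<le> B * \<bar>g s\<bar>" for n
      using B grid_range space_\<nu> by (intro AE_I2) (auto simp: abs_mult intro!: mult_right_mono)
    show "(\<lambda>s. f (grid n s) * g s) \<in> borel_measurable \<nu>" for n
      using fg[of n] by measurable
  qed (use g in auto)
  then show ?thesis unfolding eq .
qed

text \<open>One passage to the limit already captures the integrals \<open>I g\<close>, which are
  limits of Riemann sums along every path. Convergence at each sample point is the form in which
  \<open>centered_normal_limit\<close> preserves normality.\<close>

definition G :: "('w \<Rightarrow> real) set" where
  "G = {X. \<exists>F c. (\<forall>n. finite (F n) \<and> F n \<subseteq> {a..b}) \<and>
        (\<forall>\<omega>\<in>space M. (\<lambda>n. \<Sum>t\<in>F n. c n t * Y t \<omega>) \<longlonglongrightarrow> X \<omega>)}"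

lemma G_I:
  assumes "\<And>n. finite (F n)" "\<And>n. F n \<subseteq> {a..b}"
    "\<And>\<omega>. \<omega> \<in> space M \<Longrightarrow> (\<lambda>n. \<Sum>t\<in>F n. c n t * Y t \<omega>) \<longlonglongrightarrow> X \<omega>"
  shows "X \<in> G"
  unfolding G_def using assms by blast

lemma G_E:
  assumes "X \<in> G"
  obtains F c where "\<And>n. finite (F n)" "\<And>n. F n \<subseteq> {a..b}"
    "\<And>\<omega>. \<omega> \<in> space M \<Longrightarrow> (\<lambda>n. \<Sum>t\<in>F n. c n t * Y t \<omega>) \<longlonglongrightarrow> X \<omega>"
proof -
  from assms obtain F c where *: "(\<forall>n. finite (F n) \<and> F n \<subseteq> {a..b}) \<and>
        (\<forall>\<omega>\<in>space M. (\<lambda>n. \<Sum>t\<in>F n. c n t * Y t \<omega>) \<longlonglongrightarrow> X \<omega>)"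
    unfolding G_def mem_Collect_eq by (elim exE)
  show ?thesis by (rule that[of F c]) (use * in auto)
qed

sublocale gaussian_space M G
proof
  show "(\<lambda>_. 0) \<in> G"
    by (rule G_I[where F="\<lambda>_. {}"]) auto
next
  fix X X' assume X: "X \<in> G" and X': "X' \<in> G"
  obtain F c where
    F: "\<And>n. finite (F n)" "\<And>n. F n \<subseteq> {a..b}" "\<And>\<omega>. \<omega> \<in> space M \<Longrightarrow> (\<lambda>n. \<Sum>t\<in>F n. c n t * Y t \<omega>) \<longlonglongrightarrow> X \<omega>"
  proof (rule G_E[OF X])
  qed (rule that)
  obtain F' c' where
    F': "\<And>n. finite (F' n)" "\<And>n. F' n \<subseteq> {a..b}" "\<And>\<omega>. \<omega> \<in> space M \<Longrightarrow> (\<lambda>n. \<Sum>t\<in>F' n. c' n t * Y t \<omega>) \<longlonglongrightarrow> X' \<omega>"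
  proof (rule G_E[OF X'])
  qed (rule that)
  \<comment> \<open>The two index sets may overlap, so the coefficients, extended by 0, are added on
    the union.\<close>
  define d where "d = (\<lambda>n t. (if t \<in> F n then c n t else 0) + (if t \<in> F' n then c' n t else 0))"
  have "(\<Sum>t\<in>F n \<union> F' n. d n t * Y t \<omega>) = (\<Sum>t\<in>F n. c n t * Y t \<omega>) + (\<Sum>t\<in>F' n. c' n t * Y t \<omega>)" for n \<omega>
  proof -
    have "(\<Sum>t\<in>F n \<union> F' n. d n t * Y t \<omega>) =
        (\<Sum>t\<in>F n \<union> F' n. (if t \<in> F n then c n t else 0) * Y t \<omega>) + (\<Sum>t\<in>F n \<union> F' n. (if t \<in> F' n then c' n t else 0) * Y t \<omega>)"
      by (simp add: d_def distrib_right sum.distrib)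
    also have "(\<Sum>t\<in>F n \<union> F' n. (if t \<in> F n then c n t else 0) * Y t \<omega>) = (\<Sum>t\<in>F n. c n t * Y t \<omega>)"
      using F F' by (intro sum.mono_neutral_cong_right) auto
    also have "(\<Sum>t\<in>F n \<union> F' n. (if t \<in> F' n then c' n t else 0) * Y t \<omega>) = (\<Sum>t\<in>F' n. c' n t * Y t \<omega>)"
      using F F' by (intro sum.mono_neutral_cong_right) auto
    finally show ?thesis .
  qed
  then show "(\<lambda>\<omega>. X \<omega> + X' \<omega>) \<in> G"
    using F F' by (intro G_I[where F="\<lambda>n. F n \<union> F' n" and c=d]) (auto intro!: tendsto_intros)
next
  fix X k assume X: "X \<in> G"
  obtain F c where
    F: "\<And>n. finite (F n)" "\<And>n. F n \<subseteq> {a..b}" "\<And>\<omega>. \<omega> \<in> space M \<Longrightarrow> (\<lambda>n. \<Sum>t\<in>F n. c n t * Y t \<omega>) \<longlonglongrightarrow> X \<omega>"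
  proof (rule G_E[OF X])
  qed (rule that)
  then show "(\<lambda>\<omega>. k * X \<omega>) \<in> G"
    by (intro G_I[where F=F and c="\<lambda>n t. k * c n t"])
      (auto simp: mult.assoc sum_distrib_left[symmetric] intro!: tendsto_intros)
next
  fix X assume X: "X \<in> G"
  obtain F c where
    F: "\<And>n. finite (F n)" "\<And>n. F n \<subseteq> {a..b}" "\<And>\<omega>. \<omega> \<in> space M \<Longrightarrow> (\<lambda>n. \<Sum>t\<in>F n. c n t * Y t \<omega>) \<longlonglongrightarrow> X \<omega>"
  proof (rule G_E[OF X])
  qed (rule that)
  show "centered_normal M X"
    by (rule centered_normal_limit(1)[OF prob_space_axioms _ F(3)])
      (use gauss_Y F in \<open>auto simp: centered_gaussian_process_def\<close>)
qed

lemma Y_mem: "t \<in> {a..b} \<Longrightarrow> Y t \<in> G"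
  by (rule G_I[where F="\<lambda>_. {t}" and c="\<lambda>_ _. 1"]) auto

definition I :: "(real \<Rightarrow> real) \<Rightarrow> 'w \<Rightarrow> real" where
  "I g \<omega> = (\<integral>s. Y s \<omega> * g s \<partial>\<nu>)"

lemma I_mem: "integrable \<nu> g \<Longrightarrow> I g \<in> G"
  unfolding I_def
  by (rule G_I[where F="\<lambda>n. grid n ` {a..b}" and c="weight g"])
    (use grid_finite grid_range Riemann_sum_tendsto[OF path_continuous] in auto)

lemma path_limit:
  assumes "\<And>n. x n \<in> {a..b}" "t \<in> {a..b}" "x \<longlonglongrightarrow> t" "\<omega> \<in> space M"
  shows "(\<lambda>n. Y (x n) \<omega>) \<longlonglongrightarrow> Y t \<omega>"
  using path_continuous[OF assms(4)] assms unfolding continuous_on_sequentially by (auto simp: comp_def)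

text \<open>Continuity comes from the paths: \<open>Y (x n)\<close> converges to \<open>Y t\<close>
  at every sample point, and \<open>cov_limit\<close> passes this on to covariances. For
  \<open>X = Y t\<close> it is continuity of the covariance function in one variable.\<close>

lemma cov_continuous:
  assumes "X \<in> G" shows "continuous_on {a..b} (\<lambda>s. cov (Y s) X)"
  unfolding continuous_on_sequentially comp_def
proof (intro allI ballI impI, elim conjE)
  fix x t assume "t \<in> {a..b}" "\<forall>n. x n \<in> {a..b}" "x \<longlonglongrightarrow> t"
  then show "(\<lambda>n. cov (Y (x n)) X) \<longlonglongrightarrow> cov (Y t) X"
    by (intro cov_limit[OF Y_mem Y_mem assms] path_limit) auto
qed

text \<open>Expectation and \<nu>-integral are exchanged through Riemann sums. The covariance of a
  Riemann sum with \<open>X\<close> is a Riemann sum of the continuous function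
  \<open>cov (Y s) X\<close>, with the same weights, and limits are unique.\<close>

lemma cov_I:
  assumes g: "integrable \<nu> g" and X: "X \<in> G"
  shows "cov (I g) X = (\<integral>s. cov (Y s) X * g s \<partial>\<nu>)"
proof (rule LIMSEQ_unique)
  let ?S = "\<lambda>n \<omega>. \<Sum>r\<in>grid n ` {a..b}. weight g n r * Y r \<omega>"
  have mem: "(\<lambda>\<omega>. weight g n r * Y r \<omega>) \<in> G" if "r \<in> grid n ` {a..b}" for n r
    using that grid_range by (intro scale Y_mem) auto
  show "(\<lambda>n. cov (?S n) X) \<longlonglongrightarrow> cov (I g) X"
  proof (rule cov_limit[OF _ I_mem[OF g] X])
    show "?S n \<in> G" for n using mem by (intro sum) auto
    show "(\<lambda>n. ?S n \<omega>) \<longlonglongrightarrow> I g \<omega>" if "\<omega> \<in> space M" for \<omega>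
      unfolding I_def by (rule Riemann_sum_tendsto[OF path_continuous[OF that] g])
  qed
  have "cov (?S n) X = (\<Sum>r\<in>grid n ` {a..b}. weight g n r * cov (Y r) X)" for n
    using mem X by (subst cov_sum) (auto simp: cov_scale)
  then show "(\<lambda>n. cov (?S n) X) \<longlonglongrightarrow> (\<integral>s. cov (Y s) X * g s \<partial>\<nu>)"
    using Riemann_sum_tendsto[OF cov_continuous[OF X] g] by simp
qed

lemma increment_var_continuous:
  assumes "t \<in> {a..b}"
  shows "continuous_on {a..b} (\<lambda>s. cov (\<lambda>\<omega>. Y t \<omega> - Y s \<omega>) (\<lambda>\<omega>. Y t \<omega> - Y s \<omega>))"
  unfolding continuous_on_sequentially comp_def
proof (intro allI ballI impI, elim conjE)
  fix x s assume "s \<in> {a..b}" "\<forall>n. x n \<in> {a..b}" "x \<longlonglongrightarrow> s"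
  then show "(\<lambda>n. cov (\<lambda>\<omega>. Y t \<omega> - Y (x n) \<omega>) (\<lambda>\<omega>. Y t \<omega> - Y (x n) \<omega>))
      \<longlonglongrightarrow> cov (\<lambda>\<omega>. Y t \<omega> - Y s \<omega>) (\<lambda>\<omega>. Y t \<omega> - Y s \<omega>)"
    using assms by (intro var_limit[OF diff[OF Y_mem Y_mem]] tendsto_diff tendsto_const path_limit) auto
qed

lemma var_continuous: "continuous_on {a..b} (\<lambda>t. cov (Y t) (Y t))"
  unfolding continuous_on_sequentially comp_def
proof (intro allI ballI impI, elim conjE)
  fix x t assume "t \<in> {a..b}" "\<forall>n. x n \<in> {a..b}" "x \<longlonglongrightarrow> t"
  then show "(\<lambda>n. cov (Y (x n)) (Y (x n))) \<longlonglongrightarrow> cov (Y t) (Y t)"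
    by (intro var_limit[OF Y_mem] path_limit) auto
qed

text \<open>The kernel operator in covariance form; the two agree on the interval for integrable
  \<open>f\<close>. In this form Cauchy-Schwarz in the Gaussian space bounds both values and
  increments of \<open>A f\<close>.\<close>

definition A :: "(real \<Rightarrow> real) \<Rightarrow> real \<Rightarrow> real" where
  "A f t = cov (Y t) (I f)"

lemma A_eq_kernel:
  assumes "integrable \<nu> f" "t \<in> {a..b}"
  shows "kernel_operator \<nu> R f t = A f t"
proof -
  have "A f t = (\<integral>s. cov (Y s) (Y t) * f s \<partial>\<nu>)"
    unfolding A_def cov_commute[of "Y t" "I f"] by (rule cov_I[OF assms(1) Y_mem[OF assms(2)]])
  also have "\<dots> = (\<integral>s. R s t * f s \<partial>\<nu>)"
    using assms(2) by (intro Bochner_Integration.integral_cong) (auto simp: space_\<nu> cov_def R_eq)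
  finally show ?thesis by (simp add: kernel_operator_def)
qed

lemma A_continuous: "integrable \<nu> f \<Longrightarrow> continuous_on {a..b} (A f)"
  unfolding A_def by (intro cov_continuous I_mem)

lemma I_L2_mem: "in_L2 \<nu> f \<Longrightarrow> I f \<in> G"
  by (intro I_mem in_L2_integrable finite_\<nu>)

lemma A_in_L2: "in_L2 \<nu> f \<Longrightarrow> in_L2 \<nu> (A f)"
  by (rule continuous_in_L2[OF A_continuous[OF in_L2_integrable[OF finite_\<nu>]]])

text \<open>Through this identity the quadratic form of \<open>A\<close> inherits symmetry,
  non-negativity and its own Cauchy-Schwarz inequality from the covariance.\<close>

lemma cov_I_I:
  assumes "in_L2 \<nu> f" "in_L2 \<nu> g"
  shows "cov (I f) (I g) = L2_scalar \<nu> (A g) f"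
  using cov_I[OF in_L2_integrable[OF finite_\<nu> assms(1)] I_L2_mem[OF assms(2)]]
  by (simp add: L2_scalar_def A_def)

lemma A_self_adjoint:
  assumes "in_L2 \<nu> f" "in_L2 \<nu> g"
  shows "L2_scalar \<nu> (A g) f = L2_scalar \<nu> (A f) g"
  using cov_I_I[OF assms] cov_I_I[OF assms(2,1)] cov_commute[of "I f" "I g"] by simp

lemma path_integrable:
  assumes "in_L2 \<nu> f" "\<omega> \<in> space M"
  shows "integrable \<nu> (\<lambda>s. Y s \<omega> * f s)"
  by (rule in_L2_integrable_mult[OF continuous_in_L2[OF path_continuous[OF assms(2)]] assms(1)])

lemma I_diff:
  assumes "in_L2 \<nu> f" "in_L2 \<nu> g" "\<omega> \<in> space M"
  shows "I (\<lambda>s. f s - g s) \<omega> = I f \<omega> - I g \<omega>"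
  using path_integrable assms by (simp add: I_def right_diff_distrib)

lemma I_scale: "I (\<lambda>s. c * f s) \<omega> = c * I f \<omega>"
  by (simp add: I_def mult.left_commute)

lemma I_sum:
  assumes "\<And>k. k \<in> F \<Longrightarrow> in_L2 \<nu> (f k)" "\<omega> \<in> space M"
  shows "I (\<lambda>s. \<Sum>k\<in>F. f k s) \<omega> = (\<Sum>k\<in>F. I (f k) \<omega>)"
  using path_integrable assms by (simp add: I_def sum_distrib_left)

lemma A_diff:
  assumes "in_L2 \<nu> f" "in_L2 \<nu> g" "t \<in> {a..b}"
  shows "A (\<lambda>s. f s - g s) t = A f t - A g t"
proof -
  have "A (\<lambda>s. f s - g s) t = cov (Y t) (\<lambda>\<omega>. I f \<omega> - I g \<omega>)"
    unfolding A_def cov_def using I_diff[OF assms(1,2)] by (intro Bochner_Integration.integral_cong) auto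
  then show ?thesis using I_L2_mem Y_mem assms by (simp add: cov_diff_right A_def)
qed

lemma A_scale: "A (\<lambda>s. c * f s) t = c * A f t"
  unfolding A_def cov_def by (simp add: I_scale mult.left_commute)

text \<open>Cauchy-Schwarz for \<open>Y t\<close> and \<open>I f\<close> gives the pointwise bound,
  with \<open>B\<close> a bound on the variance of \<open>Y\<close>. Integrated over \<nu> and
  combined with Cauchy-Schwarz in L2, it bounds the square of the form by the form times the squared
  norm of \<open>f\<close>, and one factor is cancelled.\<close>

lemma A_bound:
  obtains K where "K > 0"
    "\<And>f t. in_L2 \<nu> f \<Longrightarrow> t \<in> {a..b} \<Longrightarrow> (A f t)\<^sup>2 \<le> K * cov (I f) (I f)"
    "\<And>f. in_L2 \<nu> f \<Longrightarrow> cov (I f) (I f) \<le> K * L2_scalar \<nu> f f"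
proof -
  obtain B where B: "B > 0" "\<And>t. t \<in> {a..b} \<Longrightarrow> \<bar>cov (Y t) (Y t)\<bar> \<le> B"
  proof (rule continuous_bounded[OF var_continuous])
  qed (rule that)
  have 1: "(A f t)\<^sup>2 \<le> B * cov (I f) (I f)" if f: "in_L2 \<nu> f" and t: "t \<in> {a..b}" for f t
  proof -
    have "(A f t)\<^sup>2 \<le> cov (Y t) (Y t) * cov (I f) (I f)"
      unfolding A_def by (rule cov_Cauchy_Schwarz[OF Y_mem[OF t] I_L2_mem[OF f]])
    also have "\<dots> \<le> B * cov (I f) (I f)"
      using B(2)[OF t] by (intro mult_right_mono cov_nonneg) auto
    finally show ?thesis .
  qed
  define m where "m = measure \<nu> (space \<nu>)"
  have m0: "0 \<le> m" by (simp add: m_def)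
  have 2: "cov (I f) (I f) \<le> B * m * L2_scalar \<nu> f f" if f: "in_L2 \<nu> f" for f
  proof -
    let ?v = "cov (I f) (I f)"
    have "?v\<^sup>2 \<le> L2_scalar \<nu> (A f) (A f) * L2_scalar \<nu> f f"
      unfolding cov_I_I[OF f f] by (rule L2_scalar_Cauchy_Schwarz[OF A_in_L2[OF f] f])
    also have "\<dots> \<le> (B * ?v * m) * L2_scalar \<nu> f f"
    proof (rule mult_right_mono[OF _ L2_scalar_nonneg])
      have "L2_scalar \<nu> (A f) (A f) \<le> (\<integral>_. B * ?v \<partial>\<nu>)"
        unfolding L2_scalar_def
        using 1[OF f] in_L2_integrable_mult[OF A_in_L2[OF f] A_in_L2[OF f]]
        by (intro integral_mono) (auto simp: space_\<nu> power2_eq_square)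
      then show "L2_scalar \<nu> (A f) (A f) \<le> B * ?v * m" by (simp add: m_def mult_ac)
    qed
    finally have "?v * ?v \<le> ?v * (B * m * L2_scalar \<nu> f f)"
      by (simp add: power2_eq_square mult_ac)
    moreover have "0 \<le> B * m * L2_scalar \<nu> f f"
      using B m0 L2_scalar_nonneg by (intro mult_nonneg_nonneg) auto
    ultimately show ?thesis
      using cov_nonneg[of "I f"] by (cases "?v = 0") (auto simp: mult_le_cancel_left)
  qed
  show ?thesis
  \<comment> \<open>This constant dominates both \<open>B\<close> and \<open>B * m\<close>, and is
    positive even if \<nu> is the zero measure.\<close>
  proof (rule that[of "B + B * m"])
    show "0 < B + B * m" using B m0 by (simp add: add_pos_nonneg)
    show "(A f t)\<^sup>2 \<le> (B + B * m) * cov (I f) (I f)" if "in_L2 \<nu> f" "t \<in> {a..b}" for f t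
      using 1[OF that] mult_nonneg_nonneg[OF mult_nonneg_nonneg[of B m] cov_nonneg[of "I f"]] B m0
      by (simp add: distrib_right)
    show "cov (I f) (I f) \<le> (B + B * m) * L2_scalar \<nu> f f" if "in_L2 \<nu> f" for f
    proof -
      have "0 \<le> B * L2_scalar \<nu> f f" using B L2_scalar_nonneg[of \<nu> f] by simp
      then show ?thesis using 2[OF that] by (simp add: distrib_right)
    qed
  qed
qed

end

section \<open>The Rayleigh quotient of the covariance operator\<close>

lemma tendsto_0_if_square_le:
  fixes x y :: "nat \<Rightarrow> real"
  assumes "\<And>n. (x n)\<^sup>2 \<le> c * y n" "y \<longlonglongrightarrow> 0"
  shows "x \<longlonglongrightarrow> 0"
proof -
  have "(\<lambda>n. (x n)\<^sup>2) \<longlonglongrightarrow> 0"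
    by (rule tendsto_sandwich[of "\<lambda>_. 0" _ _ "\<lambda>n. c * y n"])
      (use assms(1) tendsto_mult_right_zero[OF assms(2)] in auto)
  then have "(\<lambda>n. sqrt ((x n)\<^sup>2)) \<longlonglongrightarrow> sqrt 0" by (rule tendsto_real_sqrt)
  then show ?thesis by (simp add: tendsto_rabs_zero_iff)
qed

context kl_setting
begin

lemma L2_scalar_uniform_tendsto_0:
  assumes L2: "\<And>n. in_L2 \<nu> (w n)"
    and unif: "\<And>e. 0 < e \<Longrightarrow> \<exists>N. \<forall>n x. n \<ge> N \<and> x \<in> {a..b} \<longrightarrow> norm (w n x) < e"
  shows "(\<lambda>n. L2_scalar \<nu> (w n) (w n)) \<longlonglongrightarrow> 0"
proof (rule LIMSEQ_I)
  fix r :: real assume r: "0 < r"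
  define m where "m = measure \<nu> (space \<nu>)"
  have m: "0 \<le> m" by (simp add: m_def)
  \<comment> \<open>The choice gives \<open>e\<^sup>2 * m < r\<close>; \<open>m + 1\<close> in the
    denominator also covers the zero measure.\<close>
  define e where "e = sqrt (r / (m + 1))"
  have e: "0 < e" "e\<^sup>2 * m < r"
    using r m by (auto simp: e_def field_simps)
  obtain N where N: "\<And>n x. n \<ge> N \<Longrightarrow> x \<in> {a..b} \<Longrightarrow> norm (w n x) < e"
    using unif[OF e(1)] by blast
  show "\<exists>no. \<forall>n\<ge>no. norm (L2_scalar \<nu> (w n) (w n) - 0) < r"
  proof (intro exI[of _ N] allI impI)
    fix n assume n: "N \<le> n"
    have "L2_scalar \<nu> (w n) (w n) \<le> (\<integral>_. e\<^sup>2 \<partial>\<nu>)"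
      unfolding L2_scalar_def
    proof (rule integral_mono)
      fix x assume "x \<in> space \<nu>"
      then have "(norm (w n x))\<^sup>2 \<le> e\<^sup>2"
        using N[OF n, of x] by (intro power_mono) (auto simp: space_\<nu>)
      then show "w n x * w n x \<le> e\<^sup>2" by (simp add: power2_eq_square)
    qed (use L2 in_L2_integrable_mult in auto)
    also have "\<dots> = e\<^sup>2 * m" by (simp add: m_def mult.commute)
    finally show "norm (L2_scalar \<nu> (w n) (w n) - 0) < r"
      using e L2_scalar_nonneg[of \<nu> "w n"] by simp
  qed
qed

lemma eigen_equation_A:
  assumes "eigen_equation \<nu> R \<mu> f"
  shows "AE t in \<nu>. A f t = \<mu> * f t"
proof -
  have L2: "in_L2 \<nu> f" and "AE t in \<nu>. kernel_operator \<nu> R f t = \<mu> * f t"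
    using assms by (auto simp: eigen_equation_def)
  then show ?thesis
    using A_eq_kernel[OF in_L2_integrable[OF finite_\<nu> L2]] space_\<nu> by (auto elim!: AE_mp)
qed

lemma eigen_equation_scalar:
  assumes "eigen_equation \<nu> R \<mu> f" "in_L2 \<nu> g"
  shows "L2_scalar \<nu> (A f) g = \<mu> * L2_scalar \<nu> f g"
proof -
  have f: "in_L2 \<nu> f" using assms(1) by (simp add: eigen_equation_def)
  have [measurable]: "A f \<in> borel_measurable \<nu>" "f \<in> borel_measurable \<nu>" "g \<in> borel_measurable \<nu>"
    using f assms(2) A_in_L2 by (auto intro: in_L2_measurable)
  have "L2_scalar \<nu> (A f) g = (\<integral>t. \<mu> * f t * g t \<partial>\<nu>)"
    unfolding L2_scalar_def using eigen_equation_A[OF assms(1)]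
    by (intro integral_cong_AE) auto
  then show ?thesis by (simp add: L2_scalar_def mult.assoc)
qed

text \<open>The supremum of the Rayleigh quotient over an invariant subspace is attained: for a
  maximizing sequence \<open>f n\<close> the images \<open>A (f n)\<close> are equicontinuous, hence converge uniformly along a
  subsequence, and their limit is the eigenfunction.\<close>
lemma max_eigenfunction:
  fixes lam :: "'k \<Rightarrow> real" and e :: "'k \<Rightarrow> real \<Rightarrow> real"
  assumes e: "\<And>k. k \<in> P \<Longrightarrow> eigen_equation \<nu> R (lam k) (e k)"
    and f0: "in_L2 \<nu> f0" "\<And>k. k \<in> P \<Longrightarrow> L2_scalar \<nu> (e k) f0 = 0"
    and \<epsilon>: "0 \<le> \<epsilon>" "\<epsilon> * L2_scalar \<nu> f0 f0 < cov (I f0) (I f0)"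
  obtains \<mu> g where "\<epsilon> < \<mu>" "in_L2 \<nu> g" "\<And>t. t \<in> {a..b} \<Longrightarrow> A g t = \<mu> * g t"
    "\<And>k. k \<in> P \<Longrightarrow> L2_scalar \<nu> (e k) g = 0" "0 < L2_scalar \<nu> g g"
proof -
  \<comment> \<open>\<open>V\<close> is the orthogonal complement of the eigenfunctions indexed by
    \<open>P\<close>, and \<open>B\<close> is the quadratic form of \<open>A\<close>.
    Self-adjointness makes \<open>V\<close> invariant under \<open>A\<close>.\<close>
  define V where "V f \<longleftrightarrow> in_L2 \<nu> f \<and> (\<forall>k\<in>P. L2_scalar \<nu> (e k) f = 0)" for f
  define B where "B f = cov (I f) (I f)" for f
  obtain K where K: "K > 0"
    "\<And>f t. in_L2 \<nu> f \<Longrightarrow> t \<in> {a..b} \<Longrightarrow> (A f t)\<^sup>2 \<le> K * B f"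
    "\<And>f. in_L2 \<nu> f \<Longrightarrow> B f \<le> K * L2_scalar \<nu> f f"
    using A_bound unfolding B_def by blast
  have K2: "(A f t)\<^sup>2 \<le> K * K * L2_scalar \<nu> f f" if "in_L2 \<nu> f" "t \<in> {a..b}" for f t
  proof -
    have "K * B f \<le> K * (K * L2_scalar \<nu> f f)"
      using K(3)[OF that(1)] K(1) by (intro mult_left_mono) auto
    then show ?thesis using K(2)[OF that] by (simp add: mult.assoc)
  qed
  have V_L2: "in_L2 \<nu> f" if "V f" for f using that by (simp add: V_def)
  have B_scalar: "B f = L2_scalar \<nu> (A f) f" if "V f" for f
    unfolding B_def using cov_I_I[OF V_L2[OF that] V_L2[OF that]] .
  have V_A: "V (A f)" if "V f" for f
  proof -
    have "L2_scalar \<nu> (e k) (A f) = 0" if k: "k \<in> P" for k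
    proof -
      have "in_L2 \<nu> (e k)" using e[OF k] by (simp add: eigen_equation_def)
      then have "L2_scalar \<nu> (e k) (A f) = L2_scalar \<nu> (A (e k)) f"
        using A_self_adjoint[OF V_L2[OF \<open>V f\<close>], of "e k"] L2_scalar_commute[of \<nu> "e k" "A f"] by simp
      then show ?thesis
        using eigen_equation_scalar[OF e[OF k] V_L2[OF \<open>V f\<close>]] \<open>V f\<close> k by (simp add: V_def)
    qed
    then show ?thesis using A_in_L2[OF V_L2[OF that]] by (simp add: V_def)
  qed
  have V_scale: "V (\<lambda>x. c * f x)" if "V f" for c f
    using that by (auto simp: V_def L2_scalar_scale_right intro: in_L2_scale)
  have B_scale: "B (\<lambda>x. c * f x) = c\<^sup>2 * B f" for c f
    unfolding B_def cov_def by (simp add: I_scale power2_eq_square mult_ac)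
  have normalize: "\<exists>c. L2_scalar \<nu> (\<lambda>x. c * f x) (\<lambda>x. c * f x) = 1 \<and> c\<^sup>2 * L2_scalar \<nu> f f = 1" if "0 < L2_scalar \<nu> f f" for f
  proof -
    have "L2_scalar \<nu> (\<lambda>x. c * f x) (\<lambda>x. c * f x) = c\<^sup>2 * L2_scalar \<nu> f f" for c
      by (simp add: L2_scalar_scale L2_scalar_scale_right power2_eq_square)
    moreover have "(1 / sqrt (L2_scalar \<nu> f f))\<^sup>2 * L2_scalar \<nu> f f = 1"
      using that by (simp add: power_divide)
    ultimately show ?thesis by metis
  qed
  define S where "S = {B f | f. V f \<and> L2_scalar \<nu> f f = 1}"
  define \<mu> where "\<mu> = Sup S"
  have bdd: "bdd_above S"
    unfolding S_def using K(3) V_L2 by (intro bdd_aboveI[of _ K]) fastforce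
  have S_le: "B f \<le> \<mu>" if "V f" "L2_scalar \<nu> f f = 1" for f
    unfolding \<mu>_def using that by (intro cSup_upper bdd) (auto simp: S_def)
  have B_le: "B f \<le> \<mu> * L2_scalar \<nu> f f" if f: "V f" for f
  proof (cases "L2_scalar \<nu> f f = 0")
    case True
    then show ?thesis using K(3)[OF V_L2[OF f]] by simp
  next
    case False
    then have pos: "0 < L2_scalar \<nu> f f" using L2_scalar_nonneg[of \<nu> f] by simp
    then obtain c where c: "L2_scalar \<nu> (\<lambda>x. c * f x) (\<lambda>x. c * f x) = 1" "c\<^sup>2 * L2_scalar \<nu> f f = 1"
      using normalize by blast
    have "c\<^sup>2 * B f \<le> \<mu>" using S_le[OF V_scale[OF f] c(1)] by (simp add: B_scale)
    then have "(c\<^sup>2 * B f) * L2_scalar \<nu> f f \<le> \<mu> * L2_scalar \<nu> f f"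
      using pos by (intro mult_right_mono) auto
    moreover have "(c\<^sup>2 * B f) * L2_scalar \<nu> f f = (c\<^sup>2 * L2_scalar \<nu> f f) * B f" by (simp add: mult_ac)
    ultimately show ?thesis using c(2) by simp
  qed
  have Vf0: "V f0" using f0 by (simp add: V_def)
  have pos0: "0 < L2_scalar \<nu> f0 f0"
    using K(3)[OF f0(1)] \<epsilon> L2_scalar_nonneg[of \<nu> f0] unfolding B_def
    by (cases "L2_scalar \<nu> f0 f0 = 0") auto
  have "\<epsilon> * L2_scalar \<nu> f0 f0 < \<mu> * L2_scalar \<nu> f0 f0"
    using \<epsilon>(2) B_le[OF Vf0] by (simp add: B_def)
  then have \<mu>: "\<epsilon> < \<mu>" using pos0 by simp
  have "S \<noteq> {}"
    using normalize[OF pos0] V_scale[OF Vf0] by (auto simp: S_def)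
  then have "\<exists>y\<in>S. \<mu> - 1 / real (Suc n) < y" for n
    using less_cSup_iff[OF _ bdd, of "\<mu> - 1 / real (Suc n)"] unfolding \<mu>_def[symmetric] by simp
  then have "\<exists>f. V f \<and> L2_scalar \<nu> f f = 1 \<and> \<mu> - 1 / real (Suc n) < B f" for n
    unfolding S_def by blast
  then have "\<forall>n. \<exists>f. V f \<and> L2_scalar \<nu> f f = 1 \<and> \<mu> - 1 / real (Suc n) < B f" by (rule allI)
  from choice[OF this] obtain f where f: "\<And>n. V (f n)" "\<And>n. L2_scalar \<nu> (f n) (f n) = 1" "\<And>n. \<mu> - 1 / real (Suc n) < B (f n)"
    by blast
  have f_L2: "in_L2 \<nu> (f n)" for n using V_L2[OF f(1)] .
  have BK: "B (f n) \<le> K" for n using K(3)[OF f_L2, of n] f(2) by simp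
  have "\<mu> - 1 / real (Suc n) \<le> B (f n)" "B (f n) \<le> \<mu>" for n
    using f(3) S_le[OF f(1,2)] by (auto intro: less_imp_le)
  then have Blim: "(\<lambda>n. B (f n)) \<longlonglongrightarrow> \<mu>"
    by (intro tendsto_sandwich[OF always_eventually always_eventually const_minus_inverse_tendsto[of \<mu>] tendsto_const]) blast+
  \<comment> \<open>Cauchy-Schwarz for the form \<open>cov (I f) (I g)\<close>, applied to
    \<open>A (f n)\<close> and \<open>f n\<close>: the mixed term is the squared norm of
    \<open>A (f n)\<close>. Since \<open>A (f n)\<close> is again in \<open>V\<close>, the form
    there is at most \<mu> times that squared norm, and one factor is cancelled.\<close>
  have AA: "L2_scalar \<nu> (A (f n)) (A (f n)) \<le> \<mu> * B (f n)" for n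
  proof -
    let ?x = "L2_scalar \<nu> (A (f n)) (A (f n))"
    have "?x\<^sup>2 \<le> B (A (f n)) * B (f n)"
      using cov_Cauchy_Schwarz[OF I_L2_mem[OF A_in_L2[OF f_L2]] I_L2_mem[OF f_L2], of n n]
        cov_I_I[OF A_in_L2[OF f_L2] f_L2, of n n] by (simp add: B_def)
    also have "\<dots> \<le> (\<mu> * ?x) * B (f n)"
      by (intro mult_right_mono B_le V_A f) (simp add: B_def cov_nonneg)
    finally have "?x * ?x \<le> ?x * (\<mu> * B (f n))" by (simp add: power2_eq_square mult_ac)
    moreover have "0 \<le> \<mu> * B (f n)" using \<mu> \<epsilon>(1) cov_nonneg by (simp add: B_def)
    ultimately show ?thesis
      using L2_scalar_nonneg[of \<nu> "A (f n)"] by (cases "?x = 0") (auto simp: mult_le_cancel_left)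
  qed
  \<comment> \<open>The defect in the eigenvalue equation. Its squared norm is at most
    \<open>\<mu>\<^sup>2 - \<mu> * B (f n)\<close>, which tends to 0 because the sequence is
    maximizing.\<close>
  define r where "r n = (\<lambda>t. A (f n) t - \<mu> * f n t)" for n
  have r_L2: "in_L2 \<nu> (r n)" for n
    unfolding r_def by (intro in_L2_diff A_in_L2 in_L2_scale f_L2)
  have r_le: "L2_scalar \<nu> (r n) (r n) \<le> \<mu>\<^sup>2 - \<mu> * B (f n)" for n
    unfolding r_def using AA[of n] B_scalar[OF f(1), of n] f(2)[of n]
      L2_scalar_norm_diff[OF A_in_L2[OF f_L2] in_L2_scale[OF f_L2], of n \<mu> n]
    by (simp add: L2_scalar_scale L2_scalar_scale_right power2_eq_square)
  have "(\<lambda>n. \<mu>\<^sup>2 - \<mu> * B (f n)) \<longlonglongrightarrow> \<mu>\<^sup>2 - \<mu> * \<mu>" by (intro tendsto_intros Blim)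
  then have lim0: "(\<lambda>n. \<mu>\<^sup>2 - \<mu> * B (f n)) \<longlonglongrightarrow> 0" by (simp add: power2_eq_square)
  have r_lim: "(\<lambda>n. L2_scalar \<nu> (r n) (r n)) \<longlonglongrightarrow> 0"
    by (rule tendsto_sandwich[OF always_eventually always_eventually tendsto_const lim0])
      (simp_all add: L2_scalar_nonneg r_le)
  obtain h k where h: "continuous_on {a..b} h" and k: "strict_mono (k :: nat \<Rightarrow> nat)"
    and unif: "\<And>e. 0 < e \<Longrightarrow> \<exists>N. \<forall>n x. n \<ge> N \<and> x \<in> {a..b} \<longrightarrow> norm (A (f (k n)) x - h x) < e"
  proof (rule Arzela_Ascoli[of "{a..b}" "\<lambda>n. A (f n)" K])
    show "norm (A (f n) x) \<le> K" if "x \<in> {a..b}" for n x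
    proof -
      have "(A (f n) x)\<^sup>2 \<le> K\<^sup>2"
        using K2[OF f_L2 that, of n] f(2)[of n] by (simp add: power2_eq_square)
      then show ?thesis using K(1) abs_le_square_iff[of "A (f n) x" K] by simp
    qed
    \<comment> \<open>Equicontinuity at \<open>x\<close>: the difference of values of
      \<open>A (f n)\<close> is the covariance of \<open>Y x - Y y\<close> with
      \<open>I (f n)\<close>. The variance of the increment is small near \<open>x\<close>, and that
      of \<open>I (f n)\<close> is at most \<open>K\<close> for all \<open>n\<close>.\<close>
    fix x e :: real assume x: "x \<in> {a..b}" and e: "0 < e"
    let ?D = "\<lambda>y \<omega>. Y x \<omega> - Y y \<omega>"
    have "0 < e\<^sup>2 / K" using e K(1) by simp
    then obtain d where d: "d > 0" "\<And>y. y \<in> {a..b} \<Longrightarrow> dist y x < d \<Longrightarrow> dist (cov (?D y) (?D y)) (cov (?D x) (?D x)) < e\<^sup>2 / K"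
      using increment_var_continuous[OF x] x unfolding continuous_on_iff by blast
    show "\<exists>d>0. \<forall>n y. y \<in> {a..b} \<and> norm (x - y) < d \<longrightarrow> norm (A (f n) x - A (f n) y) < e"
    proof (intro exI[of _ d] conjI allI impI d(1))
      fix n y assume y: "y \<in> {a..b} \<and> norm (x - y) < d"
      have DG: "?D y \<in> G" using x y by (intro diff Y_mem) auto
      have "cov (?D x) (?D x) = 0" by (simp add: cov_def)
      then have D: "cov (?D y) (?D y) < e\<^sup>2 / K"
        using d(2)[of y] y cov_nonneg[of "?D y"] by (simp add: dist_real_def abs_minus_commute)
      have "A (f n) x - A (f n) y = cov (?D y) (I (f n))"
        unfolding A_def using x y by (simp add: cov_diff Y_mem I_L2_mem[OF f_L2])
      then have "(A (f n) x - A (f n) y)\<^sup>2 \<le> cov (?D y) (?D y) * B (f n)"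
        using cov_Cauchy_Schwarz[OF DG I_L2_mem[OF f_L2, of n]] by (simp add: B_def)
      also have "\<dots> \<le> cov (?D y) (?D y) * K"
        by (intro mult_left_mono BK cov_nonneg)
      also have "\<dots> < e\<^sup>2" using D K(1) by (simp add: field_simps)
      finally show "norm (A (f n) x - A (f n) y) < e"
        using e abs_square_less_1 power2_less_imp_less[of "\<bar>A (f n) x - A (f n) y\<bar>" e] by simp
    qed
  qed auto
  define u where "u n = A (f (k n))" for n
  have u_L2: "in_L2 \<nu> (u n)" and uV: "V (u n)" for n
    unfolding u_def using A_in_L2[OF f_L2] V_A[OF f(1)] by auto
  have h_L2: "in_L2 \<nu> h" by (rule continuous_in_L2[OF h])
  define d where "d n = L2_scalar \<nu> (\<lambda>x. u n x - h x) (\<lambda>x. u n x - h x)" for n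
  have d_lim: "d \<longlonglongrightarrow> 0"
    unfolding d_def by (rule L2_scalar_uniform_tendsto_0)
      (use unif in \<open>auto simp: u_def[symmetric] intro!: in_L2_diff u_L2 h_L2\<close>)
  have kr_lim: "(\<lambda>n. L2_scalar \<nu> (r (k n)) (r (k n))) \<longlonglongrightarrow> 0"
    using LIMSEQ_subseq_LIMSEQ[OF r_lim k] by (simp add: comp_def)
  have kB_lim: "(\<lambda>n. B (f (k n))) \<longlonglongrightarrow> \<mu>"
    using LIMSEQ_subseq_LIMSEQ[OF Blim k] by (simp add: comp_def)
  show ?thesis
  proof (rule that[OF \<mu> h_L2])
    fix t assume t: "t \<in> {a..b}"
    have "(\<lambda>n. A (u n) t - A h t) \<longlonglongrightarrow> 0"
    proof (rule tendsto_0_if_square_le[OF _ d_lim])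
      show "(A (u n) t - A h t)\<^sup>2 \<le> (K * K) * d n" for n
        using K2[OF in_L2_diff[OF u_L2 h_L2] t, of n] A_diff[OF u_L2 h_L2 t, of n] by (simp add: d_def)
    qed
    then have 1: "(\<lambda>n. A (u n) t) \<longlonglongrightarrow> A h t" by (simp add: LIM_zero_iff)
    \<comment> \<open>This expression is \<open>A\<close> applied to the defect
      \<open>r (k n)\<close>, and \<open>A\<close> turns convergence in norm into convergence at
      each point. The eigenvalue equation for the limit therefore holds at every \<open>t\<close>,
      not only almost everywhere.\<close>
    have 2: "(\<lambda>n. A (u n) t - \<mu> * u n t) \<longlonglongrightarrow> 0"
    proof (rule tendsto_0_if_square_le[OF _ kr_lim])
      show "(A (u n) t - \<mu> * u n t)\<^sup>2 \<le> (K * K) * L2_scalar \<nu> (r (k n)) (r (k n))" for n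
        using K2[OF r_L2 t, of "k n"] A_diff[OF u_L2 in_L2_scale[OF f_L2] t, of n \<mu> "k n"]
        by (simp add: r_def u_def A_scale)
    qed
    have 3: "(\<lambda>n. u n t) \<longlonglongrightarrow> h t"
      unfolding LIMSEQ_def dist_real_def u_def using unif t by (metis real_norm_def)
    have "(\<lambda>n. A (u n) t - \<mu> * u n t) \<longlonglongrightarrow> A h t - \<mu> * h t"
      by (intro tendsto_intros 1 3)
    then show "A h t = \<mu> * h t" using LIMSEQ_unique[OF 2] by force
  next
    fix i assume i: "i \<in> P"
    have ei: "in_L2 \<nu> (e i)" using e[OF i] by (simp add: eigen_equation_def)
    have "(\<lambda>n. L2_scalar \<nu> (e i) h) \<longlonglongrightarrow> 0"
    proof (rule tendsto_0_if_square_le[OF _ d_lim])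
      fix n
      have "L2_scalar \<nu> (e i) (\<lambda>x. u n x - h x) = - L2_scalar \<nu> (e i) h"
        using uV[of n] i by (simp add: L2_scalar_diff_right u_L2 h_L2 ei V_def)
      then show "(L2_scalar \<nu> (e i) h)\<^sup>2 \<le> L2_scalar \<nu> (e i) (e i) * d n"
        using L2_scalar_Cauchy_Schwarz[OF ei in_L2_diff[OF u_L2 h_L2], of n] by (simp add: d_def)
    qed
    then show "L2_scalar \<nu> (e i) h = 0" by (simp add: LIMSEQ_const_iff)
  next
    \<comment> \<open>The limit is not zero: the form at \<open>f (k n)\<close> is bounded by the
      norm of \<open>u n\<close>, and it tends to the positive number \<mu>.\<close>
    have "(B (f (k n)))\<^sup>2 \<le> 2 * d n + 2 * L2_scalar \<nu> h h" for n
    proof -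
      have "(B (f (k n)))\<^sup>2 \<le> L2_scalar \<nu> (u n) (u n)"
        using L2_scalar_Cauchy_Schwarz[OF A_in_L2[OF f_L2] f_L2, of "k n" "k n"] f(2)
        by (simp add: B_scalar[OF f(1)] u_def)
      \<comment> \<open>Rearranged, this says that the squared norm of \<open>u n - 2 * h\<close> is
        non-negative.\<close>
      also have "\<dots> \<le> 2 * d n + 2 * L2_scalar \<nu> h h"
        unfolding d_def
        using L2_scalar_norm_diff[OF u_L2 h_L2, of n] L2_scalar_norm_diff[OF u_L2 in_L2_scale[OF h_L2], of n 2]
          L2_scalar_nonneg[of \<nu> "\<lambda>x. u n x - 2 * h x"]
        by (simp add: L2_scalar_scale L2_scalar_scale_right)
      finally show ?thesis .
    qed
    moreover have "(\<lambda>n. (B (f (k n)))\<^sup>2) \<longlonglongrightarrow> \<mu>\<^sup>2" by (intro tendsto_intros kB_lim)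
    moreover have "(\<lambda>n. 2 * d n + 2 * L2_scalar \<nu> h h) \<longlonglongrightarrow> 2 * 0 + 2 * L2_scalar \<nu> h h"
      by (intro tendsto_intros d_lim)
    ultimately have "\<mu>\<^sup>2 \<le> 2 * L2_scalar \<nu> h h"
      by (intro LIMSEQ_le) auto
    moreover have "0 < \<mu>\<^sup>2" using \<mu> \<epsilon>(1) by simp
    ultimately show "0 < L2_scalar \<nu> h h" by linarith
  qed
qed

end

section \<open>Residual variance on the support\<close>

locale kl_eigensystem = kl_setting +
  fixes N :: enat and lam :: "nat \<Rightarrow> real" and e :: "nat \<Rightarrow> real \<Rightarrow> real"
  assumes eigensystem: "eigensystem \<nu> R N lam e"
begin

abbreviation Z :: "nat \<Rightarrow> 'a \<Rightarrow> real" where "Z k \<equiv> I (e k)"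

text \<open>For eigenvalue 0 the function \<open>e k\<close> is an arbitrary representative, without
  control at single points, while \<open>Z k\<close> vanishes almost surely. The residuals are built
  over \<open>Pos\<close>; the other indices return only in the final expansion.\<close>

definition Pos :: "nat set" where "Pos = {k \<in> index_set N. 0 < lam k}"

lemma e_eigen: "k \<in> index_set N \<Longrightarrow> eigen_equation \<nu> R (lam k) (e k)"
  using eigensystem unfolding eigensystem_def by blast

lemma e_L2: "k \<in> index_set N \<Longrightarrow> in_L2 \<nu> (e k)"
  using e_eigen by (simp add: eigen_equation_def)

lemma e_orthonormal:
  "j \<in> index_set N \<Longrightarrow> k \<in> index_set N \<Longrightarrow> L2_scalar \<nu> (e j) (e k) = (if j = k then 1 else 0)"
  using eigensystem unfolding eigensystem_def by blast

lemma Pos_index: "k \<in> Pos \<Longrightarrow> k \<in> index_set N" and Pos_pos: "k \<in> Pos \<Longrightarrow> 0 < lam k"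
  by (auto simp: Pos_def)

lemma Z_mem: "k \<in> index_set N \<Longrightarrow> Z k \<in> G"
  by (rule I_L2_mem[OF e_L2])

lemma cov_Z_Z:
  assumes "j \<in> index_set N" "k \<in> index_set N"
  shows "cov (Z j) (Z k) = (if j = k then lam k else 0)"
  using cov_I_I[OF e_L2 e_L2, OF assms] eigen_equation_scalar[OF e_eigen e_L2, OF assms(2,1)]
    e_orthonormal[OF assms(2,1)] by auto

lemma lam_nonneg: "k \<in> index_set N \<Longrightarrow> 0 \<le> lam k"
  using cov_Z_Z[of k k] cov_nonneg[of "Z k"] by simp

text \<open>The continuous version of \<open>e k\<close> gives the identity at every single
  \<open>t\<close>, as residuals evaluated pointwise demand.\<close>

lemma cov_Z_Y:
  assumes k: "k \<in> Pos" and t: "t \<in> {a..b}"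
  shows "cov (Z k) (Y t) = lam k * e k t"
proof -
  have "e k t = inverse (lam k) * kernel_operator \<nu> R (e k) t"
    using eigensystem k t unfolding eigensystem_def Pos_def space_\<nu> by blast
  then have "lam k * e k t = A (e k) t"
    using A_eq_kernel[OF in_L2_integrable[OF finite_\<nu> e_L2[OF Pos_index[OF k]]] t] Pos_pos[OF k] by simp
  then show ?thesis by (simp add: A_def cov_commute)
qed

lemma e_continuous:
  assumes "k \<in> Pos" shows "continuous_on {a..b} (e k)"
proof -
  have "continuous_on {a..b} (\<lambda>t. inverse (lam k) * cov (Y t) (Z k))"
    by (intro continuous_intros cov_continuous Z_mem Pos_index assms)
  moreover have "inverse (lam k) * cov (Y t) (Z k) = e k t" if "t \<in> {a..b}" for t
    using cov_Z_Y[OF assms that] Pos_pos[OF assms] by (simp add: cov_commute)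
  ultimately show ?thesis by (rule continuous_on_eq)
qed

text \<open>The projection residual of \<open>Y t\<close>: as \<open>Z k\<close> has variance
  \<open>lam k\<close> and covariance \<open>lam k * e k t\<close> with \<open>Y t\<close>, the
  number \<open>e k t\<close> is the regression coefficient. The set \<open>F\<close> is meant to
  lie in \<open>Pos\<close>.\<close>

definition W :: "nat set \<Rightarrow> real \<Rightarrow> 'a \<Rightarrow> real" where
  "W F t \<omega> = Y t \<omega> - (\<Sum>k\<in>F. e k t * Z k \<omega>)"

lemma sum_Z_mem: "F \<subseteq> Pos \<Longrightarrow> (\<lambda>\<omega>. \<Sum>k\<in>F. c k * Z k \<omega>) \<in> G"
  by (intro sum scale Z_mem Pos_index) auto

lemma W_mem: "F \<subseteq> Pos \<Longrightarrow> t \<in> {a..b} \<Longrightarrow> W F t \<in> G"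
  unfolding W_def by (intro diff Y_mem sum_Z_mem)

lemma cov_sum_Z:
  assumes "F \<subseteq> Pos" "X \<in> G"
  shows "cov (\<lambda>\<omega>. \<Sum>k\<in>F. c k * Z k \<omega>) X = (\<Sum>k\<in>F. c k * cov (Z k) X)"
proof -
  have "(\<lambda>\<omega>. c k * Z k \<omega>) \<in> G" if "k \<in> F" for k
    using that assms(1) by (intro scale Z_mem Pos_index) auto
  then show ?thesis using assms(2) by (subst cov_sum) (simp_all add: cov_scale)
qed

lemma cov_Z_W:
  assumes F: "finite F" "F \<subseteq> Pos" and k: "k \<in> F" and t: "t \<in> {a..b}"
  shows "cov (Z k) (W F t) = 0"
proof -
  have kP: "k \<in> Pos" using F k by auto
  have "cov (Z k) (W F t) = cov (Z k) (Y t) - cov (Z k) (\<lambda>\<omega>. \<Sum>j\<in>F. e j t * Z j \<omega>)"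
    unfolding W_def by (intro cov_diff_right Y_mem t sum_Z_mem F Z_mem Pos_index kP)
  also have "cov (Z k) (\<lambda>\<omega>. \<Sum>j\<in>F. e j t * Z j \<omega>) = (\<Sum>j\<in>F. e j t * cov (Z j) (Z k))"
    unfolding cov_commute[of "Z k" "\<lambda>\<omega>. \<Sum>j\<in>F. e j t * Z j \<omega>"]
    by (rule cov_sum_Z[OF F(2) Z_mem[OF Pos_index[OF kP]]])
  also have "\<dots> = (\<Sum>j\<in>F. if j = k then e k t * lam k else 0)"
    using F kP by (intro sum.cong) (auto simp: cov_Z_Z Pos_index subset_iff)
  also have "\<dots> = e k t * lam k" using F k by simp
  finally show ?thesis using cov_Z_Y[OF kP t] by simp
qed

lemma cov_sum_Z_W:
  assumes "finite F" "F \<subseteq> Pos" "F' \<subseteq> F" "t \<in> {a..b}"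
  shows "cov (\<lambda>\<omega>. \<Sum>k\<in>F'. c k * Z k \<omega>) (W F t) = 0"
proof -
  have "F' \<subseteq> Pos" using assms by auto
  then show ?thesis
    using assms cov_Z_W[OF assms(1,2) _ assms(4)] by (simp add: cov_sum_Z W_mem subset_iff)
qed

lemma var_W:
  assumes F: "finite F" "F \<subseteq> Pos" and t: "t \<in> {a..b}"
  shows "cov (W F t) (W F t) = cov (Y t) (Y t) - (\<Sum>k\<in>F. lam k * (e k t)\<^sup>2)"
proof -
  have "cov (W F t) (W F t) = cov (Y t) (W F t) - cov (\<lambda>\<omega>. \<Sum>k\<in>F. e k t * Z k \<omega>) (W F t)"
    using cov_diff[OF Y_mem[OF t] sum_Z_mem[OF F(2)] W_mem[OF F(2) t]] by (simp add: W_def[abs_def])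
  also have "\<dots> = cov (Y t) (W F t)" using cov_sum_Z_W[OF F subset_refl t] by simp
  also have "\<dots> = cov (Y t) (Y t) - cov (Y t) (\<lambda>\<omega>. \<Sum>k\<in>F. e k t * Z k \<omega>)"
    unfolding W_def by (intro cov_diff_right Y_mem t sum_Z_mem F)
  also have "cov (Y t) (\<lambda>\<omega>. \<Sum>k\<in>F. e k t * Z k \<omega>) = (\<Sum>k\<in>F. e k t * cov (Z k) (Y t))"
    unfolding cov_commute[of "Y t" "\<lambda>\<omega>. \<Sum>k\<in>F. e k t * Z k \<omega>"]
    by (rule cov_sum_Z[OF F(2) Y_mem[OF t]])
  also have "\<dots> = (\<Sum>k\<in>F. lam k * (e k t)\<^sup>2)"
    using F t by (intro sum.cong) (auto simp: cov_Z_Y power2_eq_square subset_iff)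
  finally show ?thesis .
qed

text \<open>Best approximation: \<open>U\<close> and \<open>W F t\<close> differ by a combination of
  the \<open>Z k\<close>, to which \<open>W F t\<close> is orthogonal, so the variances add.\<close>

lemma var_W_le:
  fixes c :: "nat \<Rightarrow> real"
  assumes F: "finite F" "F \<subseteq> Pos" and t: "t \<in> {a..b}"
  defines "U \<equiv> \<lambda>\<omega>. Y t \<omega> - (\<Sum>k\<in>F. c k * Z k \<omega>)"
  shows "cov (W F t) (W F t) \<le> cov U U"
proof -
  define D where "D = (\<lambda>\<omega>. \<Sum>k\<in>F. (e k t - c k) * Z k \<omega>)"
  have D: "D \<in> G" unfolding D_def by (rule sum_Z_mem[OF F(2)])
  have "U = (\<lambda>\<omega>. W F t \<omega> + D \<omega>)"
    by (simp add: U_def W_def D_def fun_eq_iff left_diff_distrib sum_subtractf)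
  moreover have "cov (W F t) D = 0"
    unfolding D_def cov_commute[of "W F t"] by (rule cov_sum_Z_W[OF F subset_refl t])
  ultimately have "cov U U = cov (W F t) (W F t) + cov D D"
    using var_add[OF W_mem[OF F(2) t] D] by simp
  then show ?thesis using cov_nonneg[of D] by simp
qed

text \<open>The residual variance in \<open>var_W\<close> is non-negative. Integrated over \<nu>,
  with each \<open>e k\<close> normalized, this bounds the sum of eigenvalues by the trace.\<close>

lemma sum_lam_le:
  assumes F: "finite F" "F \<subseteq> Pos"
  shows "(\<Sum>k\<in>F. lam k) \<le> (\<integral>t. cov (Y t) (Y t) \<partial>\<nu>)"
proof -
  have i: "integrable \<nu> (\<lambda>t. lam k * (e k t)\<^sup>2)" if "k \<in> F" for k
    using e_L2[OF Pos_index] F that by (auto simp: in_L2_def)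
  have "(\<Sum>k\<in>F. lam k) = (\<Sum>k\<in>F. \<integral>t. lam k * (e k t)\<^sup>2 \<partial>\<nu>)"
  proof (rule sum.cong)
    fix k assume "k \<in> F"
    then have "L2_scalar \<nu> (e k) (e k) = 1" using e_orthonormal[of k k] Pos_index F by auto
    then show "lam k = (\<integral>t. lam k * (e k t)\<^sup>2 \<partial>\<nu>)" by (simp add: L2_scalar_def power2_eq_square)
  qed simp
  also have "\<dots> = (\<integral>t. (\<Sum>k\<in>F. lam k * (e k t)\<^sup>2) \<partial>\<nu>)" using i by simp
  also have "\<dots> \<le> (\<integral>t. cov (Y t) (Y t) \<partial>\<nu>)"
  proof (rule integral_mono)
    show "integrable \<nu> (\<lambda>t. \<Sum>k\<in>F. lam k * (e k t)\<^sup>2)" using i by simp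
    show "integrable \<nu> (\<lambda>t. cov (Y t) (Y t))"
      by (rule in_L2_integrable[OF finite_\<nu> continuous_in_L2[OF var_continuous]])
    show "(\<Sum>k\<in>F. lam k * (e k t)\<^sup>2) \<le> cov (Y t) (Y t)" if "t \<in> space \<nu>" for t
      using var_W[OF F, of t] cov_nonneg[of "W F t"] that by (simp add: space_\<nu>)
  qed
  finally show ?thesis .
qed

text \<open>More than \<open>T / \<epsilon>\<close> eigenvalues above \<epsilon> would have a sum
  exceeding the trace \<open>T\<close>. So only finitely many indices are concerned, and these are
  bounded.\<close>

lemma eventually_lam_le:
  assumes "0 < \<epsilon>"
  obtains n where "\<And>k. k \<in> Pos \<Longrightarrow> n < k \<Longrightarrow> lam k \<le> \<epsilon>"
proof -
  define T where "T = (\<integral>t. cov (Y t) (Y t) \<partial>\<nu>)"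
  have "finite {k \<in> Pos. \<epsilon> < lam k}"
  proof (rule ccontr)
    assume "infinite {k \<in> Pos. \<epsilon> < lam k}"
    moreover obtain m :: nat where m: "T < m * \<epsilon>"
      using reals_Archimedean3[OF assms] by blast
    ultimately obtain F where F: "finite F" "card F = m" "F \<subseteq> {k \<in> Pos. \<epsilon> < lam k}"
      using infinite_arbitrarily_large by blast
    have "(\<Sum>k\<in>F. \<epsilon>) \<le> (\<Sum>k\<in>F. lam k)"
      using F by (intro sum_mono) auto
    then have "m * \<epsilon> \<le> (\<Sum>k\<in>F. lam k)" using F by simp
    also have "\<dots> \<le> T" unfolding T_def using F by (intro sum_lam_le) auto
    finally show False using m by simp
  qed
  then obtain n where "\<forall>k\<in>{k \<in> Pos. \<epsilon> < lam k}. k \<le> n" using finite_nat_set_iff_bounded_le by blast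
  then show ?thesis by (intro that[of n]) force
qed

text \<open>If the bound failed, the complement of the \<open>e k\<close> with
  \<open>k \<in> F\<close> would contain an eigenfunction with an eigenvalue above \<epsilon>. All
  listed indices for that eigenvalue lie in \<open>F\<close>, so the eigenfunction is orthogonal to
  them, against the fact that the list exhausts its eigenspace.\<close>

lemma var_I_le:
  assumes f: "in_L2 \<nu> f" and \<epsilon>: "0 \<le> \<epsilon>"
    and large: "\<And>k. k \<in> Pos \<Longrightarrow> k \<notin> F \<Longrightarrow> lam k \<le> \<epsilon>"
    and F: "F \<subseteq> Pos" and orth: "\<And>k. k \<in> F \<Longrightarrow> L2_scalar \<nu> (e k) f = 0"
  shows "cov (I f) (I f) \<le> \<epsilon> * L2_scalar \<nu> f f"
proof (rule ccontr)
  assume "\<not> ?thesis"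
  then have less: "\<epsilon> * L2_scalar \<nu> f f < cov (I f) (I f)" by simp
  have eig: "eigen_equation \<nu> R (lam k) (e k)" if "k \<in> F" for k
    using that F by (intro e_eigen Pos_index) auto
  obtain \<mu> g where g: "\<epsilon> < \<mu>" "in_L2 \<nu> g" "\<And>t. t \<in> {a..b} \<Longrightarrow> A g t = \<mu> * g t"
    "\<And>k. k \<in> F \<Longrightarrow> L2_scalar \<nu> (e k) g = 0" "0 < L2_scalar \<nu> g g"
  proof (rule max_eigenfunction[OF eig f orth \<epsilon> less])
  qed (auto intro: that)
  have "eigen_equation \<nu> R \<mu> g"
    unfolding eigen_equation_def using g A_eq_kernel[OF in_L2_integrable[OF finite_\<nu> g(2)]]
    by (auto simp: space_\<nu> intro!: AE_I2)
  moreover have "\<forall>k\<in>index_set N. lam k = \<mu> \<longrightarrow> L2_scalar \<nu> (e k) g = 0"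
    using g(1,4) \<epsilon> large by (force simp: Pos_def)
  moreover have "\<mu> \<noteq> 0" using g(1) \<epsilon> by simp
  ultimately have "AE t in \<nu>. g t = 0"
    using eigensystem unfolding eigensystem_def by blast
  then show False using L2_scalar_eq_0_iff[OF g(2)] g(5) by simp
qed

definition local_average :: "real \<Rightarrow> nat \<Rightarrow> real \<Rightarrow> real" where
  "local_average t n s = indicator (ball t (1 / real (Suc n))) s / measure \<nu> (ball t (1 / real (Suc n)) \<inter> space \<nu>)"

lemma local_average_L2: "in_L2 \<nu> (local_average t n)"
proof (rule in_L2_bounded[OF finite_\<nu>])
  have "(\<lambda>s. indicator (ball t (1 / real (Suc n))) s / measure \<nu> (ball t (1 / real (Suc n)) \<inter> space \<nu>)) \<in> borel_measurable borel"
    by (intro borel_measurable_divide borel_measurable_indicator borel_measurable_const) simp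
  then have "local_average t n \<in> borel_measurable borel" by (simp add: local_average_def[abs_def])
  then show "local_average t n \<in> borel_measurable \<nu>"
    unfolding measurable_\<nu> by (rule measurable_restrict_space1)
  show "\<bar>local_average t n x\<bar> \<le> 1 / measure \<nu> (ball t (1 / real (Suc n)) \<inter> space \<nu>)" for x
    by (simp add: local_average_def indicator_def)
qed

lemma local_average_tendsto:
  assumes t: "t \<in> measure_support \<nu>" and \<omega>: "\<omega> \<in> space M"
  shows "(\<lambda>n. I (local_average t n) \<omega>) \<longlonglongrightarrow> Y t \<omega>"
proof (rule LIMSEQ_I)
  fix r :: real assume r: "0 < r"
  have tab: "t \<in> {a..b}" using t by (simp add: measure_support_def space_\<nu>)
  obtain d where d: "0 < d" "\<And>s. s \<in> {a..b} \<Longrightarrow> dist s t < d \<Longrightarrow> dist (Y s \<omega>) (Y t \<omega>) < r / 2"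
    using path_continuous[OF \<omega>] tab r unfolding continuous_on_iff by (meson half_gt_zero)
  obtain m where m: "1 / real (Suc m) < d" using nat_approx_posE[OF d(1)] .
  show "\<exists>no. \<forall>n\<ge>no. norm (I (local_average t n) \<omega> - Y t \<omega>) < r"
  proof (intro exI[of _ m] allI impI)
    fix n assume "m \<le> n"
    then have "1 / real (Suc n) \<le> 1 / real (Suc m)" by (intro divide_left_mono) auto
    then have nd: "1 / real (Suc n) < d" using m by (rule le_less_trans)
    let ?U = "ball t (1 / real (Suc n))"
    define v where "v = measure \<nu> (?U \<inter> space \<nu>)"
    \<comment> \<open>The support condition enters here: it makes the normalizing denominator
      positive.\<close>
    have "0 < emeasure \<nu> (?U \<inter> space \<nu>)"
      using t unfolding measure_support_def by (auto simp del: of_nat_Suc)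
    then have v: "0 < v" by (simp add: v_def \<nu>.emeasure_eq_measure)
    have Us: "?U \<inter> space \<nu> \<in> sets \<nu>"
      unfolding sets_\<nu> sets_restrict_space space_\<nu> by (auto simp: Int_commute)
    have iU: "integrable \<nu> (indicator ?U :: real \<Rightarrow> real)" and vU: "(\<integral>s. indicator ?U s \<partial>\<nu>) = v"
    proof -
      have "integrable \<nu> (indicator (?U \<inter> space \<nu>) :: real \<Rightarrow> real)"
        using Us by (intro integrable_real_indicator) (simp_all add: \<nu>.emeasure_eq_measure)
      then show "integrable \<nu> (indicator ?U :: real \<Rightarrow> real)"
        by (rule Bochner_Integration.integrable_cong[THEN iffD1, rotated 2]) (auto simp: indicator_def)
      have "(\<integral>s. indicator ?U s \<partial>\<nu>) = (\<integral>s. indicator (?U \<inter> space \<nu>) s \<partial>\<nu> :: real)"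
        by (rule Bochner_Integration.integral_cong) (auto simp: indicator_def)
      then show "(\<integral>s. indicator ?U s \<partial>\<nu>) = v" by (simp add: v_def)
    qed
    have la: "local_average t n s = indicator ?U s / v" for s by (simp add: local_average_def v_def)
    have iY: "integrable \<nu> (\<lambda>s. Y s \<omega> * local_average t n s)"
      by (rule path_integrable[OF local_average_L2 \<omega>])
    have iL: "integrable \<nu> (local_average t n)"
      by (rule in_L2_integrable[OF finite_\<nu> local_average_L2])
    have L1: "(\<integral>s. local_average t n s \<partial>\<nu>) = 1"
      unfolding la using vU v by simp
    have "I (local_average t n) \<omega> - Y t \<omega> = (\<integral>s. Y s \<omega> * local_average t n s \<partial>\<nu>) - (\<integral>s. Y t \<omega> * local_average t n s \<partial>\<nu>)"
      using L1 by (simp add: I_def)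
    also have "\<dots> = (\<integral>s. Y s \<omega> * local_average t n s - Y t \<omega> * local_average t n s \<partial>\<nu>)"
      using iY iL by simp
    finally have "norm (I (local_average t n) \<omega> - Y t \<omega>) = norm (\<integral>s. Y s \<omega> * local_average t n s - Y t \<omega> * local_average t n s \<partial>\<nu>)"
      by simp
    also have "\<dots> \<le> (\<integral>s. norm (Y s \<omega> * local_average t n s - Y t \<omega> * local_average t n s) \<partial>\<nu>)"
      by (rule integral_norm_bound)
    also have "\<dots> \<le> (\<integral>s. r / 2 * local_average t n s \<partial>\<nu>)"
    proof (rule integral_mono)
      fix s assume s: "s \<in> space \<nu>"
      show "norm (Y s \<omega> * local_average t n s - Y t \<omega> * local_average t n s) \<le> r / 2 * local_average t n s"
      proof (cases "s \<in> ?U")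
        case True
        then have "dist s t < d" using nd by (simp add: dist_commute del: of_nat_Suc)
        then have "\<bar>Y s \<omega> - Y t \<omega>\<bar> \<le> r / 2"
          using d(2)[of s] s by (simp add: space_\<nu> dist_real_def)
        moreover have la0: "0 \<le> local_average t n s" using v by (simp add: la)
        ultimately have "\<bar>Y s \<omega> - Y t \<omega>\<bar> * local_average t n s \<le> r / 2 * local_average t n s"
          by (rule mult_right_mono)
        then show ?thesis
          using la0 by (simp only: left_diff_distrib[symmetric] real_norm_def abs_mult abs_of_nonneg)
      next
        case False
        then show ?thesis by (simp add: la)
      qed
    qed (use iY iL in auto)
    also have "\<dots> = r / 2" using L1 by simp
    finally show "norm (I (local_average t n) \<omega> - Y t \<omega>) < r" using r by simp
  qed
qed

lemma cov_cong: "(\<And>\<omega>. \<omega> \<in> space M \<Longrightarrow> X \<omega> = X' \<omega>) \<Longrightarrow> cov X X = cov X' X'"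
  unfolding cov_def by (intro Bochner_Integration.integral_cong) auto

text \<open>Split \<open>f\<close> into its projection \<open>s\<close> onto the span of the
  \<open>e k\<close> with \<open>k \<in> F\<close> and the rest \<open>g\<close>. Then
  \<open>Y t - I s\<close> competes with \<open>W F t\<close> in \<open>var_W_le\<close> and equals
  \<open>(Y t - I f) + I g\<close>; the last term is controlled by \<open>var_I_le\<close>, as
  \<open>g\<close> is orthogonal to these \<open>e k\<close>.\<close>

lemma var_W_le_projection:
  assumes f: "in_L2 \<nu> f" and \<epsilon>: "0 \<le> \<epsilon>"
    and large: "\<And>k. k \<in> Pos \<Longrightarrow> k \<notin> F \<Longrightarrow> lam k \<le> \<epsilon>"
    and F: "finite F" "F \<subseteq> Pos" and t: "t \<in> {a..b}"
  shows "cov (W F t) (W F t) \<le> 2 * cov (\<lambda>\<omega>. Y t \<omega> - I f \<omega>) (\<lambda>\<omega>. Y t \<omega> - I f \<omega>) + 2 * (\<epsilon> * L2_scalar \<nu> f f)"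
proof -
  define c where "c k = L2_scalar \<nu> (e k) f" for k
  define s where "s = (\<lambda>x. \<Sum>k\<in>F. c k * e k x)"
  define g where "g = (\<lambda>x. f x - s x)"
  have ce: "in_L2 \<nu> (\<lambda>x. c k * e k x)" if "k \<in> F" for k
    using that F by (intro in_L2_scale e_L2 Pos_index) auto
  have s: "in_L2 \<nu> s" unfolding s_def by (rule in_L2_sum[OF ce])
  have g: "in_L2 \<nu> g" unfolding g_def by (rule in_L2_diff[OF f s])
  have es: "L2_scalar \<nu> (e k) s = c k" if k: "k \<in> F" for k
  proof -
    have "L2_scalar \<nu> (e k) s = (\<Sum>j\<in>F. c j * L2_scalar \<nu> (e k) (e j))"
      unfolding s_def using k F by (subst L2_scalar_sum_right[OF ce]) (auto simp: L2_scalar_scale_right intro: e_L2 Pos_index)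
    also have "\<dots> = (\<Sum>j\<in>F. if j = k then c k else 0)"
      using k F by (intro sum.cong) (auto simp: e_orthonormal Pos_index subset_iff)
    finally show ?thesis using k F by simp
  qed
  have orth: "L2_scalar \<nu> (e k) g = 0" if k: "k \<in> F" for k
    unfolding g_def using k F es[OF k]
    by (subst L2_scalar_diff_right[OF f s]) (auto simp: c_def intro: e_L2 Pos_index)
  \<comment> \<open>The squared norm of \<open>s\<close> equals its scalar product with
    \<open>f\<close>; hence passing from \<open>f\<close> to \<open>g\<close> does not increase the
    norm.\<close>
  have "L2_scalar \<nu> s s = (\<Sum>k\<in>F. c k * L2_scalar \<nu> s (e k))"
    using L2_scalar_sum_right[OF ce s] by (simp add: s_def L2_scalar_scale_right)
  also have "\<dots> = (\<Sum>k\<in>F. c k * L2_scalar \<nu> f (e k))"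
    using es by (intro sum.cong) (auto simp: c_def L2_scalar_commute)
  also have "\<dots> = L2_scalar \<nu> f s"
    using L2_scalar_sum_right[where F=F and f="\<lambda>k x. c k * e k x", OF ce f] by (simp add: s_def L2_scalar_scale_right)
  finally have "L2_scalar \<nu> g g \<le> L2_scalar \<nu> f f"
    unfolding g_def using L2_scalar_norm_diff[OF f s] L2_scalar_nonneg[of \<nu> s] by simp
  then have g_le: "\<epsilon> * L2_scalar \<nu> g g \<le> \<epsilon> * L2_scalar \<nu> f f" using \<epsilon> by (rule mult_left_mono)
  have Ig_le: "cov (I g) (I g) \<le> \<epsilon> * L2_scalar \<nu> g g"
    by (rule var_I_le[OF g \<epsilon> large F(2) orth])
  have Ig: "I g \<omega> = I f \<omega> - (\<Sum>k\<in>F. c k * Z k \<omega>)" if "\<omega> \<in> space M" for \<omega>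
    using I_diff[OF f s that] I_sum[OF ce that] by (simp add: g_def s_def I_scale)
  have "cov (W F t) (W F t) \<le> cov (\<lambda>\<omega>. Y t \<omega> - (\<Sum>k\<in>F. c k * Z k \<omega>)) (\<lambda>\<omega>. Y t \<omega> - (\<Sum>k\<in>F. c k * Z k \<omega>))"
    by (rule var_W_le[OF F t])
  also have "\<dots> = cov (\<lambda>\<omega>. (Y t \<omega> - I f \<omega>) + I g \<omega>) (\<lambda>\<omega>. (Y t \<omega> - I f \<omega>) + I g \<omega>)"
    by (rule cov_cong) (simp add: Ig)
  also have "\<dots> \<le> 2 * cov (\<lambda>\<omega>. Y t \<omega> - I f \<omega>) (\<lambda>\<omega>. Y t \<omega> - I f \<omega>) + 2 * cov (I g) (I g)"
    by (intro var_add_le diff Y_mem t I_L2_mem f g)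
  finally show ?thesis using g_le Ig_le by linarith
qed

abbreviation Pos_upto :: "nat \<Rightarrow> nat set" where "Pos_upto n \<equiv> {k \<in> Pos. k \<le> n}"

lemma var_W_tendsto:
  assumes t: "t \<in> measure_support \<nu>"
  shows "(\<lambda>n. cov (W (Pos_upto n) t) (W (Pos_upto n) t)) \<longlonglongrightarrow> 0"
proof (rule LIMSEQ_I)
  fix r :: real assume r: "0 < r"
  have tab: "t \<in> {a..b}" using t by (simp add: measure_support_def space_\<nu>)
  define D where "D n = (\<lambda>\<omega>. Y t \<omega> - I (local_average t n) \<omega>)" for n
  have "(\<lambda>n. cov (D n) (D n)) \<longlonglongrightarrow> cov (\<lambda>_. 0) (\<lambda>_. 0)"
  proof (rule var_limit)
    show "D n \<in> G" for n unfolding D_def by (intro diff Y_mem tab I_L2_mem local_average_L2)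
    show "(\<lambda>n. D n \<omega>) \<longlonglongrightarrow> 0" if "\<omega> \<in> space M" for \<omega>
      using tendsto_diff[OF tendsto_const local_average_tendsto[OF t that], of "Y t \<omega>"] by (simp add: D_def)
  qed
  then have "(\<lambda>n. cov (D n) (D n)) \<longlonglongrightarrow> 0" by (simp add: cov_zero)
  then obtain m where m: "cov (D m) (D m) < r / 4"
    using order_tendstoD(2)[of _ 0 sequentially "r / 4"] r by (auto simp: eventually_sequentially)
  define L where "L = L2_scalar \<nu> (local_average t m) (local_average t m)"
  have L: "0 \<le> L" by (simp add: L_def L2_scalar_nonneg)
  \<comment> \<open>The averaging scale \<open>m\<close> is fixed before \<epsilon>, because the
    norm of the local average may grow as the ball shrinks. Each of the two terms of the projection
    bound is then below \<open>r / 2\<close>.\<close>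
  define \<epsilon> where "\<epsilon> = r / (4 * (L + 1))"
  have \<epsilon>: "0 < \<epsilon>" "\<epsilon> * L < r / 4" using r L by (auto simp: \<epsilon>_def field_simps)
  obtain n0 where n0: "\<And>k. k \<in> Pos \<Longrightarrow> n0 < k \<Longrightarrow> lam k \<le> \<epsilon>"
    using eventually_lam_le[OF \<epsilon>(1)] by blast
  show "\<exists>no. \<forall>n\<ge>no. norm (cov (W (Pos_upto n) t) (W (Pos_upto n) t) - 0) < r"
  proof (intro exI[of _ n0] allI impI)
    fix n assume n: "n0 \<le> n"
    have "cov (W (Pos_upto n) t) (W (Pos_upto n) t) \<le> 2 * cov (D m) (D m) + 2 * (\<epsilon> * L)"
      unfolding D_def L_def using n0 n \<epsilon>(1)
      by (intro var_W_le_projection local_average_L2 tab) auto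
    then show "norm (cov (W (Pos_upto n) t) (W (Pos_upto n) t) - 0) < r"
      using m \<epsilon>(2) cov_nonneg[of "W (Pos_upto n) t"] by simp
  qed
qed

end

section \<open>Uniform convergence\<close>

text \<open>The event that the supremum over \<open>J\<close> lies above \<open>c\<close>. The
  existential form avoids a possibly infinite supremum and is a countable union for countable
  \<open>J\<close>.\<close>

definition exceeds :: "'a measure \<Rightarrow> ('i \<Rightarrow> 'a \<Rightarrow> real) \<Rightarrow> 'i set \<Rightarrow> real \<Rightarrow> 'a set" where
  "exceeds M X J c = {\<omega> \<in> space M. \<exists>j\<in>J. c < \<bar>X j \<omega>\<bar>}"

lemma exceeds_sets:
  assumes "countable J" "\<And>j. j \<in> J \<Longrightarrow> X j \<in> borel_measurable M"
  shows "exceeds M X J c \<in> sets M"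
proof -
  have "exceeds M X J c = (\<Union>j\<in>J. {\<omega> \<in> space M. c < \<bar>X j \<omega>\<bar>})"
    by (auto simp: exceeds_def)
  also have "\<dots> \<in> sets M"
  proof (rule sets.countable_UN''[OF assms(1)])
    fix j assume "j \<in> J"
    then have [measurable]: "X j \<in> borel_measurable M" by (rule assms(2))
    show "{\<omega> \<in> space M. c < \<bar>X j \<omega>\<bar>} \<in> sets M" by measurable
  qed
  finally show ?thesis .
qed

context gaussian_space
begin

lemma flip_prob:
  fixes U V :: "'i \<Rightarrow> 'w \<Rightarrow> real"
  assumes U: "\<And>j. j \<in> J \<Longrightarrow> U j \<in> G" and V: "\<And>j. j \<in> J \<Longrightarrow> V j \<in> G"
    and orth: "\<And>i j. i \<in> J \<Longrightarrow> j \<in> J \<Longrightarrow> cov (U i) (V j) = 0"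
    and E: "E \<in> sets (PiM J (\<lambda>_. borel))"
  shows "prob {\<omega> \<in> space M. (\<lambda>j\<in>J. U j \<omega> + V j \<omega>) \<in> E} = prob {\<omega> \<in> space M. (\<lambda>j\<in>J. U j \<omega> - V j \<omega>) \<in> E}"
proof -
  have m1: "(\<lambda>\<omega>. \<lambda>j\<in>J. U j \<omega> + V j \<omega>) \<in> measurable M (PiM J (\<lambda>_. borel))"
    using U V by (intro measurable_restrict measurable add) auto
  have m2: "(\<lambda>\<omega>. \<lambda>j\<in>J. U j \<omega> - V j \<omega>) \<in> measurable M (PiM J (\<lambda>_. borel))"
    using U V by (intro measurable_restrict measurable diff) auto
  have "measure (distr M (PiM J (\<lambda>_. borel)) (\<lambda>\<omega>. \<lambda>j\<in>J. U j \<omega> + V j \<omega>)) E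
      = measure (distr M (PiM J (\<lambda>_. borel)) (\<lambda>\<omega>. \<lambda>j\<in>J. U j \<omega> - V j \<omega>)) E"
    using flip_law[where U=U and V=V and J=J, OF U V orth] by simp
  then show ?thesis
    unfolding measure_distr[OF m1 E] measure_distr[OF m2 E]
    by (simp add: vimage_def Int_def conj_commute)
qed

lemma second_moment:
  assumes X: "X \<in> G" and c: "0 < c"
  shows "prob {\<omega> \<in> space M. c < \<bar>X \<omega>\<bar>} \<le> cov X X / c\<^sup>2"
proof -
  have [measurable]: "X \<in> borel_measurable M" by (rule measurable[OF X])
  have "prob {\<omega> \<in> space M. c < \<bar>X \<omega>\<bar>} \<le> prob {\<omega> \<in> space M. \<bar>X \<omega>\<bar> \<ge> c}"
    by (rule finite_measure_mono) auto
  also have "\<dots> \<le> (\<integral>\<omega>. (X \<omega>)\<^sup>2 \<partial>M) / c\<^sup>2"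
    by (rule second_moment_method) (use c integrable_mult[OF X X] in \<open>auto simp: power2_eq_square\<close>)
  finally show ?thesis by (simp add: cov_def power2_eq_square)
qed

end

context kl_eigensystem
begin

abbreviation residual :: "nat \<Rightarrow> real \<Rightarrow> 'a \<Rightarrow> real" where "residual n \<equiv> W (Pos_upto n)"

lemma residual_mem: "t \<in> {a..b} \<Longrightarrow> residual n t \<in> G"
  by (rule W_mem) auto

lemma residual_exceeds_sets:
  assumes "countable D" "D \<subseteq> {a..b}"
  shows "exceeds M (residual n) D c \<in> sets M"
  using assms by (intro exceeds_sets measurable residual_mem) auto

lemma residual_continuous:
  assumes "\<omega> \<in> space M"
  shows "continuous_on {a..b} (\<lambda>t. residual n t \<omega>)"
  unfolding W_def by (intro continuous_intros path_continuous[OF assms] e_continuous) auto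

lemma cov_sum_Z_residual:
  assumes "F \<subseteq> Pos_upto n" "t \<in> {a..b}"
  shows "cov (\<lambda>\<omega>. \<Sum>k\<in>F. c k * Z k \<omega>) (residual n t) = 0"
  using assms by (intro cov_sum_Z_W) auto

section \<open>Convergence in probability, uniformly in time\<close>

definition oscillation :: "real set \<Rightarrow> real \<Rightarrow> (real \<times> real) set" where
  "oscillation D d = {(s, t) \<in> D \<times> D. \<bar>s - t\<bar> < d}"

abbreviation increment :: "(real \<Rightarrow> 'a \<Rightarrow> real) \<Rightarrow> real \<times> real \<Rightarrow> 'a \<Rightarrow> real" where
  "increment X \<equiv> (\<lambda>(s, t) \<omega>. X s \<omega> - X t \<omega>)"

lemma oscillation_countable: "countable D \<Longrightarrow> countable (oscillation D d)"
  unfolding oscillation_def by (rule countable_subset[of _ "D \<times> D"]) auto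

text \<open>Reflecting the residual, \<open>Y = S + W\<close> becomes \<open>S - W = Y - 2 * W\<close> with the same law; thus
  \<open>W\<close> inherits its modulus of continuity in probability from \<open>Y\<close>, uniformly in the truncation.\<close>
lemma reflected_increment_prob:
  assumes D: "countable D" "D \<subseteq> {a..b}"
  shows "prob (exceeds M (increment (\<lambda>t \<omega>. Y t \<omega> - 2 * residual n t \<omega>)) (oscillation D d) c)
    = prob (exceeds M (increment Y) (oscillation D d) c)"
proof -
  let ?J = "oscillation D d"
  define U where "U = (\<lambda>(s, t) \<omega>. \<Sum>k\<in>Pos_upto n. (e k s - e k t) * Z k \<omega>)"
  define V where "V = increment (residual n)"
  have Jab: "fst j \<in> {a..b}" "snd j \<in> {a..b}" if "j \<in> ?J" for j
    using that D by (auto simp: oscillation_def)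
  have U: "U j \<in> G" for j
    unfolding U_def by (cases j) (auto intro!: sum_Z_mem)
  have V: "V j \<in> G" if "j \<in> ?J" for j
    using Jab[OF that] unfolding V_def by (cases j) (auto intro!: diff residual_mem)
  have orth: "cov (U i) (V j) = 0" if "j \<in> ?J" for i j
  proof -
    obtain s t where j: "j = (s, t)" by (cases j)
    have st: "s \<in> {a..b}" "t \<in> {a..b}" using Jab[OF that] j by auto
    have "cov (U i) (residual n r) = 0" if "r \<in> {a..b}" for r
      unfolding U_def using that by (cases i) (simp add: cov_sum_Z_residual)
    then show ?thesis
      unfolding V_def j using cov_diff_right[OF residual_mem[OF st(1)] residual_mem[OF st(2)] U[of i]] st by simp
  qed
  have plus: "U j \<omega> + V j \<omega> = increment Y j \<omega>" for j \<omega>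
    unfolding U_def V_def W_def by (cases j) (simp add: left_diff_distrib sum_subtractf)
  have minus: "U j \<omega> - V j \<omega> = increment (\<lambda>t \<omega>. Y t \<omega> - 2 * residual n t \<omega>) j \<omega>" for j \<omega>
    unfolding U_def V_def W_def by (cases j) (simp add: left_diff_distrib sum_subtractf)
  \<comment> \<open>The exceedance event on path space; its preimage is the exceedance event on
    \<open>M\<close>, so equality of laws becomes equality of probabilities.\<close>
  let ?E = "exceeds (PiM ?J (\<lambda>_. borel)) (\<lambda>j x. x j) ?J c"
  have E: "?E \<in> sets (PiM ?J (\<lambda>_. borel))"
    by (intro exceeds_sets oscillation_countable D measurable_component_singleton)
  have restr: "{\<omega> \<in> space M. (\<lambda>j\<in>?J. X j \<omega>) \<in> ?E} = exceeds M X ?J c" for X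
    by (auto simp: exceeds_def space_PiM)
  show ?thesis
    using flip_prob[where U=U and V=V and J="?J", OF U V orth E] unfolding plus minus restr by simp
qed

text \<open>Every path is uniformly continuous on the compact interval, so the events decrease to
  the empty set as the distance bound tends to 0.\<close>

lemma oscillation_prob_tendsto:
  assumes D: "countable D" "D \<subseteq> {a..b}" and c: "0 < c"
  shows "(\<lambda>m. prob (exceeds M (increment Y) (oscillation D (1 / real (Suc m))) c)) \<longlonglongrightarrow> 0"
proof -
  let ?O = "\<lambda>m. exceeds M (increment Y) (oscillation D (1 / real (Suc m))) c"
  have O: "?O m \<in> sets M" for m
  proof (intro exceeds_sets oscillation_countable D)
    fix j assume "j \<in> oscillation D (1 / real (Suc m))"
    then show "increment Y j \<in> borel_measurable M"
      using D by (cases j) (auto simp: oscillation_def intro!: measurable diff Y_mem)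
  qed
  have "decseq ?O"
  proof (rule decseq_SucI)
    fix m
    have "1 / real (Suc (Suc m)) \<le> 1 / real (Suc m)" by (intro divide_left_mono) auto
    then have "oscillation D (1 / real (Suc (Suc m))) \<subseteq> oscillation D (1 / real (Suc m))"
      unfolding oscillation_def by force
    then show "?O (Suc m) \<subseteq> ?O m" unfolding exceeds_def by blast
  qed
  then have "(\<lambda>m. prob (?O m)) \<longlonglongrightarrow> prob (\<Inter>m. ?O m)"
    using O by (intro finite_Lim_measure_decseq) auto
  moreover have "(\<Inter>m. ?O m) = {}"
  proof (rule ccontr)
    assume "(\<Inter>m. ?O m) \<noteq> {}"
    then obtain \<omega> where \<omega>: "\<And>m. \<omega> \<in> ?O m" by blast
    then have "\<omega> \<in> space M" unfolding exceeds_def by blast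
    then have "uniformly_continuous_on {a..b} (\<lambda>t. Y t \<omega>)"
      by (intro compact_uniformly_continuous path_continuous compact_Icc)
    then obtain d where d: "0 < d" "\<And>s t. s \<in> {a..b} \<Longrightarrow> t \<in> {a..b} \<Longrightarrow> dist t s < d \<Longrightarrow> dist (Y t \<omega>) (Y s \<omega>) < c"
      unfolding uniformly_continuous_on_def using c by blast
    obtain m where m: "1 / real (Suc m) < d" using nat_approx_posE[OF d(1)] .
    obtain s t where st: "s \<in> D" "t \<in> D" "\<bar>s - t\<bar> < 1 / real (Suc m)" "c < \<bar>Y s \<omega> - Y t \<omega>\<bar>"
      using \<omega>[of m] by (auto simp: exceeds_def oscillation_def)
    have "s \<in> {a..b}" "t \<in> {a..b}" using st(1,2) D(2) by auto
    then have "\<bar>Y s \<omega> - Y t \<omega>\<bar> < c"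
      using d(2)[of t s] st(3) m by (simp add: dist_real_def)
    then show False using st(4) by simp
  qed
  ultimately show ?thesis by simp
qed

text \<open>The centres have to lie in \<open>D\<close>, since the residual variance is known to
  vanish only on the support. The closure of \<open>D\<close> is compact and covered by balls about
  points of \<open>D\<close>.\<close>

lemma finite_net:
  assumes D: "D \<subseteq> {a..b}" and d: "0 < d"
  obtains F where "finite F" "F \<subseteq> D" "\<And>t. t \<in> D \<Longrightarrow> \<exists>s\<in>F. \<bar>t - s\<bar> < d"
proof -
  have "bounded D" using bounded_subset[OF bounded_closed_interval D] .
  then have cpt: "compact (closure D)" by simp
  have cover: "closure D \<subseteq> (\<Union>s\<in>D. ball s d)"
  proof
    fix x assume "x \<in> closure D"
    then obtain y where "y \<in> D" "dist y x < d" using d unfolding closure_approachable by blast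
    then show "x \<in> (\<Union>s\<in>D. ball s d)" by auto
  qed
  obtain F where F: "F \<subseteq> D" "finite F" "closure D \<subseteq> (\<Union>s\<in>F. ball s d)"
  proof (rule compactE_image[OF cpt _ cover])
  qed (simp, rule that)
  show ?thesis
  proof (rule that[OF F(2,1)])
    fix t assume "t \<in> D"
    then have "t \<in> (\<Union>s\<in>F. ball s d)" using F(3) closure_subset by blast
    then show "\<exists>s\<in>F. \<bar>t - s\<bar> < d" by (auto simp: dist_real_def abs_minus_commute)
  qed
qed

text \<open>On a finite net, Chebyshev's inequality and the vanishing variances suffice. From a net
  point to \<open>t\<close> the residual changes by half the difference of an increment of
  \<open>Y\<close> and one of the reflected process, hence by at most \<open>c\<close> when neither
  exceeds \<open>c\<close>; this is the origin of the level \<open>2 * c\<close>.\<close>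

lemma residual_prob_tendsto:
  assumes D: "countable D" "D \<subseteq> measure_support \<nu>" and c: "0 < c"
  shows "(\<lambda>n. prob (exceeds M (residual n) D (2 * c))) \<longlonglongrightarrow> 0"
proof (rule LIMSEQ_I)
  fix r :: real assume r: "0 < r"
  have Dab: "D \<subseteq> {a..b}" using D(2) by (auto simp: measure_support_def space_\<nu>)
  \<comment> \<open>The bound \<open>r / 4\<close> is spent twice, on \<open>Y\<close> and on its
    reflection of equal law; the net receives the remaining \<open>r / 2\<close>.\<close>
  obtain m where m: "prob (exceeds M (increment Y) (oscillation D (1 / real (Suc m))) c) < r / 4"
    using order_tendstoD(2)[OF oscillation_prob_tendsto[OF D(1) Dab c], of "r / 4"] r
    unfolding eventually_sequentially by auto
  define d where "d = 1 / real (Suc m)"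
  have d: "0 < d" by (simp add: d_def)
  obtain F where F: "finite F" "F \<subseteq> D" "\<And>t. t \<in> D \<Longrightarrow> \<exists>s\<in>F. \<bar>t - s\<bar> < d"
    by (rule finite_net[OF Dab d]) (rule that)
  have Fab: "F \<subseteq> {a..b}" using F Dab by auto
  have "(\<lambda>n. \<Sum>s\<in>F. cov (residual n s) (residual n s) / c\<^sup>2) \<longlonglongrightarrow> (\<Sum>s\<in>F. 0 / c\<^sup>2)"
    using F D c by (intro tendsto_sum tendsto_divide var_W_tendsto tendsto_const) auto
  then obtain n0 where n0: "\<And>n. n0 \<le> n \<Longrightarrow> (\<Sum>s\<in>F. cov (residual n s) (residual n s) / c\<^sup>2) < r / 2"
    using order_tendstoD(2)[of _ 0 sequentially "r / 2"] r unfolding eventually_sequentially by auto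
  show "\<exists>no. \<forall>n\<ge>no. norm (prob (exceeds M (residual n) D (2 * c)) - 0) < r"
  proof (intro exI[of _ n0] allI impI)
    fix n assume n: "n0 \<le> n"
    let ?Y' = "\<lambda>t \<omega>. Y t \<omega> - 2 * residual n t \<omega>"
    let ?O = "exceeds M (increment Y) (oscillation D d) c"
    let ?O' = "exceeds M (increment ?Y') (oscillation D d) c"
    let ?N = "\<Union>s\<in>F. {\<omega> \<in> space M. c < \<bar>residual n s \<omega>\<bar>}"
    have inc: "increment Y j \<in> borel_measurable M" "increment ?Y' j \<in> borel_measurable M" if "j \<in> oscillation D d" for j
    proof -
      have "fst j \<in> {a..b}" "snd j \<in> {a..b}" using that Dab by (auto simp: oscillation_def)
      then show "increment Y j \<in> borel_measurable M" "increment ?Y' j \<in> borel_measurable M"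
        by (cases j, auto intro!: measurable diff Y_mem scale residual_mem)+
    qed
    have O: "?O \<in> sets M" "?O' \<in> sets M"
      by (rule exceeds_sets[OF oscillation_countable[OF D(1)]], erule inc)+
    have S: "{\<omega> \<in> space M. c < \<bar>residual n s \<omega>\<bar>} \<in> sets M" if "s \<in> F" for s
      using exceeds_sets[of "{s}" "residual n" M c] measurable[OF residual_mem, of s n] that Fab
      by (auto simp: exceeds_def)
    have N: "?N \<in> sets M" using F(1) S by (intro sets.finite_UN) auto
    have "exceeds M (residual n) D (2 * c) \<subseteq> (?N \<union> ?O) \<union> ?O'"
    proof
      fix \<omega> assume "\<omega> \<in> exceeds M (residual n) D (2 * c)"
      then obtain t where \<omega>: "\<omega> \<in> space M" and t: "t \<in> D" "2 * c < \<bar>residual n t \<omega>\<bar>"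
        by (auto simp: exceeds_def)
      obtain s where s: "s \<in> F" "\<bar>t - s\<bar> < d" using F(3)[OF t(1)] by blast
      have ts: "(t, s) \<in> oscillation D d" using s t F by (auto simp: oscillation_def)
      show "\<omega> \<in> (?N \<union> ?O) \<union> ?O'"
      proof (rule ccontr)
        assume "\<omega> \<notin> (?N \<union> ?O) \<union> ?O'"
        then have "\<bar>residual n s \<omega>\<bar> \<le> c" "\<bar>increment Y (t, s) \<omega>\<bar> \<le> c" "\<bar>increment ?Y' (t, s) \<omega>\<bar> \<le> c"
          using \<omega> s(1) ts unfolding exceeds_def by (auto simp: not_less)
        then show False using t(2) by simp
      qed
    qed
    then have "prob (exceeds M (residual n) D (2 * c)) \<le> prob ((?N \<union> ?O) \<union> ?O')"
      by (rule finite_measure_mono) (intro sets.Un N O)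
    also have "\<dots> \<le> prob ?N + prob ?O + prob ?O'"
      using measure_Un_le[of "?N \<union> ?O" M ?O'] measure_Un_le[of ?N M ?O] N O by auto
    also have "prob ?O' = prob ?O" by (rule reflected_increment_prob[OF D(1) Dab])
    also have "prob ?N \<le> (\<Sum>s\<in>F. prob {\<omega> \<in> space M. c < \<bar>residual n s \<omega>\<bar>})"
      by (rule measure_UNION_le[OF F(1) S])
    also have "\<dots> \<le> (\<Sum>s\<in>F. cov (residual n s) (residual n s) / c\<^sup>2)"
      using Fab by (intro sum_mono second_moment residual_mem c) auto
    finally show "norm (prob (exceeds M (residual n) D (2 * c)) - 0) < r"
      using n0[OF n] m unfolding d_def[symmetric] by simp
  qed
qed

text \<open>Levy's maximal inequality for the residuals, read backwards in the truncation: on the event that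
  \<open>m\<close> is the last index of exceedance, reflecting \<open>W n - W m\<close> turns \<open>W n\<close> into \<open>2 * W m - W n\<close>, and
  one of these two exceeds the level whenever \<open>W m\<close> does.\<close>
lemma last_exceedance_prob:
  fixes c :: real
  assumes D: "countable D" "D \<subseteq> {a..b}" and nm: "n \<le> m" "m \<le> L"
  defines "B \<equiv> \<lambda>j. exceeds M (residual j) D c"
  defines "E \<equiv> B m - (\<Union>j\<in>{m<..L}. B j)"
  shows "prob E \<le> 2 * prob (E \<inter> B n)"
proof -
  let ?J = "{n..L} \<times> D"
  \<comment> \<open>\<open>residual j\<close> is \<open>residual (max j m)\<close> plus
    \<open>V\<close>, where \<open>V\<close> collects the terms with indices above \<open>j\<close>
    up to \<open>m\<close> and is 0 for \<open>j \<ge> m\<close>. Reversing the sign of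
    \<open>V\<close> leaves all residuals from \<open>m\<close> on unchanged, and with them the
    event \<open>E\<close>. The two families are uncorrelated because \<open>U\<close> is truncated
    at \<open>m\<close> or later.\<close>
  define U where "U = (\<lambda>(j, t). residual (max j m) t)"
  define V where "V = (\<lambda>(j, t) \<omega>. \<Sum>k\<in>Pos_upto m - Pos_upto j. e k t * Z k \<omega>)"
  have U: "U j \<in> G" if "j \<in> ?J" for j
    using that D by (cases j) (auto simp: U_def intro!: residual_mem)
  have V: "V j \<in> G" for j
    unfolding V_def by (cases j) (auto intro!: sum_Z_mem)
  have orth: "cov (U i) (V j) = 0" if "i \<in> ?J" for i j
  proof -
    obtain i' s where i: "i = (i', s)" by (cases i)
    obtain j' t where j: "j = (j', t)" by (cases j)
    have "cov (V j) (U i) = 0"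
      unfolding U_def V_def i j using that D i by (auto intro!: cov_sum_Z_residual)
    then show ?thesis by (simp add: cov_commute)
  qed
  have split: "residual j t \<omega> = residual m t \<omega> + V (j, t) \<omega>" if "j < m" for j t \<omega>
  proof -
    have "(\<Sum>k\<in>Pos_upto m. e k t * Z k \<omega>) = (\<Sum>k\<in>Pos_upto m - Pos_upto j. e k t * Z k \<omega>) + (\<Sum>k\<in>Pos_upto j. e k t * Z k \<omega>)"
      using that by (intro sum.subset_diff) auto
    then show ?thesis by (simp add: W_def V_def)
  qed
  have V0: "V (j, t) \<omega> = 0" if "m \<le> j" for j t \<omega>
  proof -
    have "Pos_upto m - Pos_upto j = {}" using that by auto
    then show ?thesis unfolding V_def by (simp only: prod.case sum.empty)
  qed
  define X where "X = (\<lambda>(j, t). residual j t)"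
  define X' where "X' = (\<lambda>(j, t) \<omega>. if j < m then 2 * residual m t \<omega> - residual j t \<omega> else residual j t \<omega>)"
  have plus: "U j \<omega> + V j \<omega> = X j \<omega>" for j \<omega>
  proof (cases j)
    case (Pair i t)
    then show ?thesis using split[of i t \<omega>] V0[of i t \<omega>] by (cases "i < m") (auto simp: U_def X_def max_def)
  qed
  have minus: "U j \<omega> - V j \<omega> = X' j \<omega>" for j \<omega>
  proof (cases j)
    case (Pair i t)
    then show ?thesis using split[of i t \<omega>] V0[of i t \<omega>] by (cases "i < m") (auto simp: U_def X'_def max_def)
  qed
  define P :: "(nat \<times> real \<Rightarrow> real) measure" where "P = PiM ?J (\<lambda>_. borel)"
  define C where "C j = exceeds P (\<lambda>t x. x (j, t)) D c" for j
  have C: "C j \<in> sets P" if "j \<in> {n..L}" for j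
    unfolding C_def P_def using that by (intro exceeds_sets D measurable_component_singleton) auto
  \<comment> \<open>The event \<open>E \<inter> B n\<close> in path space; its preimage under the
    reflected family is \<open>?R\<close>.\<close>
  define A where "A = (C m - (\<Union>j\<in>{m<..L}. C j)) \<inter> C n"
  have A: "A \<in> sets (PiM ?J (\<lambda>_. borel))"
    unfolding A_def P_def[symmetric] using nm by (intro sets.Int sets.Diff sets.finite_UN C) auto
  have restr: "(\<lambda>j\<in>?J. Q j \<omega>) \<in> C j \<longleftrightarrow> (\<exists>t\<in>D. c < \<bar>Q (j, t) \<omega>\<bar>)" if "j \<in> {n..L}" for Q :: "nat \<times> real \<Rightarrow> 'a \<Rightarrow> real" and j \<omega>
    using that by (auto simp: C_def exceeds_def P_def space_PiM)
  have restr_A: "{\<omega> \<in> space M. (\<lambda>j\<in>?J. Q j \<omega>) \<in> A} =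
      {\<omega> \<in> space M. (\<exists>t\<in>D. c < \<bar>Q (m, t) \<omega>\<bar>) \<and> \<not> (\<exists>j\<in>{m<..L}. \<exists>t\<in>D. c < \<bar>Q (j, t) \<omega>\<bar>) \<and> (\<exists>t\<in>D. c < \<bar>Q (n, t) \<omega>\<bar>)}"
    for Q :: "nat \<times> real \<Rightarrow> 'a \<Rightarrow> real"
    unfolding A_def using nm by (auto simp: restr)
  have EX: "{\<omega> \<in> space M. (\<lambda>j\<in>?J. X j \<omega>) \<in> A} = E \<inter> B n"
    unfolding restr_A E_def B_def exceeds_def X_def by auto
  let ?R = "{\<omega> \<in> space M. (\<lambda>j\<in>?J. X' j \<omega>) \<in> A}"
  have flip: "prob (E \<inter> B n) = prob ?R"
    using flip_prob[where U=U and V=V and J="?J", OF U V orth A] unfolding plus minus EX .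
  have B_sets: "B j \<in> sets M" for j unfolding B_def by (rule residual_exceeds_sets[OF D])
  have E_sets: "E \<in> sets M" unfolding E_def using B_sets by auto
  have R_sets: "?R \<in> sets M"
  proof -
    have "(\<lambda>\<omega>. \<lambda>j\<in>?J. U j \<omega> - V j \<omega>) \<in> measurable M (PiM ?J (\<lambda>_. borel))"
      using U V by (intro measurable_restrict measurable diff) auto
    from measurable_sets[OF this A] show ?thesis
      unfolding minus by (simp add: vimage_def Int_def conj_commute)
  qed
  have "E \<subseteq> (E \<inter> B n) \<union> ?R"
  proof
    fix \<omega> assume \<omega>: "\<omega> \<in> E"
    show "\<omega> \<in> (E \<inter> B n) \<union> ?R"
    proof (cases "\<omega> \<in> B n")
      case False
      have \<omega>M: "\<omega> \<in> space M" and last: "\<not> (\<exists>j\<in>{m<..L}. \<exists>t\<in>D. c < \<bar>residual j t \<omega>\<bar>)"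
        using \<omega> by (auto simp: E_def B_def exceeds_def)
      obtain t where t: "t \<in> D" "c < \<bar>residual m t \<omega>\<bar>"
        using \<omega> by (auto simp: E_def B_def exceeds_def)
      have small: "\<bar>residual n t \<omega>\<bar> \<le> c" using False \<omega>M t(1) by (auto simp: B_def exceeds_def not_less)
      then have "n \<noteq> m" using t(2) by auto
      then have "n < m" using nm by simp
      moreover have "c < \<bar>2 * residual m t \<omega> - residual n t \<omega>\<bar>" using small t(2) by arith
      ultimately have "\<omega> \<in> ?R"
        unfolding restr_A X'_def using \<omega>M t last by auto
      then show ?thesis by simp
    qed (use \<omega> in simp)
  qed
  then have "prob E \<le> prob ((E \<inter> B n) \<union> ?R)"
    using E_sets B_sets R_sets by (intro finite_measure_mono) auto
  also have "\<dots> \<le> prob (E \<inter> B n) + prob ?R"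
    using E_sets B_sets R_sets by (intro measure_Un_le) auto
  finally show ?thesis using flip by simp
qed

text \<open>Read from \<open>L\<close> down to \<open>n\<close>, the residuals are partial sums of
  uncorrelated blocks ending in \<open>residual n\<close>, so the last exceedance plays the part of
  the first one in Levy's argument. The events \<open>E m\<close> are disjoint, which sums their
  bounds to one that does not depend on \<open>L\<close>.\<close>

lemma residual_maximal_inequality:
  fixes c :: real
  assumes D: "countable D" "D \<subseteq> {a..b}"
  defines "B \<equiv> \<lambda>j. exceeds M (residual j) D c"
  shows "prob (\<Union>m\<in>{n..L}. B m) \<le> 2 * prob (B n)"
proof -
  define E where "E m = B m - (\<Union>j\<in>{m<..L}. B j)" for m
  have B: "B j \<in> sets M" for j unfolding B_def by (rule residual_exceeds_sets[OF D])
  have E: "E j \<in> sets M" for j unfolding E_def using B by auto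
  have "(\<Union>m\<in>{n..L}. B m) \<subseteq> (\<Union>m\<in>{n..L}. E m)"
  proof
    fix \<omega> assume "\<omega> \<in> (\<Union>m\<in>{n..L}. B m)"
    then have ne: "{m \<in> {n..L}. \<omega> \<in> B m} \<noteq> {}" by auto
    define m where "m = Max {m \<in> {n..L}. \<omega> \<in> B m}"
    have "m \<in> {m \<in> {n..L}. \<omega> \<in> B m}" unfolding m_def using ne by (intro Max_in) auto
    moreover have "\<omega> \<notin> B j" if "j \<in> {m<..L}" for j
    proof
      assume "\<omega> \<in> B j"
      then have "j \<in> {m \<in> {n..L}. \<omega> \<in> B m}" using that calculation by auto
      then have "j \<le> m" unfolding m_def by (intro Max_ge) auto
      then show False using that by simp
    qed
    ultimately show "\<omega> \<in> (\<Union>m\<in>{n..L}. E m)" unfolding E_def by blast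
  qed
  then have "prob (\<Union>m\<in>{n..L}. B m) \<le> prob (\<Union>m\<in>{n..L}. E m)"
    using E by (intro finite_measure_mono) auto
  also have "\<dots> \<le> (\<Sum>m\<in>{n..L}. prob (E m))"
    using E by (intro measure_UNION_le) auto
  also have "\<dots> \<le> (\<Sum>m\<in>{n..L}. 2 * prob (E m \<inter> B n))"
    using last_exceedance_prob[OF D, of n _ L c] unfolding E_def B_def by (intro sum_mono) auto
  also have "\<dots> = 2 * prob (\<Union>m\<in>{n..L}. E m \<inter> B n)"
  proof -
    have "disjoint_family_on (\<lambda>m. E m \<inter> B n) {n..L}"
      unfolding disjoint_family_on_def
    proof (intro ballI impI)
      fix i j assume "i \<in> {n..L}" "j \<in> {n..L}" "i \<noteq> j"
      then show "E i \<inter> B n \<inter> (E j \<inter> B n) = {}"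
        unfolding E_def by (cases "i < j") auto
    qed
    then have "prob (\<Union>m\<in>{n..L}. E m \<inter> B n) = (\<Sum>m\<in>{n..L}. prob (E m \<inter> B n))"
      using E B by (intro finite_measure_finite_Union) auto
    then show ?thesis by (simp add: sum_distrib_left)
  qed
  also have "\<dots> \<le> 2 * prob (B n)"
    using B by (intro mult_left_mono finite_measure_mono) auto
  finally show ?thesis .
qed

text \<open>Letting \<open>L\<close> grow in the maximal inequality bounds the probability of any
  exceedance from \<open>n\<close> on by \<open>2 * prob (B n)\<close>. This tends to 0, so
  exceedance at infinitely many indices is a null event.\<close>

lemma residual_AE_eventually_le:
  assumes D: "countable D" "D \<subseteq> measure_support \<nu>" and c: "0 < c"
  shows "AE \<omega> in M. \<exists>n. \<forall>m\<ge>n. \<forall>t\<in>D. \<bar>residual m t \<omega>\<bar> \<le> c"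
proof -
  have Dab: "D \<subseteq> {a..b}" using D(2) by (auto simp: measure_support_def space_\<nu>)
  define B where "B j = exceeds M (residual j) D c" for j
  have B: "B j \<in> sets M" for j unfolding B_def by (rule residual_exceeds_sets[OF D(1) Dab])
  \<comment> \<open>The level \<open>c / 2\<close> compensates the factor 2 in
    \<open>residual_prob_tendsto\<close>.\<close>
  have B_lim: "(\<lambda>n. 2 * prob (B n)) \<longlonglongrightarrow> 0"
    using tendsto_mult_right_zero[OF residual_prob_tendsto[OF D, of "c / 2"], of 2] c by (simp add: B_def)
  have tail: "prob (\<Union>m\<in>{n..}. B m) \<le> 2 * prob (B n)" for n
  proof -
    have "(\<lambda>L. prob (\<Union>m\<in>{n..L}. B m)) \<longlonglongrightarrow> prob (\<Union>L. \<Union>m\<in>{n..L}. B m)"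
      using B by (intro finite_Lim_measure_incseq) (force simp: incseq_def)+
    then have "prob (\<Union>L. \<Union>m\<in>{n..L}. B m) \<le> 2 * prob (B n)"
      using residual_maximal_inequality[OF D(1) Dab, of c n] unfolding B_def by (intro LIMSEQ_le_const2) auto
    moreover have "(\<Union>L. \<Union>m\<in>{n..L}. B m) = (\<Union>m\<in>{n..}. B m)"
      by (intro equalityI subsetI) (auto, meson atLeastAtMost_iff order_refl)
    ultimately show ?thesis by simp
  qed
  let ?N = "\<Inter>n. \<Union>m\<in>{n..}. B m"
  have N: "?N \<in> sets M" using B by (intro sets.countable_INT sets.countable_UN') auto
  have "prob ?N \<le> 2 * prob (B n)" for n
  proof -
    have "prob ?N \<le> prob (\<Union>m\<in>{n..}. B m)"
      using B by (intro finite_measure_mono sets.countable_UN') auto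
    then show ?thesis using tail[of n] by simp
  qed
  then have "prob ?N \<le> 0" by (intro LIMSEQ_le_const[OF B_lim]) blast
  then have "prob ?N = 0" by (rule antisym) (rule measure_nonneg)
  then have "AE \<omega> in M. \<omega> \<notin> ?N" using N prob_eq_0 by blast
  then show ?thesis
  proof (rule AE_mp, intro AE_I2 impI)
    fix \<omega> assume \<omega>: "\<omega> \<in> space M" "\<omega> \<notin> ?N"
    then obtain n where "\<And>m. n \<le> m \<Longrightarrow> \<omega> \<notin> B m" by auto
    then show "\<exists>n. \<forall>m\<ge>n. \<forall>t\<in>D. \<bar>residual m t \<omega>\<bar> \<le> c"
      using \<omega>(1) by (intro exI[of _ n]) (auto simp: B_def exceeds_def not_less)
  qed
qed

text \<open>Measurability calls for a countable set, so the estimate is made on a countable dense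
  subset of the support, for all levels \<open>1 / real (Suc i)\<close> on one event of probability
  1. Continuity of each residual in \<open>t\<close> carries the non-strict bounds over to the whole
  support.\<close>

lemma residual_AE_uniform:
  "AE \<omega> in M. uniform_limit (measure_support \<nu>) (\<lambda>n t. residual n t \<omega>) (\<lambda>_. 0) sequentially"
proof -
  let ?C = "measure_support \<nu>"
  obtain D where D: "countable D" "D \<subseteq> ?C" "?C \<subseteq> closure D"
    using separable[of ?C] by metis
  have Dab: "D \<subseteq> {a..b}" and Cab: "?C \<subseteq> {a..b}" using D(2) by (auto simp: measure_support_def space_\<nu>)
  have "AE \<omega> in M. \<forall>i. \<exists>n. \<forall>m\<ge>n. \<forall>t\<in>D. \<bar>residual m t \<omega>\<bar> \<le> 1 / real (Suc i)"
    unfolding AE_all_countable by (intro allI residual_AE_eventually_le D) simp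
  then show ?thesis
  proof (rule AE_mp, intro AE_I2 impI uniform_limitI)
    fix \<omega> and r :: real
    assume \<omega>: "\<omega> \<in> space M" and *: "\<forall>i. \<exists>n. \<forall>m\<ge>n. \<forall>t\<in>D. \<bar>residual m t \<omega>\<bar> \<le> 1 / real (Suc i)" and r: "0 < r"
    obtain i where i: "1 / real (Suc i) < r" using nat_approx_posE[OF r] .
    obtain n where n: "\<And>m t. n \<le> m \<Longrightarrow> t \<in> D \<Longrightarrow> \<bar>residual m t \<omega>\<bar> \<le> 1 / real (Suc i)" using * by blast
    have "\<bar>residual m t \<omega>\<bar> \<le> 1 / real (Suc i)" if m: "n \<le> m" and t: "t \<in> ?C" for m t
    proof -
      have "t \<in> closure D" using D(3) t by blast
      then obtain x where "(\<forall>k. x k \<in> D) \<and> x \<longlonglongrightarrow> t"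
        unfolding closure_sequential by (elim exE)
      then have x: "\<And>k. x k \<in> D" "x \<longlonglongrightarrow> t" by auto
      have "(\<lambda>k. residual m (x k) \<omega>) \<longlonglongrightarrow> residual m t \<omega>"
        using residual_continuous[OF \<omega>, of m] x t Dab Cab unfolding continuous_on_sequentially
        by (auto simp: comp_def subset_iff)
      then have "(\<lambda>k. \<bar>residual m (x k) \<omega>\<bar>) \<longlonglongrightarrow> \<bar>residual m t \<omega>\<bar>" by (rule tendsto_rabs)
      then show ?thesis using n[OF m x(1)] by (intro LIMSEQ_le_const2) auto
    qed
    then show "\<forall>\<^sub>F m in sequentially. \<forall>t\<in>?C. dist (residual m t \<omega>) 0 < r"
      unfolding eventually_sequentially using i by (intro exI[of _ n]) (force simp: dist_real_def)
  qed
qed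

text \<open>This accounts for the indices outside \<open>Pos\<close>: variance 0 forces
  \<open>Z k = 0\<close> almost surely, and countably many null sets are joined.\<close>

lemma Z_AE_0:
  "AE \<omega> in M. \<forall>k\<in>index_set N. lam k = 0 \<longrightarrow> Z k \<omega> = 0"
proof -
  have "AE \<omega> in M. lam k = 0 \<longrightarrow> Z k \<omega> = 0" if k: "k \<in> index_set N" for k
  proof (cases "lam k = 0")
    case True
    have "(\<integral>\<omega>. Z k \<omega> * Z k \<omega> \<partial>M) = 0"
      using cov_Z_Z[OF k k] True by (simp add: cov_def)
    then have "AE \<omega> in M. Z k \<omega> * Z k \<omega> = 0"
      using integrable_mult[OF Z_mem[OF k] Z_mem[OF k]] by (subst (asm) integral_nonneg_eq_0_iff_AE) auto
    then show ?thesis by simp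
  qed simp
  then show ?thesis by (subst AE_ball_countable) auto
qed

text \<open>Terms with \<open>lam k = 0\<close> vanish whatever value the representative
  \<open>e k\<close> takes at \<open>t\<close>, so the partial sum over all listed indices is
  \<open>Y t\<close> minus the residual. For finite \<open>N\<close> these partial sums are
  eventually constant in \<open>n\<close>.\<close>

lemma expansion_AE_uniform:
  "AE \<omega> in M. uniform_limit (measure_support \<nu>)
     (\<lambda>n t. \<Sum>k\<in>{k \<in> index_set N. k \<le> n}. Z k \<omega> * e k t) (\<lambda>t. Y t \<omega>) sequentially"
  using residual_AE_uniform Z_AE_0
proof eventually_elim
  case (elim \<omega>)
  have "(\<Sum>k\<in>{k \<in> index_set N. k \<le> n}. Z k \<omega> * e k t) = Y t \<omega> - residual n t \<omega>" for n t
  proof -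
    have "(\<Sum>k\<in>Pos_upto n. e k t * Z k \<omega>) = (\<Sum>k\<in>{k \<in> index_set N. k \<le> n}. Z k \<omega> * e k t)"
    proof (rule sum.mono_neutral_cong_left)
      show "\<forall>k\<in>{k \<in> index_set N. k \<le> n} - Pos_upto n. Z k \<omega> * e k t = 0"
        using elim(2) lam_nonneg by (force simp: Pos_def)
    qed (auto simp: Pos_def)
    then show ?thesis by (simp add: W_def)
  qed
  moreover have "uniform_limit (measure_support \<nu>) (\<lambda>n t. Y t \<omega> - residual n t \<omega>) (\<lambda>t. Y t \<omega> - 0) sequentially"
    by (intro uniform_limit_intros elim(1))
  ultimately show ?case by simp
qed

end

theorem theorem3p1:
  fixes M :: "'w measure" and Y :: "real \<Rightarrow> 'w \<Rightarrow> real"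
    and a b :: real and R :: "real \<Rightarrow> real \<Rightarrow> real"
    and \<nu> :: "real measure" and C :: "real set"
    and N :: enat and lam :: "nat \<Rightarrow> real" and e :: "nat \<Rightarrow> real \<Rightarrow> real"
    and Z :: "nat \<Rightarrow> 'w \<Rightarrow> real"
  assumes "prob_space M"
    and "a < b"
    and "continuous_process M {a..b} Y"
    and "centered_gaussian_process M {a..b} Y"
    and "\<And>s t. s \<in> {a..b} \<Longrightarrow> t \<in> {a..b} \<Longrightarrow> R s t = (\<integral>\<omega>. Y s \<omega> * Y t \<omega> \<partial>M)"
    and "sets \<nu> = sets (restrict_space borel {a..b})"
    and "finite_measure \<nu>"
    and "C = measure_support \<nu>"
    and "eigensystem \<nu> R N lam e"
    and "\<And>k \<omega>. Z k \<omega> = (\<integral>s. Y s \<omega> * e k s \<partial>\<nu>)"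
  shows "(AE \<omega> in M. uniform_limit C (\<lambda>n t. \<Sum>k\<in>{k \<in> index_set N. k \<le> n}. Z k \<omega> * e k t)
            (\<lambda>t. Y t \<omega>) sequentially) \<and>
         prob_space.indep_vars M (\<lambda>_. borel) Z (index_set N) \<and>
         (\<forall>k\<in>index_set N. centered_normal M (Z k) \<and> (\<integral>\<omega>. (Z k \<omega>)\<^sup>2 \<partial>M) = lam k)"
proof -
  interpret kl_eigensystem M Y a b R \<nu> N lam e
    by (intro kl_eigensystem.intro kl_setting.intro kl_setting_axioms.intro kl_eigensystem_axioms.intro assms)
  have Z: "Z = (\<lambda>k. I (e k))"
    using assms(10) by (intro ext) (simp add: I_def)
  have "indep_vars (\<lambda>_. borel) Z (index_set N)"
    unfolding Z by (rule uncorrelated_indep) (auto simp: Z_mem cov_Z_Z)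
  moreover have "centered_normal M (Z k)" if "k \<in> index_set N" for k
    unfolding Z by (rule normal[OF Z_mem[OF that]])
  moreover have "(\<integral>\<omega>. (Z k \<omega>)\<^sup>2 \<partial>M) = lam k" if "k \<in> index_set N" for k
    using cov_Z_Z[OF that that] by (simp add: Z cov_def power2_eq_square)
  ultimately show ?thesis
    using expansion_AE_uniform unfolding Z assms(8) by blast
qed

end
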